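(* Let $\Gamma$ be a finite, simple and connected graph with first Betti number $b_1$, and let $C_2(\Gamma)$ be its unordered $2$-particle configuration space. Then the Borel--Moore homology of $C_2(\Gamma)$ with integer coefficients is given by $$ H^{BM}_{n}(C_2(\Gamma)) \cong \begin{cases} \mathbb{Z}^{\frac{b_1(b_1-1)}{2}}, & n=2,\\ (\mathbb{Z}/2\mathbb{Z})^{b_1}, & n=1,\\ 0, & \text{otherwise}. \end{cases} $$
   Context: A graph $\Gamma$ is regarded as a topological space, namely the $1$-dimensional CW complex whose $0$-cells are the vertices and whose $1$-cells are the edges. Simple means that there are no loops and no multiple edges. The first Betti number of a finite connected graph is $b_1=|E(\Gamma)|-|V(\Gamma)|+1$. Let $\operatorname{Sym}^2(\Gamma)=(\Gamma\times\Gamma)/\sim$ be the quotient space in which $(x_1,y_1)\sim(x_2,y_2)$ if and only if $(x_1,y_1)=(x_2,y_2)$ or $(x_1,y_1)=(y_2,x_2)$. Let $\Delta$ denote the image in $\operatorname{Sym}^2(\Gamma)$ of the diagonal $\{(a,a)\mid a\in\Gamma\}\subseteq \Gamma\times\Gamma$. The unordered $2$-particle configuration space is $C_2(\Gamma)=\operatorname{Sym}^2(\Gamma)\setminus\Delta$. $H^{BM}_n$ denotes Borel--Moore homology with integer coefficients, i.e. the homology of the complex of locally finite singular chains: possibly infinite formal sums of singular simplices such that every compact subset meets only finitely many simplices with nonzero coefficient. *)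

theory Defs
  imports "HOL-Homology.Homology" "Graph_Theory.Graph_Theory"
begin

section \<open>Graphs\<close>

text \<open>
  A finite simple graph is a \<^locale>\<open>pair_graph\<close>, i.e. a finite vertex set with a symmetric
  irreflexive relation \<^const>\<open>parcs\<close>. An undirected edge is thus represented by two opposite arcs.
\<close>

definition edge_set :: "'v pair_pre_digraph \<Rightarrow> 'v set set" where
  "edge_set G = (\<lambda>(u, v). {u, v}) ` parcs G"

text \<open>
  The subtraction on \<^typ>\<open>nat\<close> does not truncate for connected graphs, as these satisfy
  \<open>card (pverts G) \<le> card (edge_set G) + 1\<close>.
\<close>

definition first_betti :: "'v pair_pre_digraph \<Rightarrow> nat" where
  "first_betti G = card (edge_set G) + 1 - card (pverts G)"

text \<open>
  The 1-dimensional CW complex of a graph is realised in real space with one coordinate for every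
  vertex: the 0-cells are the unit vectors, and the closed 1-cell of an edge \<open>{u, v}\<close> is the
  segment joining the unit vectors of \<open>u\<close> and \<open>v\<close>.
\<close>

definition unit_vec :: "'v \<Rightarrow> 'v \<Rightarrow> real" where
  "unit_vec v = (\<lambda>w. if w = v then 1 else 0)"

definition edge_point :: "'v \<Rightarrow> 'v \<Rightarrow> real \<Rightarrow> 'v \<Rightarrow> real" where
  "edge_point u v t = (\<lambda>w. (1 - t) * unit_vec u w + t * unit_vec v w)"

definition graph_space :: "'v pair_pre_digraph \<Rightarrow> ('v \<Rightarrow> real) topology" where
  "graph_space G = subtopology (powertop_real UNIV)
     (unit_vec ` pverts G \<union> {edge_point u v t | u v t. (u, v) \<in> parcs G \<and> 0 \<le> t \<and> t \<le> 1})"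

text \<open>
  The following facts confirm that this is the CW complex in question: the space is a quotient of
  the disjoint union of its closed cells, whose attaching maps send the ends of a 1-cell to the
  two vertices of the edge. Two points of the cells have the same image only if they are
  identified by these attaching maps, or by the two parametrisations \<open>(u, v)\<close>, \<open>(v, u)\<close>
  of the same 1-cell.
\<close>

lemma edge_point_ends: "edge_point u v 0 = unit_vec u" "edge_point u v 1 = unit_vec v"
  by (simp_all add: edge_point_def)

lemma unit_vec_eq_iff: "unit_vec u = unit_vec v \<longleftrightarrow> u = v"
  by (metis unit_vec_def zero_neq_one)

lemma edge_point_swap: "edge_point v u t = edge_point u v (1 - t)"
  by (simp add: edge_point_def fun_eq_iff)

lemma edge_point_neq_unit_vec:
  assumes "u \<noteq> v" "0 < t" "t < 1"
  shows "edge_point u v t \<noteq> unit_vec w"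
proof
  assume "edge_point u v t = unit_vec w"
  then have "edge_point u v t u = unit_vec w u" "edge_point u v t v = unit_vec w v"
    by simp_all
  then show False
    using assms by (auto simp: edge_point_def unit_vec_def split: if_splits)
qed

lemma edge_point_eq_iff:
  assumes "u \<noteq> v" "0 < t" "t < 1" "x \<noteq> y" "0 < s" "s < 1"
  shows "edge_point u v t = edge_point x y s \<longleftrightarrow>
    u = x \<and> v = y \<and> t = s \<or> u = y \<and> v = x \<and> t = 1 - s"
proof
  assume eq: "edge_point u v t = edge_point x y s"
  then have "edge_point u v t w = edge_point x y s w" for w
    by simp
  from this[of u] this[of v] this[of x] this[of y]
  show "u = x \<and> v = y \<and> t = s \<or> u = y \<and> v = x \<and> t = 1 - s"
    using assms by (auto simp: edge_point_def unit_vec_def split: if_splits)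
qed (auto simp: edge_point_def fun_eq_iff)

lemma quotient_map_cells_graph_space:
  assumes "pair_graph G"
  shows "quotient_map
    (sum_topology (\<lambda>c. top_of_set (case c of Inl v \<Rightarrow> {0} | Inr a \<Rightarrow> {0..1}))
      (Inl ` pverts G \<union> Inr ` parcs G))
    (graph_space G)
    (\<lambda>(c, t). case c of Inl v \<Rightarrow> unit_vec v | Inr (u, v) \<Rightarrow> edge_point u v t)"
    (is "quotient_map (sum_topology ?X ?I) _ ?f")
proof (rule continuous_closed_imp_quotient_map)
  interpret pair_graph G by fact
  have fin: "finite ?I"
    using pair_finite_verts pair_finite_arcs by simp
  let ?S = "unit_vec ` pverts G \<union> {edge_point u v t | u v t. (u, v) \<in> parcs G \<and> 0 \<le> t \<and> t \<le> 1}"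
  have cell: "continuous_map (?X c) (graph_space G) (\<lambda>t. ?f (c, t))" if "c \<in> ?I" for c
  proof -
    have "?f (c, t) \<in> ?S" if "t \<in> topspace (?X c)" for t
      using that \<open>c \<in> ?I\<close> by (auto split: sum.splits)
    moreover have "continuous_map (?X c) (powertop_real UNIV) (\<lambda>t. ?f (c, t))"
      by (auto simp: continuous_map_componentwise_UNIV edge_point_def split: sum.splits prod.splits
          intro!: continuous_intros)
    ultimately show ?thesis
      unfolding graph_space_def continuous_map_in_subtopology by blast
  qed
  show cont: "continuous_map (sum_topology ?X ?I) (graph_space G) ?f"
    unfolding continuous_map_def
  proof (intro conjI allI impI)
    show "?f \<in> topspace (sum_topology ?X ?I) \<rightarrow> topspace (graph_space G)"
      using cell unfolding continuous_map_def by (fastforce simp: Pi_iff)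
  next
    fix U assume U: "openin (graph_space G) U"
    show "openin (sum_topology ?X ?I) {x \<in> topspace (sum_topology ?X ?I). ?f x \<in> U}"
      unfolding openin_sum_topology
    proof (intro conjI ballI)
      fix c assume c: "c \<in> ?I"
      have "openin (?X c) {t \<in> topspace (?X c). ?f (c, t) \<in> U}"
        using cell[OF c] U unfolding continuous_map_def by blast
      moreover have "{t. (c, t) \<in> {x \<in> topspace (sum_topology ?X ?I). ?f x \<in> U}}
          = {t \<in> topspace (?X c). ?f (c, t) \<in> U}"
        using c by auto
      ultimately show "openin (?X c) {t. (c, t) \<in> {x \<in> topspace (sum_topology ?X ?I). ?f x \<in> U}}"
        by simp
    qed auto
  qed
  have haus: "Hausdorff_space (graph_space G)"
    unfolding graph_space_def
    by (intro Hausdorff_space_subtopology) (simp add: Hausdorff_space_product_topology)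
  show "closed_map (sum_topology ?X ?I) (graph_space G) ?f"
    unfolding closed_map_def
  proof (intro allI impI)
    fix C assume C: "closedin (sum_topology ?X ?I) C"
    have "closedin (graph_space G) ((\<lambda>t. ?f (c, t)) ` {t. (c, t) \<in> C})" if c: "c \<in> ?I" for c
    proof -
      have "compact_space (?X c)"
        by (auto simp: compact_space_subtopology split: sum.splits)
      then have "closed_map (?X c) (graph_space G) (\<lambda>t. ?f (c, t))"
        using T1_Spaces.continuous_imp_closed_map[OF cell[OF c] _ haus] by blast
      moreover have "closedin (?X c) {t. (c, t) \<in> C}"
        using C c unfolding closedin_sum_topology by blast
      ultimately show ?thesis
        unfolding closed_map_def by blast
    qed
    then have "closedin (graph_space G) (\<Union>c\<in>?I. (\<lambda>t. ?f (c, t)) ` {t. (c, t) \<in> C})"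
      using fin by (intro closedin_Union) auto
    moreover have "C \<subseteq> ?I \<times> UNIV"
      using closedin_subset[OF C] by auto
    then have "?f ` C = (\<Union>c\<in>?I. (\<lambda>t. ?f (c, t)) ` {t. (c, t) \<in> C})"
      by (force simp: image_iff)
    ultimately show "closedin (graph_space G) (?f ` C)"
      by simp
  qed
  show "?f ` topspace (sum_topology ?X ?I) = topspace (graph_space G)"
  proof
    show "?f ` topspace (sum_topology ?X ?I) \<subseteq> topspace (graph_space G)"
      using cont continuous_map_image_subset_topspace by blast
    show "topspace (graph_space G) \<subseteq> ?f ` topspace (sum_topology ?X ?I)"
    proof
      fix x assume "x \<in> topspace (graph_space G)"
      then consider v where "v \<in> pverts G" "x = ?f (Inl v, 0)"
        | u v t where "(u, v) \<in> parcs G" "0 \<le> t" "t \<le> 1" "x = ?f (Inr (u, v), t)"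
        by (auto simp: graph_space_def)
      then show "x \<in> ?f ` topspace (sum_topology ?X ?I)"
      proof cases
        case 1
        then show ?thesis by (intro image_eqI[of _ _ "(Inl v, 0)"]) auto
      next
        case 2
        then show ?thesis by (intro image_eqI[of _ _ "(Inr (u, v), t)"]) auto
      qed
    qed
  qed
qed


section \<open>Unordered configuration spaces of two points\<close>

definition quotient_topology :: "'a topology \<Rightarrow> ('a \<times> 'a) set \<Rightarrow> 'a set topology" where
  "quotient_topology X r = topology
     (\<lambda>U. U \<subseteq> topspace X // r \<and> openin X {x \<in> topspace X. r `` {x} \<in> U})"

lemma openin_quotient_topology:
  "openin (quotient_topology X r) U \<longleftrightarrow>
     U \<subseteq> topspace X // r \<and> openin X {x \<in> topspace X. r `` {x} \<in> U}"
proof -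
  have Int: "{x \<in> topspace X. r `` {x} \<in> S \<inter> T}
      = {x \<in> topspace X. r `` {x} \<in> S} \<inter> {x \<in> topspace X. r `` {x} \<in> T}" for S T
    by auto
  have Un: "{x \<in> topspace X. r `` {x} \<in> \<Union>\<K>} = (\<Union>S\<in>\<K>. {x \<in> topspace X. r `` {x} \<in> S})" for \<K>
    by auto
  have "istopology (\<lambda>U. U \<subseteq> topspace X // r \<and> openin X {x \<in> topspace X. r `` {x} \<in> U})"
    unfolding istopology_def Int Un by (blast intro: openin_Int openin_Union)
  then show ?thesis
    by (simp add: quotient_topology_def topology_inverse')
qed

lemma topspace_quotient_topology [simp]: "topspace (quotient_topology X r) = topspace X // r"
proof
  show "topspace (quotient_topology X r) \<subseteq> topspace X // r"
    using openin_quotient_topology openin_topspace by blast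
  have "{x \<in> topspace X. r `` {x} \<in> topspace X // r} = topspace X"
    by (auto simp: quotientI)
  then have "openin (quotient_topology X r) (topspace X // r)"
    by (simp add: openin_quotient_topology)
  then show "topspace X // r \<subseteq> topspace (quotient_topology X r)"
    by (rule openin_subset)
qed

lemma quotient_map_quotient_topology:
  "quotient_map X (quotient_topology X r) (\<lambda>x. r `` {x})"
  by (auto simp: quotient_map_def openin_quotient_topology quotient_def)

definition sym2_rel :: "'a topology \<Rightarrow> (('a \<times> 'a) \<times> ('a \<times> 'a)) set" where
  "sym2_rel X = {((x1, y1), (x2, y2)).
     {x1, y1, x2, y2} \<subseteq> topspace X \<and> ((x1, y1) = (x2, y2) \<or> (x1, y1) = (y2, x2))}"

lemma equiv_sym2_rel: "equiv (topspace (prod_topology X X)) (sym2_rel X)"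
  by (auto simp: equiv_def sym2_rel_def refl_on_def sym_def trans_def)

definition sym2 :: "'a topology \<Rightarrow> ('a \<times> 'a) set topology" where
  "sym2 X = quotient_topology (prod_topology X X) (sym2_rel X)"

definition sym2_diagonal :: "'a topology \<Rightarrow> ('a \<times> 'a) set set" where
  "sym2_diagonal X = (\<lambda>a. sym2_rel X `` {(a, a)}) ` topspace X"

definition config2 :: "'a topology \<Rightarrow> ('a \<times> 'a) set topology" where
  "config2 X = subtopology (sym2 X) (topspace (sym2 X) - sym2_diagonal X)"


section \<open>Borel--Moore homology\<close>

text \<open>
  A possibly infinite formal sum of singular simplices with integer coefficients is represented by
  its coefficient function. The simplices are those of \<^theory>\<open>HOL-Homology.Simplices\<close>.
\<close>

type_synonym 'a lf_chain = "((nat \<Rightarrow> real) \<Rightarrow> 'a) \<Rightarrow> int"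

definition lf_singular_chain :: "nat \<Rightarrow> 'a topology \<Rightarrow> 'a lf_chain \<Rightarrow> bool" where
  "lf_singular_chain p X c \<longleftrightarrow>
     (\<forall>f. c f \<noteq> 0 \<longrightarrow> singular_simplex p X f) \<and>
     (\<forall>K. compactin X K \<longrightarrow> finite {f. c f \<noteq> 0 \<and> f ` standard_simplex p \<inter> K \<noteq> {}})"

text \<open>
  The linear extension of \<open>f \<mapsto> (\<Sum>k\<le>p. (-1) ^ k * singular_face p k f)\<close> to locally finite chains,
  given by its coefficient at the simplex \<open>g\<close>. The inner sum is finite for a locally finite chain,
  since all \<open>f\<close> that have \<open>g\<close> as a face meet the compact image of \<open>g\<close>.
\<close>

definition lf_boundary :: "nat \<Rightarrow> 'a lf_chain \<Rightarrow> 'a lf_chain" where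
  "lf_boundary p c = (\<lambda>g. if p = 0 then 0
     else \<Sum>k\<le>p. (-1) ^ k * (\<Sum>f | c f \<noteq> 0 \<and> singular_face p k f = g. c f))"

definition lf_cycle_group :: "nat \<Rightarrow> 'a topology \<Rightarrow> 'a lf_chain monoid" where
  "lf_cycle_group p X =
     \<lparr>carrier = {c. lf_singular_chain p X c \<and> lf_boundary p c = (\<lambda>_. 0)},
      monoid.mult = (\<lambda>c d f. c f + d f), one = (\<lambda>_. 0)\<rparr>"

definition lf_boundary_set :: "nat \<Rightarrow> 'a topology \<Rightarrow> 'a lf_chain set" where
  "lf_boundary_set p X = lf_boundary (Suc p) ` {d. lf_singular_chain (Suc p) X d}"

text \<open>As for \<^const>\<open>relative_homology_group\<close>, the degree is an integer.\<close>

definition BM_homology_group :: "int \<Rightarrow> 'a topology \<Rightarrow> 'a lf_chain set monoid" where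
  "BM_homology_group n X =
     (if n < 0 then singleton_group undefined
      else lf_cycle_group (nat n) X Mod lf_boundary_set (nat n) X)"

end

theory Submission
  imports Defs "HOL-Analysis.Abstract_Topological_Spaces"
begin

text \<open>
  Let \<open>\<Gamma>\<close> be the graph, \<open>Y\<close> its symmetric square and \<open>\<Delta>\<close> the diagonal. The space \<open>Y\<close> is compact, and two
  points of \<open>\<Gamma>\<close> that are close to each other can be moved along \<open>\<Gamma>\<close> to a common position. Hence a
  locally finite cycle of \<open>Y - \<Delta>\<close> that lies near \<open>\<Delta>\<close> can be pushed further and further towards
  \<open>\<Delta>\<close>, and it bounds the infinite sum of the chains that are swept out. So a locally finite cycle is
  determined up to boundaries by its finitely many simplices away from \<open>\<Delta>\<close>, and together with
  excision this gives \<open>H\<^sup>B\<^sup>M(Y - \<Delta>) \<cong> H(Y, \<Delta>)\<close>; see \<open>BM_homology_iso_relative\<close> and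
  \<open>BM_homology_config2_Gam\<close>.

  Choose a spanning tree \<open>T\<close>. It is contractible, so its symmetric square contracts to a single
  point of \<open>\<Delta>\<close>, with equal points remaining equal, and \<open>\<Delta>\<close> may be enlarged to
  \<open>X0 = Sym\<^sup>2(T) \<union> \<Delta>\<close> without changing the relative homology (\<open>BM_homology_config2_tree\<close>). Let \<open>\<gamma>\<^sub>i\<close> for \<open>i < b\<close> be the edges outside \<open>T\<close>, where
  \<open>b\<close> is the first Betti number. Up to the contractible factor \<open>T\<close>, the space \<open>Y\<close> is built from \<open>X0\<close> by
  attaching

    \<^item> a 1-cell \<open>e\<^sub>i\<close> for every \<open>i\<close>, the pairs of a point of \<open>T\<close> and a point of \<open>\<gamma>\<^sub>i\<close>,
    \<^item> a 1-cell \<open>d\<^sub>i\<^sub>k\<close> for \<open>i < k\<close>, the pairs \<open>{\<gamma>\<^sub>i(t), \<gamma>\<^sub>k(t)}\<close>,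
    \<^item> a 2-cell \<open>\<sigma>\<^sub>i\<^sub>k\<close> for every ordered pair \<open>(i, k)\<close>, the pairs \<open>{\<gamma>\<^sub>i(s), \<gamma>\<^sub>k(t)}\<close> with \<open>s \<le> t\<close>.

  Let \<open>X1\<close> be the union of \<open>X0\<close> and the 1-cells. Then \<open>(X1, X0)\<close> has free homology on the
  1-cells in degree 1 only and \<open>(Y, X1)\<close> has free homology on the 2-cells in degree 2 only (\<open>homology_X1\<close>, \<open>homology_X2\<close>, from \<open>homology_attach_cells\<close>). The three
  sides of the triangle \<open>\<sigma>\<^sub>i\<^sub>k\<close> give \<open>\<partial>\<sigma>\<^sub>i\<^sub>k = e\<^sub>i + e\<^sub>k - d\<^sub>i\<^sub>k\<close>, where \<open>d\<^sub>k\<^sub>i = d\<^sub>i\<^sub>k\<close>, and \<open>d\<^sub>i\<^sub>i = 0\<close> because the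
  side \<open>s = t\<close> of \<open>\<sigma>\<^sub>i\<^sub>i\<close> lies in \<open>\<Delta>\<close>.

  The rest is linear algebra. A combination \<open>\<Sum> c\<^sub>i\<^sub>k \<sigma>\<^sub>i\<^sub>k\<close> is a cycle if and only if the matrix \<open>c\<close> is
  antisymmetric, so \<open>H\<^sub>2\<close> is free of rank \<open>b (b - 1) / 2\<close>. In the cokernel \<open>d\<^sub>i\<^sub>k\<close> becomes \<open>e\<^sub>i + e\<^sub>k\<close>, and what
  remains are the relations \<open>2 e\<^sub>i = 0\<close> from the cells \<open>\<sigma>\<^sub>i\<^sub>i\<close>, so \<open>H\<^sub>1\<close> is \<open>(\<int>/2)\<^sup>b\<close>.
\<close>

section \<open>Locally finite chains near a compact set\<close>

definition trunc_chain :: "nat \<Rightarrow> 'a set \<Rightarrow> 'a lf_chain \<Rightarrow> 'a chain" where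
  "trunc_chain p K c = Abs_poly_mapping (\<lambda>f. if f ` standard_simplex p \<inter> K \<noteq> {} then c f else 0)"

lemma lookup_trunc_chain:
  assumes "lf_singular_chain p X c" "compactin X K"
  shows "Poly_Mapping.lookup (trunc_chain p K c) f =
    (if f ` standard_simplex p \<inter> K \<noteq> {} then c f else 0)"
proof -
  have "finite {f. (if f ` standard_simplex p \<inter> K \<noteq> {} then c f else 0) \<noteq> 0}"
    using assms unfolding lf_singular_chain_def
    by (elim conjE allE[of _ K] impE) (auto elim!: rev_finite_subset)
  then show ?thesis
    by (simp add: trunc_chain_def)
qed

lemma singular_chain_trunc_chain:
  assumes "lf_singular_chain p X c" "compactin X K"
  shows "singular_chain p X (trunc_chain p K c)"
  using assms(1) by (auto simp: singular_chain_def in_keys_iff lookup_trunc_chain[OF assms] lf_singular_chain_def split: if_splits)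

lemma singular_face_image_subset:
  assumes "1 \<le> p" "k \<le> p"
  shows "singular_face p k f ` standard_simplex (p - Suc 0) \<subseteq> f ` standard_simplex p"
  using assms by (auto simp: singular_face_def simplical_face_in_standard_simplex)

text \<open>
  The coefficient of \<open>\<partial>c\<close> at \<open>g\<close> only involves simplices that contain the image of \<open>g\<close>, so
  every identity between boundaries of locally finite chains can be checked on finite truncations.
\<close>

lemma lf_boundary_local:
  assumes eq: "\<And>f. f ` standard_simplex p \<inter> K \<noteq> {} \<Longrightarrow> c f = d f"
    and g: "g ` standard_simplex (p - Suc 0) \<inter> K \<noteq> {}"
  shows "lf_boundary p c g = lf_boundary p d g"
proof (cases "p = 0")
  case False
  have "c f = d f" if "singular_face p k f = g" "k \<le> p" for f k
    using singular_face_image_subset[of p k f] that g False by (intro eq) fastforce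
  then have "(\<Sum>f | c f \<noteq> 0 \<and> singular_face p k f = g. c f) = (\<Sum>f | d f \<noteq> 0 \<and> singular_face p k f = g. d f)"
    if "k \<le> p" for k
    using that by (intro sum.cong) auto
  then show ?thesis
    by (simp add: lf_boundary_def)
qed (simp add: lf_boundary_def)

lemma lf_boundary_lookup:
  "lf_boundary p (Poly_Mapping.lookup c) = Poly_Mapping.lookup (chain_boundary p c)"
proof (cases "p = 0")
  case False
  show ?thesis
  proof
    fix g
    have "Poly_Mapping.lookup (chain_boundary p c) g
        = (\<Sum>f\<in>Poly_Mapping.keys c. \<Sum>k\<le>p. Poly_Mapping.lookup c f * ((-1) ^ k * (if singular_face p k f = g then 1 else 0)))"
      using False
      by (auto simp: chain_boundary_def frag_extend_def lookup_sum frag_cmul_sum sum_distrib_left intro!: sum.cong)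
    also have "\<dots> = (\<Sum>k\<le>p. \<Sum>f\<in>Poly_Mapping.keys c. (-1) ^ k * (if singular_face p k f = g then Poly_Mapping.lookup c f else 0))"
      by (subst sum.swap) (auto intro!: sum.cong)
    also have "\<dots> = lf_boundary p (Poly_Mapping.lookup c) g"
      using False
      by (auto simp: lf_boundary_def sum_distrib_left[symmetric] sum.inter_filter[symmetric] in_keys_iff
          intro!: sum.cong arg_cong[where f="(*) _"])
    finally show "lf_boundary p (Poly_Mapping.lookup c) g = Poly_Mapping.lookup (chain_boundary p c) g"
      by simp
  qed
qed (auto simp: lf_boundary_def chain_boundary_def)

lemma lf_boundary_trunc_chain:
  assumes "lf_singular_chain p X c" "compactin X K" "g ` standard_simplex (p - Suc 0) \<inter> K \<noteq> {}"
  shows "lf_boundary p c g = Poly_Mapping.lookup (chain_boundary p (trunc_chain p K c)) g"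
proof -
  have "lf_boundary p c g = lf_boundary p (Poly_Mapping.lookup (trunc_chain p K c)) g"
    by (rule lf_boundary_local[OF _ assms(3)]) (simp add: lookup_trunc_chain[OF assms(1,2)])
  then show ?thesis
    by (simp add: lf_boundary_lookup)
qed

lemma lf_boundary_nonzeroD:
  assumes "lf_singular_chain p X c" "lf_boundary p c g \<noteq> 0"
  shows "singular_simplex (p - Suc 0) X g"
proof -
  have "p \<noteq> 0"
    using assms(2) by (intro notI) (simp add: lf_boundary_def)
  moreover have "\<exists>k\<le>p. \<exists>f. c f \<noteq> 0 \<and> singular_face p k f = g"
    using assms(2) by (force simp: lf_boundary_def intro!: sum.neutral split: if_splits)
  ultimately show ?thesis
    using assms(1) singular_simplex_singular_face[of p X] unfolding lf_singular_chain_def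
    by (metis One_nat_def Suc_leI neq0_conv)
qed

lemma compactin_singular_simplex_image:
  assumes "singular_simplex p X f"
  shows "compactin X (f ` standard_simplex p)"
proof -
  have "compactin (subtopology (powertop_real UNIV) (standard_simplex p)) (standard_simplex p)"
    using compactin_standard_simplex by (simp add: compactin_subtopology)
  then show ?thesis
    using assms image_compactin unfolding singular_simplex_def by blast
qed

lemma singular_simplex_image_ne: "f ` standard_simplex p \<noteq> {}"
  by (simp add: nonempty_standard_simplex)

lemma lf_singular_chain_lookup:
  assumes "singular_chain p X c"
  shows "lf_singular_chain p X (Poly_Mapping.lookup c)"
  using assms unfolding lf_singular_chain_def singular_chain_def
  by (auto simp: in_keys_iff subset_eq intro: rev_finite_subset[OF finite_keys[of c]])

lemma lf_singular_chain_add: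
  assumes "lf_singular_chain p X c" "lf_singular_chain p X d"
  shows "lf_singular_chain p X (\<lambda>f. c f + d f)"
  unfolding lf_singular_chain_def
proof (intro conjI allI impI)
  fix f assume "c f + d f \<noteq> 0"
  then have "c f \<noteq> 0 \<or> d f \<noteq> 0" by auto
  then show "singular_simplex p X f"
    using assms unfolding lf_singular_chain_def by blast
next
  fix K assume "compactin X K"
  then have "finite ({f. c f \<noteq> 0 \<and> f ` standard_simplex p \<inter> K \<noteq> {}} \<union> {f. d f \<noteq> 0 \<and> f ` standard_simplex p \<inter> K \<noteq> {}})"
    using assms unfolding lf_singular_chain_def by blast
  then show "finite {f. c f + d f \<noteq> 0 \<and> f ` standard_simplex p \<inter> K \<noteq> {}}"
    by (rule rev_finite_subset) auto
qed

lemma lf_singular_chain_minus: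
  "lf_singular_chain p X c \<Longrightarrow> lf_singular_chain p X (\<lambda>f. - c f)"
  by (simp add: lf_singular_chain_def)

lemma lf_boundary_minus: "lf_boundary p (\<lambda>f. - c f) = (\<lambda>f. - lf_boundary p c f)"
  by (auto simp: lf_boundary_def sum_negf)

lemma lf_boundary_add:
  assumes c: "lf_singular_chain p X c" and d: "lf_singular_chain p X d"
  shows "lf_boundary p (\<lambda>f. c f + d f) = (\<lambda>f. lf_boundary p c f + lf_boundary p d f)"
proof
  fix g
  show "lf_boundary p (\<lambda>f. c f + d f) g = lf_boundary p c g + lf_boundary p d g"
  proof (cases "singular_simplex (p - Suc 0) X g")
    case True
    let ?K = "g ` standard_simplex (p - Suc 0)"
    have K: "compactin X ?K" "g ` standard_simplex (p - Suc 0) \<inter> ?K \<noteq> {}"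
      using compactin_singular_simplex_image[OF True] nonempty_standard_simplex by auto
    have "trunc_chain p ?K (\<lambda>f. c f + d f) = trunc_chain p ?K c + trunc_chain p ?K d"
      by (intro poly_mapping_eqI)
        (simp add: lookup_add lookup_trunc_chain[OF _ K(1)] c d lf_singular_chain_add)
    then show ?thesis
      by (simp add: lf_boundary_trunc_chain[OF _ K] c d lf_singular_chain_add chain_boundary_add lookup_add)
  next
    case False
    then show ?thesis
      using lf_boundary_nonzeroD[OF lf_singular_chain_add[OF c d]] lf_boundary_nonzeroD[OF c]
        lf_boundary_nonzeroD[OF d]
      by (metis add_0)
  qed
qed

lemma lf_singular_chain_boundary:
  assumes c: "lf_singular_chain p X c"
  shows "lf_singular_chain (p - Suc 0) X (lf_boundary p c)"
  unfolding lf_singular_chain_def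
proof (intro conjI allI impI)
  show "\<And>f. lf_boundary p c f \<noteq> 0 \<Longrightarrow> singular_simplex (p - Suc 0) X f"
    using lf_boundary_nonzeroD[OF c] .
  fix K assume "compactin X K"
  then have "{f. lf_boundary p c f \<noteq> 0 \<and> f ` standard_simplex (p - Suc 0) \<inter> K \<noteq> {}}
      \<subseteq> Poly_Mapping.keys (chain_boundary p (trunc_chain p K c))"
    by (intro subsetI, elim CollectE conjE) (simp add: in_keys_iff lf_boundary_trunc_chain[OF c])
  then show "finite {f. lf_boundary p c f \<noteq> 0 \<and> f ` standard_simplex (p - Suc 0) \<inter> K \<noteq> {}}"
    by (rule finite_subset) simp
qed

lemma lf_boundary_boundary:
  assumes c: "lf_singular_chain (Suc p) X c"
  shows "lf_boundary p (lf_boundary (Suc p) c) = (\<lambda>_. 0)"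
proof
  fix g
  have bc: "lf_singular_chain p X (lf_boundary (Suc p) c)"
    using lf_singular_chain_boundary[OF c] by simp
  show "lf_boundary p (lf_boundary (Suc p) c) g = 0"
  proof (cases "singular_simplex (p - Suc 0) X g")
    case True
    let ?K = "g ` standard_simplex (p - Suc 0)"
    have K: "compactin X ?K" "g ` standard_simplex (p - Suc 0) \<inter> ?K \<noteq> {}"
      using compactin_singular_simplex_image[OF True] nonempty_standard_simplex by auto
    have "lf_boundary p (lf_boundary (Suc p) c) g
        = lf_boundary p (Poly_Mapping.lookup (chain_boundary (Suc p) (trunc_chain (Suc p) ?K c))) g"
      by (rule lf_boundary_local[OF _ K(2)]) (simp add: lf_boundary_trunc_chain[OF c K(1)])
    also have "\<dots> = 0"
      using chain_boundary_boundary_alt[OF singular_chain_trunc_chain[OF c K(1)]]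
      by (simp add: lf_boundary_lookup)
    finally show ?thesis .
  next
    case False
    then show ?thesis
      using lf_boundary_nonzeroD[OF bc] by blast
  qed
qed


section \<open>Borel--Moore homology as relative homology\<close>

text \<open>
  The vanishing of a relative homology group, in terms of chains.
\<close>

definition rel_acyclic :: "nat \<Rightarrow> 'a topology \<Rightarrow> 'a set \<Rightarrow> bool" where
  "rel_acyclic p X S \<longleftrightarrow> (\<forall>c. singular_relcycle p X S c \<longrightarrow> singular_relboundary p X S c)"

lemma group_lf_cycle_group: "group (lf_cycle_group p X)"
proof (rule groupI)
  fix x assume x: "x \<in> carrier (lf_cycle_group p X)"
  then have "(\<lambda>f. - x f) \<in> carrier (lf_cycle_group p X)"
    by (simp add: lf_cycle_group_def lf_singular_chain_minus lf_boundary_minus)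
  then show "\<exists>y\<in>carrier (lf_cycle_group p X). y \<otimes>\<^bsub>lf_cycle_group p X\<^esub> x = \<one>\<^bsub>lf_cycle_group p X\<^esub>"
    by (rule bexI[rotated]) (simp add: lf_cycle_group_def)
next
  have "lf_boundary p (\<lambda>_. 0) = (\<lambda>_. 0 :: int)"
    by (auto simp: lf_boundary_def)
  then show "\<one>\<^bsub>lf_cycle_group p X\<^esub> \<in> carrier (lf_cycle_group p X)"
    by (simp add: lf_cycle_group_def lf_singular_chain_def)
qed (auto simp: lf_cycle_group_def lf_singular_chain_add lf_boundary_add add.assoc)

lemma homologous_class_hom:
  "homologous_rel_set p X S \<in> hom (relcycle_group p X S) (relative_homology_group (int p) X S)"
  using normal.r_coset_hom_Mod[OF normal_subgroup_singular_relboundary_relcycle, of p X S]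
  by (simp add: right_coset_singular_relboundary relative_homology_group_def)

text \<open>
  A neighbourhood basis \<open>A 0 \<supseteq> A 1 \<supseteq> \<dots>\<close> of the end of a space, such that each inclusion
  \<open>A (m + 1) \<subseteq> A m\<close> is a homology isomorphism. It is this last condition that allows a cycle near the
  end to be pushed to infinity.
\<close>

locale end_exhaustion =
  fixes X :: "'a topology" and A :: "nat \<Rightarrow> 'a set"
  assumes dec: "A (Suc m) \<subseteq> A m"
    and sub: "A m \<subseteq> topspace X"
    and cpt: "compactin X (topspace X - A m)"
    and esc: "compactin X K \<Longrightarrow> \<exists>m. K \<inter> A m = {}"
    and acyc: "rel_acyclic p (subtopology X (A m)) (A (Suc m))"
begin

definition core :: "nat \<Rightarrow> 'a set" where "core m = topspace X - A m"

lemma compact_core: "compactin X (core m)"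
  by (simp add: core_def cpt)

lemma antimono: "m \<le> n \<Longrightarrow> A n \<subseteq> A m"
  by (rule lift_Suc_antimono_le[of A]) (use dec in auto)

definition end_cycle :: "nat \<Rightarrow> nat \<Rightarrow> 'a lf_chain \<Rightarrow> bool" where
  "end_cycle p m c \<longleftrightarrow> lf_singular_chain p X c \<and> lf_boundary p c = (\<lambda>_. 0) \<and>
     (\<forall>f. c f \<noteq> 0 \<longrightarrow> f ` standard_simplex p \<subseteq> A m)"

lemma simplex_in_end:
  assumes "singular_simplex p X f"
  shows "f ` standard_simplex p \<inter> core m = {} \<longleftrightarrow> f ` standard_simplex p \<subseteq> A m"
proof -
  have "f ` standard_simplex p \<subseteq> topspace X"
    using assms by (auto simp: singular_simplex_def continuous_map_def)
  then show ?thesis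
    by (auto simp: core_def)
qed

text \<open>
  The boundary of the part of a cycle that meets the core is cancelled by the boundary of the other
  simplices, all of which lie in \<open>A m\<close>.
\<close>

lemma trunc_relcycle:
  assumes c: "lf_singular_chain p X c" and z: "lf_boundary p c = (\<lambda>_. 0)"
  shows "singular_relcycle p X (A m) (trunc_chain p (core m) c)"
proof -
  let ?t = "trunc_chain p (core m) c"
  have t: "singular_chain p X ?t"
    by (rule singular_chain_trunc_chain[OF c compact_core])
  have bt: "singular_chain (p - Suc 0) X (chain_boundary p ?t)"
    by (rule singular_chain_boundary[OF t])
  have "f ` standard_simplex (p - Suc 0) \<subseteq> A m" if "f \<in> Poly_Mapping.keys (chain_boundary p ?t)" for f
  proof -
    have f: "singular_simplex (p - Suc 0) X f"
      using bt that by (auto simp: singular_chain_def)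
    have "f ` standard_simplex (p - Suc 0) \<inter> core m = {}"
      using that lf_boundary_trunc_chain[OF c compact_core, of f m] z by (auto simp: in_keys_iff)
    then show ?thesis
      using simplex_in_end[OF f] by simp
  qed
  then show ?thesis
    using t bt by (simp add: singular_relcycle singular_chain_subtopology)
qed

text \<open>
  Pushing a cycle one step towards the end: the finitely many simplices that are not yet in
  \<open>A (Suc m)\<close> form a relative cycle, which is homologous to a chain in \<open>A (Suc m)\<close>.
\<close>

lemma push_end_cycle:
  assumes c: "end_cycle p m c"
  shows "\<exists>b. singular_chain (Suc p) (subtopology X (A m)) b \<and>
    end_cycle p (Suc m) (\<lambda>f. c f - Poly_Mapping.lookup (chain_boundary (Suc p) b) f)"
proof -
  let ?t = "trunc_chain p (core (Suc m)) c"
  have lf: "lf_singular_chain p X c" and z: "lf_boundary p c = (\<lambda>_. 0)"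
    and im: "\<And>f. c f \<noteq> 0 \<Longrightarrow> f ` standard_simplex p \<subseteq> A m"
    using c by (auto simp: end_cycle_def)
  have int: "A m \<inter> A (Suc m) = A (Suc m)"
    using dec by blast
  have t: "singular_relcycle p X (A (Suc m)) ?t"
    by (rule trunc_relcycle[OF lf z])
  have tA: "f ` standard_simplex p \<subseteq> A m" if "f \<in> Poly_Mapping.keys ?t" for f
    by (rule im) (use that in \<open>simp add: in_keys_iff lookup_trunc_chain[OF lf compact_core] split: if_splits\<close>)
  from t have "singular_relcycle p (subtopology X (A m)) (A (Suc m)) ?t"
    using tA int unfolding singular_relcycle subtopology_subtopology
    by (simp add: singular_chain_subtopology)
  then have "singular_relboundary p (subtopology X (A m)) (A (Suc m)) ?t"
    using acyc unfolding rel_acyclic_def by blast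
  then obtain b e where b: "singular_chain (Suc p) (subtopology X (A m)) b"
    and e: "singular_chain p (subtopology X (A (Suc m))) e"
    and be: "chain_boundary (Suc p) b = ?t + e"
    unfolding singular_relboundary_alt subtopology_subtopology int by blast
  have bX: "singular_chain (Suc p) X b"
    using b by (simp add: singular_chain_subtopology)
  define c' where "c' = (\<lambda>f. c f - Poly_Mapping.lookup (chain_boundary (Suc p) b) f)"
  have bb: "lf_singular_chain p X (Poly_Mapping.lookup (chain_boundary (Suc p) b))"
    by (rule lf_singular_chain_lookup) (use singular_chain_boundary[OF bX] in simp)
  have c'_alt: "c' = (\<lambda>f. c f + - Poly_Mapping.lookup (chain_boundary (Suc p) b) f)"
    by (simp add: c'_def)
  have lf': "lf_singular_chain p X c'"
    unfolding c'_alt by (intro lf_singular_chain_add lf lf_singular_chain_minus bb)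
  have "lf_boundary p c' = (\<lambda>_. 0)"
    unfolding c'_alt lf_boundary_add[OF lf lf_singular_chain_minus[OF bb]]
    using chain_boundary_boundary_alt[OF bX] by (simp add: lf_boundary_minus lf_boundary_lookup z)
  moreover have "f ` standard_simplex p \<subseteq> A (Suc m)" if "c' f \<noteq> 0" for f
  proof (rule ccontr)
    assume n: "\<not> f ` standard_simplex p \<subseteq> A (Suc m)"
    have "singular_simplex p X f"
      using lf' that by (auto simp: lf_singular_chain_def)
    then have "f ` standard_simplex p \<inter> core (Suc m) \<noteq> {}"
      using n simplex_in_end by blast
    moreover have "Poly_Mapping.lookup e f = 0"
      using e n unfolding singular_chain_subtopology by (metis in_keys_iff)
    ultimately have "c' f = 0"
      by (simp add: c'_def be lookup_add lookup_trunc_chain[OF lf compact_core])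
    then show False
      using that by simp
  qed
  ultimately have "end_cycle p (Suc m) c'"
    using lf' by (simp add: end_cycle_def)
  then show ?thesis
    using b unfolding c'_def by blast
qed

text \<open>
  A cycle near the end is pushed off to infinity: the chains used in the successive steps lie in
  smaller and smaller sets \<open>A m\<close>, so their infinite sum is locally finite, and it bounds the cycle
  because the boundaries telescope.
\<close>

lemma end_cycle_bounds:
  assumes c: "end_cycle p 0 c"
  shows "\<exists>d. lf_singular_chain (Suc p) X d \<and> lf_boundary (Suc p) d = c \<and>
    (\<forall>f. d f \<noteq> 0 \<longrightarrow> f ` standard_simplex (Suc p) \<subseteq> A 0)"
proof -
  obtain B where B: "\<And>m c. end_cycle p m c \<Longrightarrow> singular_chain (Suc p) (subtopology X (A m)) (B m c) \<and>
    end_cycle p (Suc m) (\<lambda>f. c f - Poly_Mapping.lookup (chain_boundary (Suc p) (B m c)) f)"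
    using push_end_cycle by metis
  \<comment> \<open>\<open>cs m\<close> is what is left of the cycle after \<open>m\<close> steps, a cycle in \<open>A m\<close>\<close>
  define cs where "cs = rec_nat c (\<lambda>m c f. c f - Poly_Mapping.lookup (chain_boundary (Suc p) (B m c)) f)"
  have cs0: "cs 0 = c" and csS: "\<And>m f. cs (Suc m) f = cs m f - Poly_Mapping.lookup (chain_boundary (Suc p) (B m (cs m))) f"
    by (simp_all add: cs_def)
  have cyc: "end_cycle p m (cs m)" for m
    using c B by (induction m) (auto simp: cs_def)
  define b where "b m = B m (cs m)" for m
  have b: "singular_chain (Suc p) X (b m)" and bA: "Poly_Mapping.lookup (b m) f \<noteq> 0 \<Longrightarrow> f ` standard_simplex (Suc p) \<subseteq> A m" for m f
    using B[OF cyc[of m]] by (auto simp: b_def singular_chain_subtopology in_keys_iff)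
  \<comment> \<open>the infinite sum of the chains \<open>b m\<close>: each simplex meets a compact core, so it occurs in only
      finitely many of them\<close>
  define d where "d f = (\<Sum>m | Poly_Mapping.lookup (b m) f \<noteq> 0. Poly_Mapping.lookup (b m) f)" for f
  \<comment> \<open>on simplices that meet a compact set \<open>K\<close>, the infinite sum is a finite one\<close>
  have loc: "d f = Poly_Mapping.lookup (\<Sum>m<M. b m) f"
    if "K \<inter> A M = {}" "f ` standard_simplex (Suc p) \<inter> K \<noteq> {}" for K M f
  proof -
    have "Poly_Mapping.lookup (b m) f = 0" if "M \<le> m" for m
      using bA[of m f] antimono[OF that] \<open>K \<inter> A M = {}\<close> \<open>f ` standard_simplex (Suc p) \<inter> K \<noteq> {}\<close> by blast
    then have sub: "{m. Poly_Mapping.lookup (b m) f \<noteq> 0} \<subseteq> {..<M}"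
      by (auto simp: not_less[symmetric])
    show ?thesis
      unfolding d_def lookup_sum by (rule sum.mono_neutral_left) (use sub in auto)
  qed
  have lf: "lf_singular_chain (Suc p) X d"
    unfolding lf_singular_chain_def
  proof (intro conjI allI impI)
    fix f assume "d f \<noteq> 0"
    then obtain m where "Poly_Mapping.lookup (b m) f \<noteq> 0"
      unfolding d_def by (metis (mono_tags, lifting) mem_Collect_eq sum.neutral)
    then show "singular_simplex (Suc p) X f"
      using b[of m] by (auto simp: singular_chain_def in_keys_iff subset_eq)
  next
    fix K assume "compactin X K"
    then obtain M where M: "K \<inter> A M = {}"
      using esc by blast
    have "{f. d f \<noteq> 0 \<and> f ` standard_simplex (Suc p) \<inter> K \<noteq> {}} \<subseteq> Poly_Mapping.keys (\<Sum>m<M. b m)"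
      by (intro subsetI, elim CollectE conjE) (simp add: in_keys_iff loc[OF M])
    then show "finite {f. d f \<noteq> 0 \<and> f ` standard_simplex (Suc p) \<inter> K \<noteq> {}}"
      by (rule finite_subset) simp
  qed
  have "lf_boundary (Suc p) d g = c g" for g
  proof (cases "singular_simplex p X g")
    case True
    let ?K = "g ` standard_simplex p"
    obtain M where M: "?K \<inter> A M = {}"
      using esc[OF compactin_singular_simplex_image[OF True]] by blast
    have tel: "Poly_Mapping.lookup (chain_boundary (Suc p) (\<Sum>m<M. b m)) g = c g - cs M g" for M
      by (induction M) (auto simp: cs0 csS b_def chain_boundary_add lookup_add)
    have "lf_boundary (Suc p) d g = lf_boundary (Suc p) (Poly_Mapping.lookup (\<Sum>m<M. b m)) g"
      by (rule lf_boundary_local[where K = ?K]) (use loc[OF M] nonempty_standard_simplex in auto)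
    also have "\<dots> = c g - cs M g"
      by (simp add: lf_boundary_lookup tel)
    also have "cs M g = 0"
      using cyc[of M] M singular_simplex_image_ne[of g p] unfolding end_cycle_def by blast
    finally show ?thesis
      by simp
  next
    case False
    then have "c g = 0"
      using c by (auto simp: end_cycle_def lf_singular_chain_def)
    then show ?thesis
      using lf_boundary_nonzeroD[OF lf, of g] False by auto
  qed
  moreover have "f ` standard_simplex (Suc p) \<subseteq> A 0" if df: "d f \<noteq> 0" for f
  proof -
    obtain m where "Poly_Mapping.lookup (b m) f \<noteq> 0"
      using df unfolding d_def by (metis (mono_tags, lifting) mem_Collect_eq sum.neutral)
    then show ?thesis
      using bA[of m f] antimono[of 0 m] by blast
  qed
  ultimately show ?thesis
    using lf by blast
qed

text \<open>
  The isomorphism sends a locally finite cycle to the finite part of it that meets the core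
  \<open>X - A 0\<close>. Both surjectivity and injectivity amount to pushing to infinity a cycle in \<open>A 0\<close>: for
  surjectivity the boundary of a relative cycle, for injectivity the difference of a locally finite
  cycle and the boundary that kills its finite part.
\<close>

theorem BM_homology_iso_relative:
  "BM_homology_group (int p) X \<cong> relative_homology_group (int p) X (A 0)"
proof -
  define \<phi> where "\<phi> c = homologous_rel_set p X (A 0) (trunc_chain p (core 0) c)" for c
  let ?Z = "lf_cycle_group p X" and ?H = "relative_homology_group (int p) X (A 0)"
  have Z: "x \<in> carrier ?Z \<longleftrightarrow> lf_singular_chain p X x \<and> lf_boundary p x = (\<lambda>_. 0)" for x
    by (simp add: lf_cycle_group_def)
  have hom: "\<phi> \<in> hom ?Z ?H"
  proof (rule homI)
    fix x assume "x \<in> carrier ?Z"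
    then show "\<phi> x \<in> carrier ?H"
      unfolding \<phi>_def using homologous_class_hom trunc_relcycle[of p x 0]
      by (auto simp: Z carrier_relative_homology_group)
  next
    fix x y assume x: "x \<in> carrier ?Z" and y: "y \<in> carrier ?Z"
    have "trunc_chain p (core 0) (x \<otimes>\<^bsub>?Z\<^esub> y) = trunc_chain p (core 0) x + trunc_chain p (core 0) y"
      using x y
      by (intro poly_mapping_eqI)
        (simp add: Z lf_cycle_group_def lookup_add lookup_trunc_chain[OF _ compact_core] lf_singular_chain_add)
    then show "\<phi> (x \<otimes>\<^bsub>?Z\<^esub> y) = \<phi> x \<otimes>\<^bsub>?H\<^esub> \<phi> y"
      unfolding \<phi>_def using hom_mult[OF homologous_class_hom[of p X "A 0"]] trunc_relcycle[of p _ 0] x y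
      by (simp add: Z)
  qed
  then interpret group_hom ?Z ?H \<phi>
    by (intro group_hom.intro group_lf_cycle_group group_relative_homology_group) (simp add: group_hom_axioms_def)
  have "\<phi> ` carrier ?Z = carrier ?H"
  proof
    show "\<phi> ` carrier ?Z \<subseteq> carrier ?H"
      using hom_closed by blast
    show "carrier ?H \<subseteq> \<phi> ` carrier ?Z"
    proof
      fix y assume "y \<in> carrier ?H"
      then obtain t where t: "singular_relcycle p X (A 0) t" and y: "y = homologous_rel_set p X (A 0) t"
        by (auto simp: carrier_relative_homology_group)
      have tX: "singular_chain p X t"
        using t by (simp add: singular_relcycle)
      \<comment> \<open>the boundary of \<open>t\<close> is a cycle in \<open>A 0\<close>, which bounds a locally finite chain \<open>q\<close> there\<close>
      obtain q where q: "lf_singular_chain p X q" "lf_boundary p q = Poly_Mapping.lookup (chain_boundary p t)"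
        "\<And>f. q f \<noteq> 0 \<Longrightarrow> f ` standard_simplex p \<subseteq> A 0"
      proof (cases p)
        case 0
        then show thesis
          by (intro that[of "\<lambda>_. 0"]) (auto simp: lf_singular_chain_def lf_boundary_def chain_boundary_def)
      next
        case (Suc n)
        let ?s = "Poly_Mapping.lookup (chain_boundary p t)"
        have "end_cycle n 0 ?s"
          using t Suc chain_boundary_boundary_alt[of n X t]
          by (auto simp: end_cycle_def singular_relcycle singular_chain_subtopology in_keys_iff
              lf_boundary_lookup intro!: lf_singular_chain_lookup)
        then show thesis
          using end_cycle_bounds[of n ?s] that unfolding Suc by blast
      qed
      define c where "c = (\<lambda>f. Poly_Mapping.lookup t f + - q f)"
      have lf: "lf_singular_chain p X c"
        unfolding c_def by (intro lf_singular_chain_add lf_singular_chain_minus lf_singular_chain_lookup q tX)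
      have "lf_boundary p c = (\<lambda>_. 0)"
        unfolding c_def lf_boundary_add[OF lf_singular_chain_lookup[OF tX] lf_singular_chain_minus[OF q(1)]]
        by (simp add: lf_boundary_minus lf_boundary_lookup q(2))
      then have cZ: "c \<in> carrier ?Z"
        using lf by (simp add: Z)
      have "singular_chain p (subtopology X (A 0)) (t - trunc_chain p (core 0) c)"
        unfolding singular_chain_subtopology
      proof (intro conjI ballI)
        show "singular_chain p X (t - trunc_chain p (core 0) c)"
          by (intro singular_chain_diff tX singular_chain_trunc_chain[OF lf compact_core])
        fix f assume f: "f \<in> Poly_Mapping.keys (t - trunc_chain p (core 0) c)"
        then have "singular_simplex p X f"
          using \<open>singular_chain p X (t - trunc_chain p (core 0) c)\<close> by (auto simp: singular_chain_def)
        have "f ` standard_simplex p \<inter> core 0 = {}"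
        proof (rule ccontr)
          assume n: "f ` standard_simplex p \<inter> core 0 \<noteq> {}"
          then have "q f \<noteq> 0"
            using f by (simp add: in_keys_iff lookup_minus lookup_trunc_chain[OF lf compact_core]) (simp add: c_def)
          then show False
            using q(3)[of f] simplex_in_end[OF \<open>singular_simplex p X f\<close>, of 0] n by blast
        qed
        then show "f ` standard_simplex p \<subseteq> A 0"
          using simplex_in_end[OF \<open>singular_simplex p X f\<close>] by blast
      qed
      then have "homologous_rel p X (A 0) t (trunc_chain p (core 0) c)"
        unfolding homologous_rel_def by (rule singular_chain_imp_relboundary)
      then show "y \<in> \<phi> ` carrier ?Z"
        using cZ unfolding y \<phi>_def by (auto simp flip: homologous_rel_set_eq)
    qed
  qed
  moreover have "kernel ?Z ?H \<phi> = lf_boundary_set p X"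
  proof
    show "kernel ?Z ?H \<phi> \<subseteq> lf_boundary_set p X"
    proof
      fix c assume "c \<in> kernel ?Z ?H \<phi>"
      then have lf: "lf_singular_chain p X c" and z: "lf_boundary p c = (\<lambda>_. 0)"
        and "singular_relboundary p X (A 0) (trunc_chain p (core 0) c)"
        by (auto simp: kernel_def Z \<phi>_def homologous_rel_set_eq_relboundary)
      \<comment> \<open>subtracting the finite boundary \<open>\<partial>b\<close> moves \<open>c\<close> into \<open>A 0\<close>\<close>
      then obtain b e where b: "singular_chain (Suc p) X b" and e: "singular_chain p (subtopology X (A 0)) e"
        and be: "chain_boundary (Suc p) b = trunc_chain p (core 0) c + e"
        unfolding singular_relboundary_alt by blast
      define c' where "c' = (\<lambda>f. c f + - Poly_Mapping.lookup (chain_boundary (Suc p) b) f)"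
      have lb: "lf_singular_chain (Suc p) X (Poly_Mapping.lookup b)"
        by (rule lf_singular_chain_lookup[OF b])
      have bb: "lf_singular_chain p X (Poly_Mapping.lookup (chain_boundary (Suc p) b))"
        by (rule lf_singular_chain_lookup) (use singular_chain_boundary[OF b] in simp)
      have lf': "lf_singular_chain p X c'"
        unfolding c'_def by (intro lf_singular_chain_add lf lf_singular_chain_minus bb)
      have "end_cycle p 0 c'"
        unfolding end_cycle_def
      proof (intro conjI allI impI lf')
        show "lf_boundary p c' = (\<lambda>_. 0)"
          unfolding c'_def lf_boundary_add[OF lf lf_singular_chain_minus[OF bb]]
          using chain_boundary_boundary_alt[OF b] by (simp add: lf_boundary_minus lf_boundary_lookup z)
        fix f assume f: "c' f \<noteq> 0"
        then have s: "singular_simplex p X f"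
          using lf' by (auto simp: lf_singular_chain_def)
        show "f ` standard_simplex p \<subseteq> A 0"
        proof (rule ccontr)
          assume n: "\<not> f ` standard_simplex p \<subseteq> A 0"
          then have "Poly_Mapping.lookup e f = 0"
            using e n unfolding singular_chain_subtopology by (metis in_keys_iff)
          then show False
            using f n simplex_in_end[OF s, of 0] by (simp add: c'_def be lookup_add lookup_trunc_chain[OF lf compact_core])
        qed
      qed
      then obtain d where d: "lf_singular_chain (Suc p) X d" "lf_boundary (Suc p) d = c'"
        using end_cycle_bounds by blast
      have "c = lf_boundary (Suc p) (\<lambda>f. d f + Poly_Mapping.lookup b f)"
        by (simp add: lf_boundary_add[OF d(1) lb] d(2) lf_boundary_lookup c'_def)
      then show "c \<in> lf_boundary_set p X"
        using lf_singular_chain_add[OF d(1) lb] unfolding lf_boundary_set_def by blast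
    qed
    show "lf_boundary_set p X \<subseteq> kernel ?Z ?H \<phi>"
    proof
      fix c assume "c \<in> lf_boundary_set p X"
      then obtain d where d: "lf_singular_chain (Suc p) X d" and c: "c = lf_boundary (Suc p) d"
        by (auto simp: lf_boundary_set_def)
      have lf: "lf_singular_chain p X c"
        using lf_singular_chain_boundary[OF d] by (simp add: c)
      have cZ: "c \<in> carrier ?Z"
        using lf lf_boundary_boundary[OF d] by (simp add: Z c)
      let ?t = "trunc_chain (Suc p) (core 0) d"
      have t: "singular_chain (Suc p) X ?t"
        by (rule singular_chain_trunc_chain[OF d compact_core])
      let ?e = "chain_boundary (Suc p) ?t - trunc_chain p (core 0) c"
      have eX: "singular_chain p X ?e"
        using singular_chain_boundary[OF t] by (intro singular_chain_diff singular_chain_trunc_chain[OF lf compact_core]) simp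
      have "f ` standard_simplex p \<subseteq> A 0" if "f \<in> Poly_Mapping.keys ?e" for f
      proof -
        have "singular_simplex p X f"
          using eX that by (auto simp: singular_chain_def)
        moreover have "f ` standard_simplex p \<inter> core 0 = {}"
        proof (rule ccontr)
          assume n: "f ` standard_simplex p \<inter> core 0 \<noteq> {}"
          then have "c f = Poly_Mapping.lookup (chain_boundary (Suc p) ?t) f"
            using lf_boundary_trunc_chain[OF d compact_core, of f 0] by (simp add: c)
          then show False
            using that n by (simp add: in_keys_iff lookup_minus lookup_trunc_chain[OF lf compact_core])
        qed
        ultimately show ?thesis
          using simplex_in_end by blast
      qed
      then have "singular_relboundary p X (A 0) (trunc_chain p (core 0) c)"
        using t eX unfolding singular_relboundary_def mod_subset_def
        by (auto simp: singular_chain_subtopology intro!: exI[of _ ?t])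
      then show "c \<in> kernel ?Z ?H \<phi>"
        using cZ by (simp add: kernel_def \<phi>_def homologous_rel_set_eq_relboundary)
    qed
  qed
  ultimately show ?thesis
    using FactGroup_iso by (simp add: BM_homology_group_def)
qed

end

section \<open>Acyclic pairs and bases of relative homology\<close>

definition chain_comb :: "'i set \<Rightarrow> ('i \<Rightarrow> int) \<Rightarrow> ('i \<Rightarrow> 'a chain) \<Rightarrow> 'a chain" where
  "chain_comb J a z = (\<Sum>j\<in>J. frag_cmul (a j) (z j))"

text \<open>
  The classes of the relative cycles \<open>z j\<close> form a basis of the relative homology group. The cycles
  themselves are kept, because the boundary maps between cells are computed on them.
\<close>

definition rel_basis :: "nat \<Rightarrow> 'a topology \<Rightarrow> 'a set \<Rightarrow> 'i set \<Rightarrow> ('i \<Rightarrow> 'a chain) \<Rightarrow> bool" where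
  "rel_basis p X S J z \<longleftrightarrow> finite J \<and> (\<forall>j\<in>J. singular_relcycle p X S (z j)) \<and>
     (\<forall>c. singular_relcycle p X S c \<longrightarrow> (\<exists>a. homologous_rel p X S c (chain_comb J a z))) \<and>
     (\<forall>a. singular_relboundary p X S (chain_comb J a z) \<longrightarrow> (\<forall>j\<in>J. a j = 0))"

lemma rel_acyclic_iff_trivial:
  "rel_acyclic p X S \<longleftrightarrow> trivial_group (relative_homology_group (int p) X S)"
proof -
  have "homologous_rel_set p X S ` singular_relcycle_set p X S = {singular_relboundary_set p X S}
      \<longleftrightarrow> rel_acyclic p X S" (is "?l = _")
  proof
    assume l: ?l
    show "rel_acyclic p X S"
      unfolding rel_acyclic_def
    proof (intro allI impI)
      fix c assume "singular_relcycle p X S c"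
      then have "homologous_rel_set p X S c \<in> {singular_relboundary_set p X S}"
        unfolding l[symmetric] by (intro imageI CollectI)
      then show "singular_relboundary p X S c"
        using homologous_rel_set_eq_relboundary by blast
    qed
  next
    assume a: "rel_acyclic p X S"
    have "0 \<in> singular_relcycle_set p X S"
      by simp
    moreover have "homologous_rel_set p X S c = singular_relboundary_set p X S"
      if "c \<in> singular_relcycle_set p X S" for c
      using a that by (simp add: rel_acyclic_def homologous_rel_set_eq_relboundary)
    ultimately show ?l
      by (intro equalityI subsetI) (auto intro!: image_eqI[of _ _ 0])
  qed
  then show ?thesis
    by (simp add: trivial_group_def carrier_relative_homology_group)
qed

lemma rel_acyclic_iso:
  assumes "f \<in> iso (relative_homology_group (int p) X S) (relative_homology_group (int p) Y T)"
  shows "rel_acyclic p X S \<longleftrightarrow> rel_acyclic p Y T"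
  unfolding rel_acyclic_iff_trivial
  by (rule isomorphic_group_triviality[OF is_isoI[OF assms]]) simp_all

lemma chain_map_comb: "chain_map p f (chain_comb J a z) = chain_comb J a (\<lambda>j. chain_map p f (z j))"
  unfolding chain_comb_def
  by (induction J rule: infinite_finite_induct) (simp_all add: chain_map_add)

lemma chain_boundary_comb: "chain_boundary p (chain_comb J a z) = chain_comb J a (\<lambda>j. chain_boundary p (z j))"
  by (simp add: chain_comb_def chain_boundary_sum o_def chain_boundary_cmul)

lemma singular_relcycle_comb:
  "(\<And>j. j \<in> J \<Longrightarrow> singular_relcycle p X S (z j)) \<Longrightarrow> singular_relcycle p X S (chain_comb J a z)"
  unfolding chain_comb_def by (intro singular_relcycle_sum singular_relcycle_cmul)

lemma homologous_rel_cmul: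
  "homologous_rel p X S a b \<Longrightarrow> homologous_rel p X S (frag_cmul k a) (frag_cmul k b)"
proof -
  assume "homologous_rel p X S a b"
  moreover have "frag_cmul k (a - b) = frag_cmul k a - frag_cmul k b"
    by (rule poly_mapping_eqI) (simp add: lookup_minus right_diff_distrib)
  ultimately show ?thesis
    unfolding homologous_rel_def by (metis singular_relboundary_cmul)
qed

lemma homologous_rel_comb:
  assumes "finite J" "\<And>j. j \<in> J \<Longrightarrow> homologous_rel p X S (z j) (z' j)"
  shows "homologous_rel p X S (chain_comb J a z) (chain_comb J a z')"
  using assms unfolding chain_comb_def
  by (induction J rule: finite_induct) (auto intro!: homologous_rel_add homologous_rel_cmul)

lemma homologous_rel_relboundary:
  "homologous_rel p X S a b \<Longrightarrow> singular_relboundary p X S a \<longleftrightarrow> singular_relboundary p X S b"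
  by (metis homologous_rel_eq homologous_rel_eq_relboundary)

text \<open>
  The next two lemmas translate between isomorphisms of homology groups and statements about chains.
\<close>

lemma hom_induced_isoI:
  assumes f: "continuous_map X Y f" "f \<in> S \<rightarrow> T"
    and surj: "\<And>d. singular_relcycle p Y T d \<Longrightarrow> \<exists>c. singular_relcycle p X S c \<and> homologous_rel p Y T d (chain_map p f c)"
    and inj: "\<And>c. \<lbrakk>singular_relcycle p X S c; singular_relboundary p Y T (chain_map p f c)\<rbrakk> \<Longrightarrow> singular_relboundary p X S c"
  shows "hom_induced (int p) X S Y T f \<in> iso (relative_homology_group (int p) X S) (relative_homology_group (int p) Y T)"
proof -
  let ?h = "hom_induced (int p) X S Y T f"
  have h: "?h (homologous_rel_set p X S c) = homologous_rel_set p Y T (chain_map p f c)"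
    if "singular_relcycle p X S c" for c
    using hom_induced_chain_map[OF f that] .
  have "inj_on ?h (carrier (relative_homology_group (int p) X S))"
  proof (rule inj_onI)
    fix x y assume "x \<in> carrier (relative_homology_group (int p) X S)" "y \<in> carrier (relative_homology_group (int p) X S)"
      and eq: "?h x = ?h y"
    then obtain c d where c: "singular_relcycle p X S c" "x = homologous_rel_set p X S c"
      and d: "singular_relcycle p X S d" "y = homologous_rel_set p X S d"
      by (auto simp: carrier_relative_homology_group)
    have "homologous_rel p Y T (chain_map p f c) (chain_map p f d)"
      using eq c d by (simp add: h homologous_rel_set_eq)
    then have "singular_relboundary p Y T (chain_map p f (c - d))"
      by (simp add: homologous_rel_def chain_map_diff)
    then have "homologous_rel p X S c d"
      unfolding homologous_rel_def by (intro inj singular_relcycle_diff c d)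
    then show "x = y"
      by (simp add: c d homologous_rel_set_eq)
  qed
  moreover have "?h ` carrier (relative_homology_group (int p) X S) = carrier (relative_homology_group (int p) Y T)"
  proof
    show "?h ` carrier (relative_homology_group (int p) X S) \<subseteq> carrier (relative_homology_group (int p) Y T)"
      by (simp add: hom_induced_carrier image_subset_iff)
    show "carrier (relative_homology_group (int p) Y T) \<subseteq> ?h ` carrier (relative_homology_group (int p) X S)"
    proof
      fix y assume "y \<in> carrier (relative_homology_group (int p) Y T)"
      then obtain d where d: "singular_relcycle p Y T d" "y = homologous_rel_set p Y T d"
        by (auto simp: carrier_relative_homology_group)
      then obtain c where c: "singular_relcycle p X S c" "homologous_rel p Y T d (chain_map p f c)"
        using surj by blast
      then have "y = ?h (homologous_rel_set p X S c)"
        by (simp add: d h homologous_rel_set_eq)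
      then show "y \<in> ?h ` carrier (relative_homology_group (int p) X S)"
        using c by (auto simp: carrier_relative_homology_group)
    qed
  qed
  ultimately show ?thesis
    by (simp add: iso_def hom_induced_hom bij_betw_def)
qed

lemma hom_induced_isoD:
  assumes f: "continuous_map X Y f" "f \<in> S \<rightarrow> T"
    and iso: "hom_induced (int p) X S Y T f \<in> iso (relative_homology_group (int p) X S) (relative_homology_group (int p) Y T)"
  shows "singular_relcycle p Y T d \<Longrightarrow> \<exists>c. singular_relcycle p X S c \<and> homologous_rel p Y T d (chain_map p f c)"
    and "\<lbrakk>singular_relcycle p X S c; singular_relboundary p Y T (chain_map p f c)\<rbrakk> \<Longrightarrow> singular_relboundary p X S c"
proof -
  let ?h = "hom_induced (int p) X S Y T f"
  have h: "?h (homologous_rel_set p X S c) = homologous_rel_set p Y T (chain_map p f c)"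
    if "singular_relcycle p X S c" for c
    using hom_induced_chain_map[OF f that] .
  have bij: "inj_on ?h (carrier (relative_homology_group (int p) X S))"
    "?h ` carrier (relative_homology_group (int p) X S) = carrier (relative_homology_group (int p) Y T)"
    using iso by (auto simp: iso_def bij_betw_def)
  show "\<exists>c. singular_relcycle p X S c \<and> homologous_rel p Y T d (chain_map p f c)" if "singular_relcycle p Y T d"
  proof -
    have "homologous_rel_set p Y T d \<in> ?h ` carrier (relative_homology_group (int p) X S)"
      using that bij(2) by (simp add: carrier_relative_homology_group)
    then obtain c where c: "singular_relcycle p X S c" and "homologous_rel_set p Y T d = ?h (homologous_rel_set p X S c)"
      by (auto simp: carrier_relative_homology_group)
    then have "homologous_rel_set p Y T d = homologous_rel_set p Y T (chain_map p f c)"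
      using h by simp
    then show ?thesis
      using c by (auto simp: homologous_rel_set_eq)
  qed
  show "singular_relboundary p X S c" if c: "singular_relcycle p X S c" "singular_relboundary p Y T (chain_map p f c)"
  proof -
    have "homologous_rel_set p Y T (chain_map p f c) = homologous_rel_set p Y T (chain_map p f 0)"
      unfolding homologous_rel_set_eq using c(2) by (simp add: homologous_rel_def)
    then have "?h (homologous_rel_set p X S c) = ?h (homologous_rel_set p X S 0)"
      using h[OF c(1)] h[of 0] by simp
    then have "homologous_rel_set p X S c = homologous_rel_set p X S 0"
      using c by (intro inj_onD[OF bij(1)]) (auto simp: carrier_relative_homology_group)
    then show ?thesis
      unfolding homologous_rel_set_eq by (simp add: homologous_rel_def)
  qed
qed

lemma rel_basis_push:
  assumes f: "continuous_map X Y f" "f \<in> S \<rightarrow> T"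
    and iso: "hom_induced (int p) X S Y T f \<in> iso (relative_homology_group (int p) X S) (relative_homology_group (int p) Y T)"
    and z: "rel_basis p X S J z"
  shows "rel_basis p Y T J (\<lambda>j. chain_map p f (z j))"
  unfolding rel_basis_def
proof (intro conjI ballI allI impI)
  show "finite J"
    using z by (simp add: rel_basis_def)
  show "singular_relcycle p Y T (chain_map p f (z j))" if "j \<in> J" for j
    using z that f singular_relcycle_chain_map[of p X S "z j" Y f T] by (simp add: rel_basis_def)
next
  fix d assume "singular_relcycle p Y T d"
  then obtain c where c: "singular_relcycle p X S c" "homologous_rel p Y T d (chain_map p f c)"
    using hom_induced_isoD(1)[OF f iso] by blast
  then obtain a where a: "homologous_rel p X S c (chain_comb J a z)"
    using z by (auto simp: rel_basis_def)
  have "homologous_rel p Y T (chain_map p f c) (chain_map p f (chain_comb J a z))"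
    using a singular_relboundary_chain_map[OF _ f, of p "c - chain_comb J a z"]
    by (simp add: homologous_rel_def chain_map_diff)
  then show "\<exists>a. homologous_rel p Y T d (chain_comb J a (\<lambda>j. chain_map p f (z j)))"
    using c(2) homologous_rel_trans unfolding chain_map_comb by blast
next
  fix a j assume "singular_relboundary p Y T (chain_comb J a (\<lambda>j. chain_map p f (z j)))" "j \<in> J"
  then show "a j = 0"
    using hom_induced_isoD(2)[OF f iso, of "chain_comb J a z"] z
    by (simp add: rel_basis_def chain_map_comb singular_relcycle_comb)
qed

lemma singular_chain_subtopology_in: "singular_chain p (subtopology X S) c \<Longrightarrow> singular_chain p X c"
  by (simp add: singular_chain_subtopology)

lemma sub_chain:
  "C \<subseteq> A \<Longrightarrow> singular_chain p (subtopology (subtopology X A) C) c \<longleftrightarrow> singular_chain p (subtopology X C) c"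
  by (simp add: subtopology_subtopology Int_absorb1)

text \<open>
  For \<open>C \<subseteq> A \<subseteq> X\<close> the following lemmas are pieces of the exact sequence of the triple, stated for
  chains; they hold because a chain in \<open>X\<close> whose boundary lies in \<open>A\<close> can be corrected by a chain in \<open>A\<close>.
\<close>

lemma rel_acyclic_triple_trans:
  assumes CA: "C \<subseteq> A" and 1: "rel_acyclic p (subtopology X A) C" and 2: "rel_acyclic p X A"
  shows "rel_acyclic p X C"
  unfolding rel_acyclic_def
proof (intro allI impI)
  fix c assume c: "singular_relcycle p X C c"
  then have "singular_relcycle p X A c"
    using singular_chain_mono[OF _ CA] by (auto simp: singular_relcycle)
  then obtain d e where d: "singular_chain (Suc p) X d" and e: "singular_chain p (subtopology X A) e"
    and de: "chain_boundary (Suc p) d = c + e"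
    using 2 unfolding rel_acyclic_def singular_relboundary_alt by blast
  have "chain_boundary p c + chain_boundary p e = 0"
    using chain_boundary_boundary_alt[OF d] by (simp add: de chain_boundary_add)
  then have "chain_boundary p e = - chain_boundary p c"
    by (metis add.commute eq_neg_iff_add_eq_0)
  then have "singular_relcycle p (subtopology X A) C e"
    using c e by (simp add: singular_relcycle sub_chain[OF CA] singular_chain_minus)
  then obtain d' e' where d': "singular_chain (Suc p) (subtopology X A) d'" and e': "singular_chain p (subtopology X C) e'"
    and de': "chain_boundary (Suc p) d' = e + e'"
    using 1 unfolding rel_acyclic_def singular_relboundary_alt sub_chain[OF CA] by blast
  have "chain_boundary (Suc p) (d - d') = c + (- e')"
    by (simp add: chain_boundary_diff de de')
  moreover have "singular_chain p (subtopology X C) (- e')"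
    using e' by (simp add: singular_chain_minus)
  ultimately show "singular_relboundary p X C c"
    unfolding singular_relboundary_alt
    using singular_chain_diff[OF d singular_chain_subtopology_in[OF d']] by blast
qed

lemma relcycle_correction:
  assumes CA: "C \<subseteq> A" and 1: "p = 0 \<or> rel_acyclic (p - Suc 0) (subtopology X A) C"
    and c: "singular_relcycle p X A c"
  shows "\<exists>d. singular_chain p (subtopology X A) d \<and> singular_relcycle p X C (c - d)"
proof (cases p)
  case 0
  then show ?thesis
    using c by (intro exI[of _ 0]) (auto simp: singular_relcycle chain_boundary_def)
next
  case (Suc n)
  have cX: "singular_chain (Suc n) X c" and bA: "singular_chain n (subtopology X A) (chain_boundary (Suc n) c)"
    using c Suc by (auto simp: singular_relcycle)
  then have "singular_relcycle n (subtopology X A) C (chain_boundary (Suc n) c)"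
    by (simp add: singular_relcycle chain_boundary_boundary_alt[OF cX])
  then obtain d e where d: "singular_chain (Suc n) (subtopology X A) d" and e: "singular_chain n (subtopology X C) e"
    and de: "chain_boundary (Suc n) d = chain_boundary (Suc n) c + e"
    using 1 Suc unfolding rel_acyclic_def by (auto simp: singular_relboundary_alt sub_chain[OF CA])
  have "singular_relcycle (Suc n) X C (c - d)"
    using cX e singular_chain_subtopology_in[OF d]
    by (simp add: singular_relcycle singular_chain_diff chain_boundary_diff de singular_chain_minus)
  then show ?thesis
    using d Suc by blast
qed

lemma rel_acyclic_triple_quotient:
  assumes CA: "C \<subseteq> A" and 1: "p = 0 \<or> rel_acyclic (p - Suc 0) (subtopology X A) C" and 2: "rel_acyclic p X C"
  shows "rel_acyclic p X A"
  unfolding rel_acyclic_def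
proof (intro allI impI)
  fix c assume "singular_relcycle p X A c"
  then obtain d where d: "singular_chain p (subtopology X A) d" "singular_relcycle p X C (c - d)"
    using relcycle_correction[OF CA 1] by blast
  then obtain f e where f: "singular_chain (Suc p) X f" and e: "singular_chain p (subtopology X C) e"
    and fe: "chain_boundary (Suc p) f = (c - d) + e"
    using 2 unfolding rel_acyclic_def singular_relboundary_alt by blast
  have "singular_chain p (subtopology X A) (e - d)"
    using singular_chain_mono[OF e CA] d(1) by (rule singular_chain_diff)
  moreover have "chain_boundary (Suc p) f = c + (e - d)"
    by (simp add: fe)
  ultimately show "singular_relboundary p X A c"
    using f unfolding singular_relboundary_alt by blast
qed

lemma relboundary_restrict:
  assumes CA: "C \<subseteq> A" and 1: "rel_acyclic p (subtopology X A) C"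
    and c: "singular_relcycle p X C c" "singular_relboundary p X A c"
  shows "singular_relboundary p X C c"
proof -
  obtain d e where d: "singular_chain (Suc p) X d" and e: "singular_chain p (subtopology X A) e"
    and de: "chain_boundary (Suc p) d = c + e"
    using c(2) unfolding singular_relboundary_alt by blast
  have "chain_boundary p c + chain_boundary p e = 0"
    using chain_boundary_boundary_alt[OF d] by (simp add: de chain_boundary_add)
  then have "chain_boundary p e = - chain_boundary p c"
    by (metis add.commute eq_neg_iff_add_eq_0)
  then have "singular_relcycle p (subtopology X A) C e"
    using c(1) e by (simp add: singular_relcycle sub_chain[OF CA] singular_chain_minus)
  then obtain d' e' where d': "singular_chain (Suc p) (subtopology X A) d'" and e': "singular_chain p (subtopology X C) e'"
    and de': "chain_boundary (Suc p) d' = e + e'"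
    using 1 unfolding rel_acyclic_def singular_relboundary_alt sub_chain[OF CA] by blast
  have "chain_boundary (Suc p) (d - d') = c + (- e')"
    by (simp add: chain_boundary_diff de de')
  moreover have "singular_chain p (subtopology X C) (- e')"
    using e' by (simp add: singular_chain_minus)
  ultimately show "singular_relboundary p X C c"
    unfolding singular_relboundary_alt
    using singular_chain_diff[OF d singular_chain_subtopology_in[OF d']] by blast
qed

lemma hom_induced_triple_iso:
  assumes CA: "C \<subseteq> A" and acyc: "\<And>q. rel_acyclic q (subtopology X A) C"
  shows "hom_induced (int p) X C X A id \<in> iso (relative_homology_group (int p) X C) (relative_homology_group (int p) X A)"
proof (rule hom_induced_isoI)
  have id: "chain_map p id c = c" if "singular_chain p X c" for c :: "'a chain"
    using chain_map_id_gen[of p X c id] that by simp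
  fix c assume "singular_relcycle p X A c"
  then obtain d where d: "singular_chain p (subtopology X A) d" "singular_relcycle p X C (c - d)"
    using relcycle_correction[OF CA] acyc by blast
  then have "homologous_rel p X A c (chain_map p id (c - d))"
    by (simp add: id homologous_rel_def singular_relcycle singular_chain_imp_relboundary)
  then show "\<exists>c'. singular_relcycle p X C c' \<and> homologous_rel p X A c (chain_map p id c')"
    using d by blast
next
  have id: "chain_map p id c = c" if "singular_chain p X c" for c :: "'a chain"
    using chain_map_id_gen[of p X c id] that by simp
  fix c assume "singular_relcycle p X C c" "singular_relboundary p X A (chain_map p id c)"
  then show "singular_relboundary p X C c"
    using relboundary_restrict[OF CA acyc] by (simp add: id singular_relcycle)
qed (use CA in auto)

text \<open>
  If \<open>(X, C)\<close> is acyclic, the connecting map from \<open>(X, A)\<close> to \<open>(A, C)\<close> is an isomorphism, so cycles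
  whose boundaries form a basis form a basis.
\<close>

lemma rel_basis_connecting:
  assumes CA: "C \<subseteq> A" and acyc: "rel_acyclic (Suc p) X C"
    and z': "rel_basis p (subtopology X A) C J z'"
    and z: "\<And>j. j \<in> J \<Longrightarrow> singular_relcycle (Suc p) X A (z j)"
    and hom: "\<And>j. j \<in> J \<Longrightarrow> homologous_rel p (subtopology X A) C (chain_boundary (Suc p) (z j)) (z' j)"
  shows "rel_basis (Suc p) X A J z"
  unfolding rel_basis_def
proof (intro conjI ballI allI impI)
  show fin: "finite J"
    using z' by (simp add: rel_basis_def)
  have comb: "homologous_rel p (subtopology X A) C (chain_boundary (Suc p) (chain_comb J a z)) (chain_comb J a z')" for a
    unfolding chain_boundary_comb by (rule homologous_rel_comb[OF fin hom])
  {
    fix c assume c: "singular_relcycle (Suc p) X A c"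
    then have cX: "singular_chain (Suc p) X c" and bA: "singular_chain p (subtopology X A) (chain_boundary (Suc p) c)"
      by (auto simp: singular_relcycle)
    then have "singular_relcycle p (subtopology X A) C (chain_boundary (Suc p) c)"
      by (simp add: singular_relcycle chain_boundary_boundary_alt[OF cX])
    then obtain a where a: "homologous_rel p (subtopology X A) C (chain_boundary (Suc p) c) (chain_comb J a z')"
      using z' by (auto simp: rel_basis_def)
    then have "homologous_rel p (subtopology X A) C (chain_boundary (Suc p) c) (chain_boundary (Suc p) (chain_comb J a z))"
      using comb homologous_rel_trans homologous_rel_sym by metis
    then obtain d e where d: "singular_chain (Suc p) (subtopology X A) d" and e: "singular_chain p (subtopology X C) e"
      and de: "chain_boundary (Suc p) d = chain_boundary (Suc p) (c - chain_comb J a z) + e"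
      unfolding homologous_rel_def chain_boundary_diff[symmetric] singular_relboundary_alt sub_chain[OF CA] by blast
    have zX: "singular_chain (Suc p) X (chain_comb J a z)"
      using singular_relcycle_comb[OF z, where a = a] by (simp add: singular_relcycle)
    have "singular_relcycle (Suc p) X C (c - chain_comb J a z - d)"
      unfolding singular_relcycle chain_boundary_diff[of _ "c - chain_comb J a z"] de
      using cX zX e singular_chain_subtopology_in[OF d]
      by (simp add: singular_chain_diff singular_chain_minus)
    then obtain f e' where f: "singular_chain (Suc (Suc p)) X f" and e': "singular_chain (Suc p) (subtopology X C) e'"
      and fe: "chain_boundary (Suc (Suc p)) f = (c - chain_comb J a z - d) + e'"
      using acyc unfolding rel_acyclic_def singular_relboundary_alt by blast
    have "chain_boundary (Suc (Suc p)) f = (c - chain_comb J a z) + (e' - d)"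
      by (simp add: fe)
    moreover have "singular_chain (Suc p) (subtopology X A) (e' - d)"
      using singular_chain_mono[OF e' CA] d by (rule singular_chain_diff)
    ultimately have "homologous_rel (Suc p) X A c (chain_comb J a z)"
      using f unfolding homologous_rel_def singular_relboundary_alt by blast
    then show "\<exists>a. homologous_rel (Suc p) X A c (chain_comb J a z)"
      by blast
  next
    fix a j assume b: "singular_relboundary (Suc p) X A (chain_comb J a z)" and j: "j \<in> J"
    then obtain f e where f: "singular_chain (Suc (Suc p)) X f" and e: "singular_chain (Suc p) (subtopology X A) e"
      and fe: "chain_boundary (Suc (Suc p)) f = chain_comb J a z + e"
      unfolding singular_relboundary_alt by blast
    have "chain_boundary (Suc p) (chain_comb J a z) + chain_boundary (Suc p) e = 0"
      using chain_boundary_boundary_alt[OF f] by (simp add: fe chain_boundary_add)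
    then have "chain_boundary (Suc p) (- e) = chain_boundary (Suc p) (chain_comb J a z)"
      by (metis chain_boundary_minus eq_neg_iff_add_eq_0)
    then have "singular_relboundary p (subtopology X A) C (chain_boundary (Suc p) (chain_comb J a z))"
      using e unfolding singular_relboundary_def mod_subset_def
      by (intro exI[of _ "- e"]) (simp add: singular_chain_minus)
    then have "singular_relboundary p (subtopology X A) C (chain_comb J a z')"
      using homologous_rel_relboundary[OF comb] by blast
    then show "a j = 0"
      using z' j by (auto simp: rel_basis_def)
  }
qed (use z in auto)

lemma chain_comb_Un:
  "finite J \<Longrightarrow> finite K \<Longrightarrow> J \<inter> K = {} \<Longrightarrow> chain_comb (J \<union> K) a z = chain_comb J a z + chain_comb K a z"
  by (simp add: chain_comb_def sum.union_disjoint)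

lemma chain_comb_cong: "(\<And>j. j \<in> J \<Longrightarrow> a j = b j) \<Longrightarrow> (\<And>j. j \<in> J \<Longrightarrow> z j = w j) \<Longrightarrow> chain_comb J a z = chain_comb J b w"
  by (simp add: chain_comb_def)

text \<open>
  If the basis of \<open>(X, A)\<close> consists of cycles relative to the smaller set \<open>C\<close>, the exact sequence of
  the triple splits, and the two bases combine.
\<close>

lemma rel_basis_Un:
  assumes CA: "C \<subseteq> A" and J: "rel_basis p (subtopology X A) C J z" and K: "rel_basis p X A K z"
    and disj: "J \<inter> K = {}" and zK: "\<And>k. k \<in> K \<Longrightarrow> singular_relcycle p X C (z k)"
    and acyc: "rel_acyclic (Suc p) X A"
  shows "rel_basis p X C (J \<union> K) z"
  unfolding rel_basis_def
proof (intro conjI ballI allI impI)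
  have fin: "finite J" "finite K"
    using J K by (simp_all add: rel_basis_def)
  then show "finite (J \<union> K)"
    by simp
  have zJ: "singular_relcycle p (subtopology X A) C (z j)" if "j \<in> J" for j
    using J that by (simp add: rel_basis_def)
  then show "singular_relcycle p X C (z j)" if "j \<in> J \<union> K" for j
  proof (cases "j \<in> K")
    case False
    with that have "singular_relcycle p (subtopology X A) C (z j)"
      using zJ by blast
    then show ?thesis
      using singular_chain_subtopology_in[of p X A "z j"] by (simp add: singular_relcycle sub_chain[OF CA])
  qed (rule zK)
  {
    fix c assume c: "singular_relcycle p X C c"
    then have "singular_relcycle p X A c"
      using singular_chain_mono[OF _ CA] by (auto simp: singular_relcycle)
    then obtain a where "homologous_rel p X A c (chain_comb K a z)"
      using K by (auto simp: rel_basis_def)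
    then obtain d e where d: "singular_chain (Suc p) X d" and e: "singular_chain p (subtopology X A) e"
      and de: "chain_boundary (Suc p) d = (c - chain_comb K a z) + e"
      unfolding homologous_rel_def singular_relboundary_alt by blast
    have "chain_boundary p (c - chain_comb K a z) + chain_boundary p e = 0"
      using chain_boundary_boundary_alt[OF d] by (simp add: de chain_boundary_add)
    then have "chain_boundary p (- e) = chain_boundary p (c - chain_comb K a z)"
      by (metis chain_boundary_minus eq_neg_iff_add_eq_0)
    moreover have "singular_relcycle p X C (c - chain_comb K a z)"
      by (intro singular_relcycle_diff c singular_relcycle_comb zK)
    ultimately have "singular_relcycle p (subtopology X A) C (- e)"
      using e by (simp add: singular_relcycle sub_chain[OF CA] singular_chain_minus)
    then obtain b where "homologous_rel p (subtopology X A) C (- e) (chain_comb J b z)"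
      using J by (auto simp: rel_basis_def)
    then obtain d' e' where d': "singular_chain (Suc p) (subtopology X A) d'" and e': "singular_chain p (subtopology X C) e'"
      and de': "chain_boundary (Suc p) d' = (- e - chain_comb J b z) + e'"
      unfolding homologous_rel_def singular_relboundary_alt sub_chain[OF CA] by blast
    define ab where "ab j = (if j \<in> J then b j else a j)" for j
    have "chain_comb (J \<union> K) ab z = chain_comb J b z + chain_comb K a z"
      unfolding chain_comb_Un[OF fin disj] using disj
      by (auto simp: ab_def intro!: arg_cong2[where f="(+)"] chain_comb_cong)
    then have "chain_boundary (Suc p) (d + d') = (c - chain_comb (J \<union> K) ab z) + e'"
      by (simp add: chain_boundary_add de de')
    then have "homologous_rel p X C c (chain_comb (J \<union> K) ab z)"
      using singular_chain_add[OF d singular_chain_subtopology_in[OF d']] e'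
      unfolding homologous_rel_def singular_relboundary_alt by blast
    then show "\<exists>a. homologous_rel p X C c (chain_comb (J \<union> K) a z)"
      by blast
  next
    fix a j assume "singular_relboundary p X C (chain_comb (J \<union> K) a z)" and j: "j \<in> J \<union> K"
    then obtain d e where d: "singular_chain (Suc p) X d" and e: "singular_chain p (subtopology X C) e"
      and de: "chain_boundary (Suc p) d = chain_comb (J \<union> K) a z + e"
      unfolding singular_relboundary_alt by blast
    have eA: "singular_chain p (subtopology X A) e"
      by (rule singular_chain_mono[OF e CA])
    have JA: "singular_chain p (subtopology X A) (chain_comb J a z)"
      using singular_relcycle_comb[OF zJ, where a = a] by (simp add: singular_relcycle)
    have "chain_boundary (Suc p) d = chain_comb K a z + (chain_comb J a z + e)"
      by (simp add: de chain_comb_Un[OF fin disj])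
    then have "singular_relboundary p X A (chain_comb K a z)"
      using d singular_chain_add[OF JA eA] unfolding singular_relboundary_alt by blast
    then have aK: "\<forall>k\<in>K. a k = 0"
      using K by (auto simp: rel_basis_def)
    then have "chain_comb K a z = 0"
      by (simp add: chain_comb_def)
    then have de2: "chain_boundary (Suc p) d = chain_comb J a z + e"
      by (simp add: de chain_comb_Un[OF fin disj])
    \<comment> \<open>\<open>d\<close> is a cycle relative to \<open>A\<close>, hence up to boundaries a chain in \<open>A\<close>, so the combination
        over \<open>J\<close> is already a boundary in \<open>(A, C)\<close>\<close>
    have "singular_relcycle (Suc p) X A d"
      using d singular_chain_add[OF JA eA] by (simp add: singular_relcycle de2)
    then obtain f g where f: "singular_chain (Suc (Suc p)) X f" and g: "singular_chain (Suc p) (subtopology X A) g"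
      and fg: "chain_boundary (Suc (Suc p)) f = d + g"
      using acyc unfolding rel_acyclic_def singular_relboundary_alt by blast
    have "chain_boundary (Suc p) d + chain_boundary (Suc p) g = 0"
      using chain_boundary_boundary_alt[OF f] by (simp add: fg chain_boundary_add)
    then have "chain_boundary (Suc p) (- g) = chain_comb J a z + e"
      by (metis chain_boundary_minus eq_neg_iff_add_eq_0 de2)
    moreover have "singular_chain (Suc p) (subtopology X A) (- g)"
      using g by (simp add: singular_chain_minus)
    ultimately have "singular_relboundary p (subtopology X A) C (chain_comb J a z)"
      unfolding singular_relboundary_alt sub_chain[OF CA] using e by blast
    then show "a j = 0"
      using J aK j by (auto simp: rel_basis_def)
  }
qed

lemma rel_basis_cong:
  assumes "rel_basis p X S J z" "\<And>j. j \<in> J \<Longrightarrow> z j = w j"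
  shows "rel_basis p X S J w"
proof -
  have "chain_comb J a z = chain_comb J a w" for a
    by (rule chain_comb_cong) (use assms(2) in auto)
  then show ?thesis
    using assms by (auto simp: rel_basis_def)
qed

section \<open>Homology of a space with cells attached\<close>

lemma rel_acyclic_topspace: "rel_acyclic p X (topspace X)"
  unfolding rel_acyclic_iff_trivial by (rule trivial_relative_homology_group_topspace)

text \<open>
  A deformation of \<open>X\<close> into \<open>S\<close> that keeps \<open>S\<close> inside \<open>S\<close> makes the identity of the pair
  \<open>(X, S)\<close> homotopic to a map into \<open>(S, S)\<close>.
\<close>

lemma rel_acyclic_deformation:
  assumes h: "continuous_map (prod_topology (top_of_set {0..1::real}) X) X h"
    and S: "S \<subseteq> topspace X"
    and h0: "\<And>x. x \<in> topspace X \<Longrightarrow> h (0, x) = x"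
    and hS: "\<And>t x. \<lbrakk>0 \<le> t; t \<le> 1; x \<in> S\<rbrakk> \<Longrightarrow> h (t, x) \<in> S"
    and h1: "\<And>x. x \<in> topspace X \<Longrightarrow> h (1, x) \<in> S"
  shows "rel_acyclic p X S"
proof -
  let ?g = "\<lambda>x. h (1, x)"
  let ?H = "relative_homology_group (int p) X S"
  have "homotopic_with (\<lambda>k. k \<in> S \<rightarrow> S) X X id ?g"
  proof (subst homotopic_with, goal_cases)
    case (1 k k')
    then have "k x = k' x" if "x \<in> S" for x
      using that S by auto
    then show ?case by (simp add: Pi_iff)
  next
    case 2
    show ?case
      using h h0 hS by (intro exI[of _ h]) auto
  qed
  then have id_eq: "hom_induced (int p) X S X S id = hom_induced (int p) X S X S ?g"
    by (rule homology_homotopy_axiom)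
  have g: "continuous_map X X ?g"
    using continuous_map_compose[OF _ h, of X "\<lambda>x. (1, x)"]
    by (simp add: o_def continuous_map_pairwise)
  have gS: "continuous_map X (subtopology X S) ?g"
    using g h1 by (auto simp: continuous_map_in_subtopology)
  have comp: "hom_induced (int p) X S X S ?g =
      hom_induced (int p) (subtopology X S) S X S id \<circ> hom_induced (int p) X S (subtopology X S) S ?g"
    using hom_induced_compose[where f = ?g and g = id and X = X and Y = "subtopology X S" and Z = X
        and S = S and T = S and U = S and p = "int p"] gS hS[of 1]
    by (simp add: o_def)
  have triv: "trivial_group (relative_homology_group (int p) (subtopology X S) S)"
    using trivial_relative_homology_group_topspace[of "int p" "subtopology X S"] S
    by (simp add: Int_absorb1)
  have "x = \<one>\<^bsub>?H\<^esub>" if x: "x \<in> carrier ?H" for x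
  proof -
    have "hom_induced (int p) X S (subtopology X S) S ?g x \<in> carrier (relative_homology_group (int p) (subtopology X S) S)"
      by (rule hom_induced_carrier)
    then have "hom_induced (int p) X S (subtopology X S) S ?g x = \<one>\<^bsub>relative_homology_group (int p) (subtopology X S) S\<^esub>"
      using triv by (simp add: trivial_group_def)
    then have "hom_induced (int p) X S X S ?g x = \<one>\<^bsub>?H\<^esub>"
      unfolding comp o_def
      by (simp only:) (rule hom_one[OF hom_induced_hom group_relative_homology_group group_relative_homology_group])
    then show ?thesis
      using hom_induced_id[OF x] id_eq by simp
  qed
  then show ?thesis
    unfolding rel_acyclic_iff_trivial group.trivial_group_subset[OF group_relative_homology_group] by blast
qed

text \<open>
  Two out of three for maps that induce isomorphisms in relative homology.
\<close>

lemma iso_cancel_right: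
  assumes f: "continuous_map X Y f" "f \<in> S \<rightarrow> T" and g: "continuous_map Y Z g" "g \<in> T \<rightarrow> U"
    and f_iso: "hom_induced p X S Y T f \<in> iso (relative_homology_group p X S) (relative_homology_group p Y T)"
    and gf_iso: "hom_induced p X S Z U (g \<circ> f) \<in> iso (relative_homology_group p X S) (relative_homology_group p Z U)"
  shows "hom_induced p Y T Z U g \<in> iso (relative_homology_group p Y T) (relative_homology_group p Z U)"
  using f_iso gf_iso unfolding hom_induced_compose[OF f g] iso_def
  by (simp add: hom_induced_hom bij_betw_comp_iff)

lemma iso_cancel_left:
  assumes f: "continuous_map X Y f" "f \<in> S \<rightarrow> T" and g: "continuous_map Y Z g" "g \<in> T \<rightarrow> U"
    and g_iso: "hom_induced p Y T Z U g \<in> iso (relative_homology_group p Y T) (relative_homology_group p Z U)"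
    and gf_iso: "hom_induced p X S Z U (g \<circ> f) \<in> iso (relative_homology_group p X S) (relative_homology_group p Z U)"
  shows "hom_induced p X S Y T f \<in> iso (relative_homology_group p X S) (relative_homology_group p Y T)"
proof -
  have "hom_induced p X S Y T f ` carrier (relative_homology_group p X S) \<subseteq> carrier (relative_homology_group p Y T)"
    by (auto simp: hom_induced_carrier)
  then show ?thesis
    using g_iso gf_iso unfolding hom_induced_compose[OF f g] iso_def
    by (simp add: hom_induced_hom bij_betw_comp_iff2[of "hom_induced p Y T Z U g"])
qed

lemma iso_comp:
  assumes f: "continuous_map X Y f" "f \<in> S \<rightarrow> T" and g: "continuous_map Y Z g" "g \<in> T \<rightarrow> U"
    and "hom_induced p X S Y T f \<in> iso (relative_homology_group p X S) (relative_homology_group p Y T)"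
    and "hom_induced p Y T Z U g \<in> iso (relative_homology_group p Y T) (relative_homology_group p Z U)"
  shows "hom_induced p X S Z U (g \<circ> f) \<in> iso (relative_homology_group p X S) (relative_homology_group p Z U)"
  unfolding hom_induced_compose[OF f g] by (rule iso_set_trans) (rule assms)+

text \<open>
  A relative homeomorphism induces isomorphisms if the subspace \<open>A\<close> has a collar \<open>W\<close> in \<open>D\<close>:
  the collar descends to a collar of \<open>B\<close>, and away from \<open>A\<close> and \<open>B\<close> the map is a homeomorphism.
\<close>

lemma relative_homeomorphism_iso:
  fixes f :: "'b \<Rightarrow> 'a"
  assumes D: "compact_space D" and Y: "Hausdorff_space Y" and f: "continuous_map D Y f"
    and B: "closedin Y B" and cover: "topspace Y = B \<union> f ` topspace D"
    and A: "A = {x \<in> topspace D. f x \<in> B}" and inj: "inj_on f (topspace D - A)"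
    and W: "openin D W" "A \<subseteq> W"
    and h: "continuous_map (prod_topology (top_of_set {0..1::real}) (subtopology D W)) (subtopology D W) h"
    and h0: "\<And>w. w \<in> W \<Longrightarrow> h (0, w) = w"
    and hA: "\<And>t w. \<lbrakk>0 \<le> t; t \<le> 1; w \<in> A\<rbrakk> \<Longrightarrow> h (t, w) = w"
    and h1: "\<And>w. w \<in> W \<Longrightarrow> h (1, w) \<in> A"
  shows "hom_induced (int p) D A Y B f \<in> iso (relative_homology_group (int p) D A) (relative_homology_group (int p) Y B)"
proof -
  let ?I = "top_of_set {0..1::real}"
  define V where "V = B \<union> f ` W"
  have WD: "W \<subseteq> topspace D" and BY: "B \<subseteq> topspace Y"
    using openin_subset[OF W(1)] closedin_subset[OF B] by auto
  have fD: "f x \<in> topspace Y" if "x \<in> topspace D" for x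
    using f that by (auto simp: continuous_map_def)
  have VY: "V \<subseteq> topspace Y"
    using BY WD fD by (auto simp: V_def)
  have fV: "f x \<in> V \<longleftrightarrow> x \<in> W" if x: "x \<in> topspace D" for x
  proof
    assume "f x \<in> V"
    then consider "f x \<in> B" | w where "w \<in> W" "f x = f w" "f x \<notin> B"
      unfolding V_def by blast
    then show "x \<in> W"
    proof cases
      case 1
      then show ?thesis using x W A by auto
    next
      case 2
      then have "x = w"
        using x WD by (intro inj_onD[OF inj]) (auto simp: A)
      then show ?thesis using 2 by simp
    qed
  qed (simp add: V_def)
  have clf: "closed_map D Y f"
    by (rule T1_Spaces.continuous_imp_closed_map[OF f D Y])
  have "topspace Y - V = f ` (topspace D - W)"
    using cover fV VY by (auto simp: V_def)
  moreover have "closedin Y (f ` (topspace D - W))"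
    using clf W(1) by (auto simp: closed_map_def)
  ultimately have Vopen: "openin Y V"
    using VY by (simp add: openin_closedin_eq)
  have hW: "h (t, w) \<in> W" if "0 \<le> t" "t \<le> 1" "w \<in> W" for t w
    using h that WD by (auto simp: continuous_map_def Pi_iff Int_absorb1)
  have acycW: "rel_acyclic q (subtopology D W) A" for q
    by (rule rel_acyclic_deformation[OF h]) (use W WD h0 hA h1 in auto)
  have acycV: "rel_acyclic q (subtopology Y V) B" for q
  proof -
    \<comment> \<open>the collar deformation carried over to \<open>V\<close>; it is continuous because
        \<open>id \<times> f\<close> is a closed map\<close>
    define F where "F = (\<lambda>(t, y). if y \<in> B then y else f (h (t, inv_into (topspace D - A) f y)))"
    have F: "F (t, f w) = f (h (t, w))" if "0 \<le> t" "t \<le> 1" "w \<in> W" for t w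
    proof (cases "f w \<in> B")
      case True
      then have "w \<in> A"
        using that WD by (auto simp: A)
      then show ?thesis
        using True that by (simp add: F_def hA)
    next
      case False
      then have "inv_into (topspace D - A) f (f w) = w"
        using that WD by (intro inv_into_f_f[OF inj]) (auto simp: A)
      then show ?thesis
        using False by (simp add: F_def)
    qed
    have FB: "F (t, y) = y" if "y \<in> B" for t y
      using that by (simp add: F_def)
    have FV: "F (t, y) \<in> V" if "0 \<le> t" "t \<le> 1" "y \<in> V" for t y
      using that hW unfolding V_def by (auto simp: FB F)
    let ?q = "\<lambda>(t, w). (t, f w)"
    have q: "continuous_map (prod_topology ?I D) (prod_topology ?I Y) ?q"
      using f by (auto simp: continuous_map_pairwise o_def case_prod_unfold
          intro!: continuous_map_fst continuous_map_compose[OF continuous_map_snd, unfolded o_def])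
    have "closed_map (prod_topology ?I D) (prod_topology ?I Y) ?q"
      by (rule T1_Spaces.continuous_imp_closed_map[OF q])
        (auto simp: compact_space_prod_topology D Y Hausdorff_space_prod_topology compact_space_subtopology
          Hausdorff_space_subtopology)
    then have clq: "closed_map (prod_topology ?I (subtopology D W)) (prod_topology ?I (subtopology Y V)) ?q"
      unfolding prod_topology_subtopology(2) by (rule closed_map_restriction) (use fV WD in auto)
    have fh: "continuous_map (prod_topology ?I (subtopology D W)) Y (\<lambda>x. f (h x))"
      using continuous_map_compose[OF continuous_map_into_fulltopology[OF h] f] by (simp add: o_def)
    have "continuous_map (prod_topology ?I (subtopology Y V)) Y F"
      unfolding continuous_map_closedin
    proof (intro conjI allI impI)
      show "F \<in> topspace (prod_topology ?I (subtopology Y V)) \<rightarrow> topspace Y"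
        using FV VY by auto
      fix C assume C: "closedin Y C"
      have "{x \<in> topspace (prod_topology ?I (subtopology Y V)). F x \<in> C} =
        {0..1} \<times> (B \<inter> C) \<union> ?q ` {x \<in> topspace (prod_topology ?I (subtopology D W)). f (h x) \<in> C}" (is "?l = ?r")
      proof
        show "?l \<subseteq> ?r"
        proof
          fix x assume x: "x \<in> ?l"
          then obtain t y where ty: "x = (t, y)" "0 \<le> t" "t \<le> 1" "y \<in> V" "F (t, y) \<in> C"
            by auto
          show "x \<in> ?r"
          proof (cases "y \<in> B")
            case True
            then show ?thesis
              using ty by (simp add: FB)
          next
            case False
            then obtain w where w: "w \<in> W" "y = f w"
              using ty by (auto simp: V_def)
            then have "(t, w) \<in> {x \<in> topspace (prod_topology ?I (subtopology D W)). f (h x) \<in> C}"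
              using ty WD by (auto simp: F)
            then show ?thesis
              using ty w by (intro UnI2 image_eqI[of _ _ "(t, w)"]) auto
          qed
        qed
        show "?r \<subseteq> ?l"
          using BY VY WD fV by (auto simp: FB F V_def)
      qed
      moreover have "closedin (prod_topology ?I (subtopology Y V)) ({0..1} \<times> (B \<inter> C))"
      proof -
        have "closedin (subtopology Y V) (B \<inter> C)"
          unfolding closedin_subtopology using B C by (intro exI[of _ "B \<inter> C"]) (auto simp: V_def)
        then show ?thesis
          by (simp add: closedin_prod_Times_iff)
      qed
      moreover have "closedin (prod_topology ?I (subtopology Y V)) (?q ` {x \<in> topspace (prod_topology ?I (subtopology D W)). f (h x) \<in> C})"
        using clq closedin_continuous_map_preimage[OF fh C] unfolding closed_map_def by blast
      ultimately show "closedin (prod_topology ?I (subtopology Y V)) {x \<in> topspace (prod_topology ?I (subtopology Y V)). F x \<in> C}"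
        by (simp only: closedin_Un)
    qed
    then have contF: "continuous_map (prod_topology ?I (subtopology Y V)) (subtopology Y V) F"
      using FV by (auto simp: continuous_map_in_subtopology)
    show ?thesis
    proof (rule rel_acyclic_deformation[OF contF])
      show "F (0, y) = y" if "y \<in> topspace (subtopology Y V)" for y
        using that by (auto simp: V_def FB F h0)
      show "F (1, y) \<in> B" if "y \<in> topspace (subtopology Y V)" for y
        using that h1 by (auto simp: V_def FB F A)
    qed (use BY in \<open>auto simp: V_def FB\<close>)
  qed
  have AW: "A \<subseteq> topspace D"
    by (auto simp: A)
  have fA: "f \<in> A \<rightarrow> B" and fW: "f \<in> W \<rightarrow> V"
    by (auto simp: A V_def)
  \<comment> \<open>excise \<open>A\<close> and \<open>B\<close>: on the complements \<open>f\<close> is a homeomorphism\<close>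
  let ?D' = "subtopology D (topspace D - A)" and ?Y' = "subtopology Y (topspace Y - B)"
  have "closedin D A"
    unfolding A by (rule closedin_continuous_map_preimage[OF f B])
  then have excD: "hom_induced (int p) ?D' (W - A) D W id \<in> iso (relative_homology_group (int p) ?D' (W - A)) (relative_homology_group (int p) D W)"
    using homology_excision_axiom[of D A W "topspace D" "int p"] W WD
    by (simp add: closure_of_closedin interior_of_openin)
  have excY: "hom_induced (int p) ?Y' (V - B) Y V id \<in> iso (relative_homology_group (int p) ?Y' (V - B)) (relative_homology_group (int p) Y V)"
    using homology_excision_axiom[of Y B V "topspace Y" "int p"] Vopen VY B
    by (simp add: closure_of_closedin interior_of_openin V_def)
  have "homeomorphic_map ?D' ?Y' f"
  proof (rule bijective_closed_imp_homeomorphic_map)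
    show "continuous_map ?D' ?Y' f"
      using f fD by (auto simp: continuous_map_in_subtopology continuous_map_from_subtopology A)
    show "closed_map ?D' ?Y' f"
      by (rule closed_map_restriction[OF clf]) (use fD in \<open>auto simp: A\<close>)
    show "f ` topspace ?D' = topspace ?Y'"
      using cover fD by (auto simp: A)
    show "inj_on f (topspace ?D')"
      using inj by (simp add: Int_absorb1)
  qed
  moreover have "f ` (W - A) = V - B"
    using WD by (auto simp: V_def A)
  ultimately have homeo: "hom_induced (int p) ?D' (W - A) ?Y' (V - B) f \<in> iso (relative_homology_group (int p) ?D' (W - A)) (relative_homology_group (int p) ?Y' (V - B))"
    using WD by (intro homeomorphic_map_relative_homology_iso) auto
  have fD': "continuous_map ?D' ?Y' f" "f \<in> W - A \<rightarrow> V - B"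
    using f fD \<open>f ` (W - A) = V - B\<close> by (auto simp: continuous_map_in_subtopology continuous_map_from_subtopology A)
  have "hom_induced (int p) ?D' (W - A) Y V (id \<circ> f) \<in> iso (relative_homology_group (int p) ?D' (W - A)) (relative_homology_group (int p) Y V)"
    by (rule iso_comp[OF fD' _ _ homeo excY]) auto
  then have fDW: "hom_induced (int p) D W Y V f \<in> iso (relative_homology_group (int p) D W) (relative_homology_group (int p) Y V)"
    by (intro iso_cancel_right[OF _ _ f fW excD]) auto
  have "hom_induced (int p) D A Y V (f \<circ> id) \<in> iso (relative_homology_group (int p) D A) (relative_homology_group (int p) Y V)"
    by (rule iso_comp[OF _ _ f fW hom_induced_triple_iso[OF W(2) acycW] fDW]) (use W in auto)
  then show ?thesis
    by (intro iso_cancel_left[OF f fA _ _ hom_induced_triple_iso[OF _ acycV]]) (auto simp: V_def)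
qed

subsection \<open>The simplex and its boundary\<close>

definition simplex_top :: "nat \<Rightarrow> (nat \<Rightarrow> real) topology" where
  "simplex_top p = subtopology (powertop_real UNIV) (standard_simplex p)"

definition simplex_bd :: "nat \<Rightarrow> (nat \<Rightarrow> real) set" where
  "simplex_bd p = {x \<in> standard_simplex p. \<exists>i\<le>p. x i = 0}"

primrec min_coord :: "nat \<Rightarrow> (nat \<Rightarrow> real) \<Rightarrow> real" where
  "min_coord 0 x = x 0"
| "min_coord (Suc p) x = min (min_coord p x) (x (Suc p))"

text \<open>
  Subtracting a multiple of the smallest coordinate from all coordinates and rescaling moves a point
  away from the barycentre, and reaches the boundary at time 1. This works where the smallest
  coordinate is less than \<open>1 / (p + 1)\<close>; the collar uses half of this bound, which keeps the scaling
  factor away from 0.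
\<close>

definition collar_flow :: "nat \<Rightarrow> real \<times> (nat \<Rightarrow> real) \<Rightarrow> nat \<Rightarrow> real" where
  "collar_flow p = (\<lambda>(t, x) i. if i \<le> p then (x i - t * min_coord p x) / (1 - (real p + 1) * t * min_coord p x) else 0)"

definition collar :: "nat \<Rightarrow> (nat \<Rightarrow> real) set" where
  "collar p = {x \<in> standard_simplex p. min_coord p x < 1 / (2 * (real p + 1))}"

lemma topspace_simplex_top [simp]: "topspace (simplex_top p) = standard_simplex p"
  by (simp add: simplex_top_def)

lemma compact_space_simplex_top: "compact_space (simplex_top p)"
  by (simp add: simplex_top_def compact_space_subtopology compactin_standard_simplex)

lemma Hausdorff_space_simplex_top: "Hausdorff_space (simplex_top p)"
  by (simp add: simplex_top_def Hausdorff_space_subtopology Hausdorff_space_product_topology)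

lemma standard_simplex_iff:
  "x \<in> standard_simplex p \<longleftrightarrow> (\<forall>i. 0 \<le> x i) \<and> (\<forall>i>p. x i = 0) \<and> (\<Sum>i\<le>p. x i) = 1"
proof -
  have "x i \<le> 1" if "\<forall>i. 0 \<le> x i" "\<forall>i>p. x i = 0" "(\<Sum>i\<le>p. x i) = 1" for i
  proof (cases "i \<le> p")
    case True
    then have "x i \<le> (\<Sum>i\<le>p. x i)"
      using that by (intro member_le_sum) auto
    then show ?thesis using that by simp
  qed (use that in auto)
  then show ?thesis
    by (auto simp: standard_simplex_def)
qed

lemma min_coord_le: "i \<le> p \<Longrightarrow> min_coord p x \<le> x i"
  by (induction p) (auto simp: le_Suc_eq min_le_iff_disj)

lemma min_coord_attained: "\<exists>i\<le>p. min_coord p x = x i"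
proof (induction p)
  case (Suc p)
  then obtain i where "i \<le> p" "min_coord p x = x i"
    by blast
  then show ?case
    by (cases "min_coord p x \<le> x (Suc p)") (auto simp: min_def intro: exI[of _ i] exI[of _ "Suc p"])
qed auto

lemma min_coord_simplex:
  assumes "x \<in> standard_simplex p"
  shows "0 \<le> min_coord p x" "(real p + 1) * min_coord p x \<le> 1" "min_coord p x = 0 \<longleftrightarrow> x \<in> simplex_bd p"
proof -
  show 0: "0 \<le> min_coord p x"
    using min_coord_attained[of p x] assms by (auto simp: standard_simplex_iff)
  have "(\<Sum>i\<le>p. min_coord p x) \<le> (\<Sum>i\<le>p. x i)"
    by (intro sum_mono min_coord_le) simp
  then show "(real p + 1) * min_coord p x \<le> 1"
    using assms by (simp add: standard_simplex_iff algebra_simps)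
  show "min_coord p x = 0 \<longleftrightarrow> x \<in> simplex_bd p"
  proof
    assume "x \<in> simplex_bd p"
    then obtain i where "i \<le> p" "x i = 0"
      by (auto simp: simplex_bd_def)
    then show "min_coord p x = 0"
      using min_coord_le[of i p x] 0 by simp
  qed (use min_coord_attained[of p x] assms in \<open>auto simp: simplex_bd_def\<close>)
qed

lemma continuous_map_min_coord: "continuous_map (powertop_real UNIV) euclideanreal (min_coord p)"
proof (induction p)
  case 0
  have "min_coord 0 = (\<lambda>x. x 0)" by auto
  then show ?case
    using continuous_map_product_projection[of 0 UNIV "\<lambda>_. euclideanreal"] by simp
next
  case (Suc p)
  have "min_coord (Suc p) = (\<lambda>x. min (min_coord p x) (x (Suc p)))" by auto
  then show ?case
    using Suc by (auto intro!: continuous_map_real_min continuous_map_product_projection)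
qed

lemma collar_denominator:
  assumes "x \<in> collar p" "0 \<le> t" "t \<le> 1"
  shows "1 - (real p + 1) * t * min_coord p x \<ge> 1 / 2"
proof -
  have "0 \<le> min_coord p x" "(real p + 1) * min_coord p x \<le> 1 / 2"
    using assms(1) min_coord_simplex(1)[of x p] by (auto simp: collar_def field_simps)
  moreover have "t * ((real p + 1) * min_coord p x) \<le> 1 * ((real p + 1) * min_coord p x)"
    using assms calculation by (intro mult_right_mono) auto
  ultimately show ?thesis
    by (simp add: algebra_simps)
qed

lemma collar_flow_in_collar:
  assumes x: "x \<in> collar p" and t: "0 \<le> t" "t \<le> 1"
  shows "collar_flow p (t, x) \<in> collar p"
proof -
  let ?m = "min_coord p x" and ?d = "1 - (real p + 1) * t * min_coord p x"
  have xs: "x \<in> standard_simplex p" and mlt: "?m < 1 / (2 * (real p + 1))"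
    using x by (auto simp: collar_def)
  have d: "?d \<ge> 1 / 2"
    by (rule collar_denominator[OF x t])
  have m0: "0 \<le> ?m" "(real p + 1) * ?m \<le> 1"
    using min_coord_simplex[OF xs] by auto
  have tm: "t * ?m \<le> x i" if "i \<le> p" for i
  proof -
    have "t * ?m \<le> 1 * ?m"
      using t m0 by (intro mult_right_mono) auto
    then show ?thesis
      using min_coord_le[OF that, of x] by simp
  qed
  have "(\<Sum>i\<le>p. collar_flow p (t, x) i) = (\<Sum>i\<le>p. x i - t * ?m) / ?d"
    by (simp add: collar_flow_def sum_divide_distrib)
  also have "(\<Sum>i\<le>p. x i - t * ?m) = ?d"
    using xs by (simp add: sum_subtractf standard_simplex_iff algebra_simps)
  finally have "(\<Sum>i\<le>p. collar_flow p (t, x) i) = 1"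
    using d by simp
  moreover have "0 \<le> collar_flow p (t, x) i" for i
    using tm[of i] d by (auto simp: collar_flow_def intro!: divide_nonneg_nonneg)
  ultimately have fs: "collar_flow p (t, x) \<in> standard_simplex p"
    by (simp add: standard_simplex_iff) (simp add: collar_flow_def)
  obtain i where i: "i \<le> p" "?m = x i"
    using min_coord_attained by blast
  have "t * ?m * ((real p + 1) * ?m) \<le> t * ?m * 1"
    using m0 t by (intro mult_left_mono) auto
  then have "?m - t * ?m \<le> ?m * ?d"
    by (simp add: algebra_simps)
  then have "(?m - t * ?m) / ?d \<le> ?m"
    using d by (simp add: pos_divide_le_eq)
  then have "min_coord p (collar_flow p (t, x)) \<le> ?m"
    using min_coord_le[OF i(1), of "collar_flow p (t, x)"] i by (simp add: collar_flow_def)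
  then show ?thesis
    using fs mlt by (simp add: collar_def)
qed

lemma collar_flow_0: "x \<in> standard_simplex p \<Longrightarrow> collar_flow p (0, x) = x"
  by (auto simp: collar_flow_def standard_simplex_iff)

lemma collar_flow_bd: "x \<in> simplex_bd p \<Longrightarrow> collar_flow p (t, x) = x"
  using min_coord_simplex(3)[of x p] by (auto simp: collar_flow_def simplex_bd_def standard_simplex_iff)

lemma collar_flow_1:
  assumes x: "x \<in> collar p"
  shows "collar_flow p (1, x) \<in> simplex_bd p"
proof -
  obtain i where i: "i \<le> p" "min_coord p x = x i"
    using min_coord_attained by blast
  then have "collar_flow p (1, x) i = 0"
    by (simp add: collar_flow_def)
  then show ?thesis
    using collar_flow_in_collar[OF x, of 1] i by (auto simp: simplex_bd_def collar_def)
qed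

lemma simplex_bd_subset_collar: "simplex_bd p \<subseteq> collar p"
  using min_coord_simplex(3) by (fastforce simp: collar_def simplex_bd_def)

lemma openin_collar: "openin (simplex_top p) (collar p)"
proof -
  have "openin (simplex_top p) {x \<in> topspace (simplex_top p). min_coord p x \<in> {..<1 / (2 * (real p + 1))}}"
    by (rule openin_continuous_map_preimage[where Y = euclideanreal])
      (simp_all add: simplex_top_def continuous_map_from_subtopology continuous_map_min_coord)
  then show ?thesis
    by (simp add: collar_def)
qed

lemma continuous_map_collar_flow:
  "continuous_map (prod_topology (top_of_set {0..1}) (subtopology (simplex_top p) (collar p)))
     (subtopology (simplex_top p) (collar p)) (collar_flow p)"
proof -
  let ?P = "prod_topology (top_of_set {0..1::real}) (subtopology (simplex_top p) (collar p))"
  have fst: "continuous_map ?P euclideanreal fst"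
    using continuous_map_into_fulltopology[OF continuous_map_fst] by blast
  have snd: "continuous_map ?P (powertop_real UNIV) snd"
    using continuous_map_into_fulltopology[OF continuous_map_into_fulltopology[OF continuous_map_snd]]
    unfolding simplex_top_def by blast
  have m: "continuous_map ?P euclideanreal (\<lambda>x. min_coord p (snd x))"
    using continuous_map_compose[OF snd continuous_map_min_coord] by (simp add: o_def)
  have c: "continuous_map ?P euclideanreal (\<lambda>x. snd x i)" for i
    using continuous_map_compose[OF snd continuous_map_product_projection[of i UNIV]] by (simp add: o_def)
  have "continuous_map ?P (powertop_real UNIV) (collar_flow p)"
    unfolding continuous_map_componentwise_UNIV
  proof
    fix i
    show "continuous_map ?P euclideanreal (\<lambda>x. collar_flow p x i)"
    proof (cases "i \<le> p")
      case True
      have "1 - (real p + 1) * fst x * min_coord p (snd x) \<noteq> 0" if "x \<in> topspace ?P" for x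
        using that collar_denominator[of "snd x" p "fst x"] by auto
      then have "continuous_map ?P euclideanreal
          (\<lambda>x. (snd x i - fst x * min_coord p (snd x)) / (1 - (real p + 1) * fst x * min_coord p (snd x)))"
        by (intro continuous_intros fst m c) auto
      then show ?thesis
        using True by (simp add: collar_flow_def case_prod_unfold)
    qed (simp add: collar_flow_def case_prod_unfold)
  qed
  moreover have "collar_flow p x \<in> collar p" if "x \<in> topspace ?P" for x
    using that collar_flow_in_collar[of "snd x" p "fst x"] by (cases x) auto
  ultimately show ?thesis
    unfolding simplex_top_def subtopology_subtopology continuous_map_in_subtopology
    by (auto simp: collar_def)
qed

definition simplex_id :: "nat \<Rightarrow> (nat \<Rightarrow> real) \<Rightarrow> nat \<Rightarrow> real" where
  "simplex_id p = restrict (\<lambda>x. x) (standard_simplex p)"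

lemma singular_simplex_id: "singular_simplex p (simplex_top p) (simplex_id p)"
  by (simp add: singular_simplex_def simplex_id_def flip: simplex_top_def)

lemma continuous_map_simplex_coordinate: "continuous_map (simplex_top p) euclideanreal (\<lambda>x. x i)"
  unfolding simplex_top_def
  by (rule continuous_map_from_subtopology)
    (use continuous_map_product_projection[of i UNIV "\<lambda>_. euclideanreal"] in simp)

lemma simplex_map_simplex_id: "simplex_map p f (simplex_id p) = restrict f (standard_simplex p)"
  by (auto simp: simplex_map_def simplex_id_def)

lemma simplical_face_in_bd:
  assumes "x \<in> standard_simplex p" "k \<le> Suc p"
  shows "simplical_face k x \<in> simplex_bd (Suc p)"
  using simplical_face_in_standard_simplex[of "Suc p" k x] assms
  by (auto simp: simplex_bd_def simplical_face_def)

lemma relcycle_simplex_id: "singular_relcycle p (simplex_top p) (simplex_bd p) (frag_of (simplex_id p))"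
proof (cases p)
  case 0
  then show ?thesis
    using singular_simplex_id[of p] by (simp add: singular_relcycle singular_chain_of chain_boundary_def)
next
  case (Suc n)
  have "singular_chain n (subtopology (simplex_top p) (simplex_bd p)) (frag_of (singular_face p k (simplex_id p)))"
    if "k \<le> p" for k
    unfolding singular_chain_of singular_simplex_subtopology
  proof
    show "singular_simplex n (simplex_top p) (singular_face p k (simplex_id p))"
      using singular_simplex_singular_face[OF singular_simplex_id[of p] _ that] Suc by simp
    show "singular_face p k (simplex_id p) ` standard_simplex n \<subseteq> simplex_bd p"
      using simplical_face_in_bd[of _ n k] simplical_face_in_standard_simplex[of p k] that Suc
      by (auto simp: singular_face_def simplex_id_def)
  qed
  then have "singular_chain n (subtopology (simplex_top p) (simplex_bd p))
      (\<Sum>k\<le>p. frag_cmul ((-1) ^ k) (frag_of (singular_face p k (simplex_id p))))"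
    by (intro singular_chain_sum singular_chain_cmul) auto
  then show ?thesis
    using singular_simplex_id[of p] Suc
    by (simp add: singular_relcycle singular_chain_of chain_boundary_of del: sum.atMost_Suc)
qed

text \<open>
  The homology of the pair of a simplex and its boundary. The horn opposite to the face \<open>0\<close> is
  star-shaped about the vertex \<open>0\<close>, so the simplex is acyclic relative to it, and the face \<open>0\<close> is
  attached to the horn along its own boundary; this reduces the dimension by one.
\<close>

lemma homology_simplex:
  "rel_basis p (simplex_top p) (simplex_bd p) {j} (\<lambda>_. frag_of (simplex_id p)) \<and>
   (\<forall>q. q \<noteq> p \<longrightarrow> rel_acyclic q (simplex_top p) (simplex_bd p))"
proof (induction p)
  case 0
  define a :: "nat \<Rightarrow> real" where "a = (\<lambda>j. if j = 0 then 1 else 0)"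
  have top: "topspace (simplex_top 0) = {a}"
    by (simp add: standard_simplex_0 a_def)
  have bd: "simplex_bd 0 = {}"
    by (auto simp: simplex_bd_def standard_simplex_0)
  have id: "simplex_id 0 = restrict (\<lambda>x. a) (standard_simplex 0)"
    by (auto simp: simplex_id_def standard_simplex_0 a_def)
  have "rel_acyclic q (simplex_top 0) {}" if "q \<noteq> 0" for q
    unfolding rel_acyclic_iff_trivial using homology_dimension_axiom[OF top, of "int q"] that by simp
  moreover have "rel_basis 0 (simplex_top 0) {} {j} (\<lambda>_. frag_of (simplex_id 0))"
    unfolding rel_basis_def
  proof (intro conjI allI impI ballI)
    show "singular_relcycle 0 (simplex_top 0) {} (frag_of (simplex_id 0))"
      using relcycle_simplex_id[of 0] by (simp add: bd)
    fix c assume "singular_relcycle 0 (simplex_top 0) {} c"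
    then obtain b where "c = frag_cmul b (frag_of (simplex_id 0))"
      using singular_chain_singleton[OF top, of 0 c] by (auto simp: singular_relcycle id)
    then show "\<exists>a. homologous_rel 0 (simplex_top 0) {} c (chain_comb {j} a (\<lambda>_. frag_of (simplex_id 0)))"
      by (intro exI[of _ "\<lambda>_. b"]) (simp add: chain_comb_def)
  next
    fix a' j' assume "singular_relboundary 0 (simplex_top 0) {} (chain_comb {j} a' (\<lambda>_. frag_of (simplex_id 0)))" "j' \<in> {j}"
    then show "a' j' = 0"
      using singular_boundary_singleton[OF top, of 0] by (auto simp: chain_comb_def frag_of_nonzero)
  qed simp
  ultimately show ?case
    by (simp add: bd)
next
  case (Suc p)
  let ?X = "simplex_top (Suc p)" and ?A = "simplex_bd (Suc p)" and ?f = "simplical_face 0 :: (nat \<Rightarrow> real) \<Rightarrow> nat \<Rightarrow> real"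
  \<comment> \<open>the horn: the union of all faces except the face \<open>0\<close>\<close>
  define C where "C = {x \<in> standard_simplex (Suc p). \<exists>i. 1 \<le> i \<and> i \<le> Suc p \<and> x i = 0}"
  let ?Y = "subtopology ?X ?A"
  have CA: "C \<subseteq> ?A"
    by (auto simp: C_def simplex_bd_def)
  have topA: "topspace ?Y = ?A"
    by (auto simp: simplex_bd_def)
  note proj = continuous_map_simplex_coordinate[of "Suc p"]
  have "closedin ?X {x \<in> topspace ?X. x i \<in> {0}}" for i
    by (rule closedin_continuous_map_preimage[OF proj]) simp
  then have "closedin ?X (\<Union>i\<in>{1..Suc p}. {x \<in> topspace ?X. x i \<in> {0}})"
    by (intro closedin_Union) auto
  also have "(\<Union>i\<in>{1..Suc p}. {x \<in> topspace ?X. x i \<in> {0}}) = C"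
    by (auto simp: C_def)
  finally have clC: "closedin ?Y C"
    using CA by (metis closedin_subset_topspace)
  have fsimp: "?f x (Suc i) = x i" "?f x 0 = 0" for x i
    by (simp_all add: simplical_face_def)
  have f_in: "?f x \<in> ?A" if "x \<in> standard_simplex p" for x
    by (rule simplical_face_in_bd[OF that]) simp
  have fC: "?f x \<in> C \<longleftrightarrow> x \<in> simplex_bd p" if x: "x \<in> standard_simplex p" for x
  proof -
    have "?f x \<in> C \<longleftrightarrow> (\<exists>i. 1 \<le> i \<and> i \<le> Suc p \<and> ?f x i = 0)"
      using f_in[OF x] by (auto simp: C_def simplex_bd_def)
    also have "\<dots> \<longleftrightarrow> (\<exists>i\<le>p. x i = 0)"
      by (metis Suc_le_mono Suc_pred fsimp(1) le_add1 less_eq_Suc_le plus_1_eq_Suc One_nat_def)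
    finally show ?thesis
      using x by (simp add: simplex_bd_def)
  qed
  have inj: "inj ?f"
    by (rule injI) (metis fsimp(1) ext)
  have cont: "continuous_map (simplex_top p) ?Y ?f"
  proof -
    have "continuous_map (simplex_top p) (powertop_real UNIV) ?f"
      unfolding continuous_map_componentwise_UNIV
    proof
      fix i show "continuous_map (simplex_top p) euclideanreal (\<lambda>x. ?f x i)"
        by (cases i) (simp_all add: fsimp continuous_map_simplex_coordinate)
    qed
    then show ?thesis
      using f_in unfolding simplex_top_def subtopology_subtopology continuous_map_in_subtopology
      by (auto simp: simplex_bd_def)
  qed
  have cover: "topspace ?Y = C \<union> ?f ` topspace (simplex_top p)"
  proof
    show "C \<union> ?f ` topspace (simplex_top p) \<subseteq> topspace ?Y"
      using CA f_in topA by auto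
    show "topspace ?Y \<subseteq> C \<union> ?f ` topspace (simplex_top p)"
    proof
      fix x assume "x \<in> topspace ?Y"
      then have x: "x \<in> standard_simplex (Suc p)" and "\<exists>i\<le>Suc p. x i = 0"
        by (auto simp: topA simplex_bd_def)
      show "x \<in> C \<union> ?f ` topspace (simplex_top p)"
      proof (cases "x \<in> C")
        case False
        obtain i where i: "i \<le> Suc p" "x i = 0"
          using \<open>\<exists>i\<le>Suc p. x i = 0\<close> by blast
        then have "\<not> 1 \<le> i"
          using False x unfolding C_def by blast
        then have x0: "x 0 = 0"
          using i by (cases i) auto
        let ?y = "\<lambda>i. x (Suc i)"
        have "?y \<in> standard_simplex p"
          using x x0 sum.atMost_Suc_shift[of x p] by (simp add: standard_simplex_iff del: sum.atMost_Suc)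
        moreover have "x = ?f ?y"
        proof
          fix i show "x i = ?f ?y i"
            by (cases i) (simp_all add: fsimp x0)
        qed
        ultimately show ?thesis
          by auto
      qed auto
    qed
  qed
  have iso: "hom_induced (int q) (simplex_top p) (simplex_bd p) ?Y C ?f
      \<in> iso (relative_homology_group (int q) (simplex_top p) (simplex_bd p)) (relative_homology_group (int q) ?Y C)" for q
  proof (rule relative_homeomorphism_iso[where W = "collar p" and h = "collar_flow p"])
    show "simplex_bd p = {x \<in> topspace (simplex_top p). ?f x \<in> C}"
      using fC by (auto simp: simplex_bd_def)
    show "collar_flow p (0, w) = w" if "w \<in> collar p" for w
      using that by (auto simp: collar_def collar_flow_0)
  qed (use clC cover cont inj in \<open>auto simp: compact_space_simplex_top Hausdorff_space_simplex_top
      Hausdorff_space_subtopology openin_collar simplex_bd_subset_collar continuous_map_collar_flow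
      collar_flow_bd collar_flow_1 intro: inj_on_subset\<close>)
  have fbd: "?f \<in> simplex_bd p \<rightarrow> C"
    using fC by (auto simp: simplex_bd_def)
  have IH: "rel_basis p (simplex_top p) (simplex_bd p) {j} (\<lambda>_. frag_of (simplex_id p))"
    "\<And>q. q \<noteq> p \<Longrightarrow> rel_acyclic q (simplex_top p) (simplex_bd p)"
    using Suc.IH by auto
  have basis: "rel_basis p ?Y C {j} (\<lambda>_. frag_of (restrict ?f (standard_simplex p)))"
    using rel_basis_push[OF cont fbd iso IH(1)] by (simp add: simplex_map_simplex_id)
  have acycYC: "rel_acyclic q ?Y C" if "q \<noteq> p" for q
    using rel_acyclic_iso[OF iso] IH(2)[OF that] by blast
  have acycXC: "rel_acyclic q ?X C" for q
  proof -
    let ?e = "\<lambda>j. if j = 0 then 1 else 0 :: real"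
    \<comment> \<open>the straight line to the vertex \<open>0\<close> preserves every face other than the face \<open>0\<close>\<close>
    let ?h = "\<lambda>(t::real, x) i. (1 - t) * x i + t * ?e i"
    let ?P = "prod_topology (top_of_set {0..1::real}) ?X"
    have fst: "continuous_map ?P euclideanreal fst"
      using continuous_map_into_fulltopology[OF continuous_map_fst] by blast
    have c: "continuous_map ?P euclideanreal (\<lambda>x. snd x i)" for i
      using continuous_map_compose[OF continuous_map_snd proj] by (simp add: o_def)
    have h_in: "?h (t, x) \<in> standard_simplex (Suc p)" if "0 \<le> t" "t \<le> 1" "x \<in> standard_simplex (Suc p)" for t x
      using convex_standard_simplex[OF that(3) _ that(1,2), of ?e] by simp
    have "continuous_map ?P (powertop_real UNIV) ?h"
      unfolding continuous_map_componentwise_UNIV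
    proof
      fix i
      have "continuous_map ?P euclideanreal (\<lambda>x. (1 - fst x) * snd x i + fst x * ?e i)"
        by (intro continuous_intros fst c) simp_all
      then show "continuous_map ?P euclideanreal (\<lambda>x. ?h x i)"
        by (simp add: case_prod_unfold)
    qed
    then have "continuous_map ?P ?X ?h"
      using h_in unfolding simplex_top_def continuous_map_in_subtopology by auto
    then show ?thesis
    proof (rule rel_acyclic_deformation)
      show "C \<subseteq> topspace ?X"
        by (auto simp: C_def)
      fix t x assume t: "0 \<le> (t::real)" "t \<le> 1" and "x \<in> C"
      then obtain i where i: "x \<in> standard_simplex (Suc p)" "1 \<le> i" "i \<le> Suc p" "x i = 0"
        by (auto simp: C_def)
      then have "?h (t, x) i = 0"
        by simp
      then show "?h (t, x) \<in> C"
        unfolding C_def using h_in[OF t i(1)] i by blast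
    next
      fix x assume x: "x \<in> topspace ?X"
      have "?h (1, x) 1 = 0"
        by simp
      then show "?h (1, x) \<in> C"
        unfolding C_def using h_in[of 1 x] x by force
    qed auto
  qed
  \<comment> \<open>all faces but the face \<open>0\<close> of the identity simplex lie in the horn\<close>
  have bound: "homologous_rel p ?Y C (chain_boundary (Suc p) (frag_of (simplex_id (Suc p)))) (frag_of (restrict ?f (standard_simplex p)))"
  proof -
    have face0: "singular_face (Suc p) 0 (simplex_id (Suc p)) = restrict ?f (standard_simplex p)"
      using simplical_face_in_standard_simplex[of "Suc p" 0]
      by (auto simp: singular_face_def simplex_id_def fun_eq_iff restrict_def)
    have "singular_chain p (subtopology ?X C) (frag_of (singular_face (Suc p) k (simplex_id (Suc p))))"
      if k: "1 \<le> k" "k \<le> Suc p" for k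
      unfolding singular_chain_of singular_simplex_subtopology
    proof
      show "singular_simplex p ?X (singular_face (Suc p) k (simplex_id (Suc p)))"
        using singular_simplex_singular_face[OF singular_simplex_id[of "Suc p"] _ k(2)] by simp
      show "singular_face (Suc p) k (simplex_id (Suc p)) ` standard_simplex p \<subseteq> C"
      proof clarify
        fix x :: "nat \<Rightarrow> real" assume "x \<in> standard_simplex p"
        then have "simplical_face k x \<in> standard_simplex (Suc p)" "simplical_face k x k = 0"
          using simplical_face_in_standard_simplex[of "Suc p" k x] k by (auto simp: simplical_face_def)
        then show "singular_face (Suc p) k (simplex_id (Suc p)) x \<in> C"
          using k \<open>x \<in> standard_simplex p\<close> by (auto simp: C_def singular_face_def simplex_id_def)
      qed
    qed
    then have "singular_chain p (subtopology ?X C)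
        (\<Sum>k=1..Suc p. frag_cmul ((-1) ^ k) (frag_of (singular_face (Suc p) k (simplex_id (Suc p)))))"
      by (intro singular_chain_sum singular_chain_cmul) auto
    also have "(\<Sum>k=1..Suc p. frag_cmul ((-1) ^ k) (frag_of (singular_face (Suc p) k (simplex_id (Suc p)))))
      = chain_boundary (Suc p) (frag_of (simplex_id (Suc p))) - frag_of (restrict ?f (standard_simplex p))"
      using sum.atLeast_Suc_atMost[of 0 "Suc p" "\<lambda>k. frag_cmul ((-1) ^ k) (frag_of (singular_face (Suc p) k (simplex_id (Suc p))))"]
      by (simp add: chain_boundary_of face0 atMost_atLeast0 del: sum.atMost_Suc sum.cl_ivl_Suc)
    finally show ?thesis
      unfolding homologous_rel_def by (intro singular_chain_imp_relboundary) (simp add: sub_chain[OF CA])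
  qed
  have "rel_basis (Suc p) ?X ?A {j} (\<lambda>_. frag_of (simplex_id (Suc p)))"
    by (rule rel_basis_connecting[OF CA acycXC basis]) (use relcycle_simplex_id bound in auto)
  moreover have "rel_acyclic q ?X ?A" if "q \<noteq> Suc p" for q
  proof (rule rel_acyclic_triple_quotient[OF CA _ acycXC])
    show "q = 0 \<or> rel_acyclic (q - Suc 0) ?Y C"
      using acycYC[of "q - Suc 0"] that by (cases q) auto
  qed
  ultimately show ?case
    by blast
qed

subsection \<open>Attaching cells\<close>

text \<open>
  By the collar of the simplex, the map \<open>\<Phi>\<close> is a relative homeomorphism as above, so \<open>(Y, B)\<close> has the
  homology of \<open>S \<times> (simplex, boundary)\<close>. The contractible factor \<open>S\<close> does not affect the homology; it
  allows a cell such as an edge times a tree to be attached at once.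
\<close>

lemma homology_attach_cell:
  fixes \<Phi> :: "'s \<times> (nat \<Rightarrow> real) \<Rightarrow> 'a"
  assumes Y: "Hausdorff_space Y" and B: "closedin Y B"
    and S: "compact_space S" "contractible_space S" "s \<in> topspace S"
    and \<Phi>: "continuous_map (prod_topology S (simplex_top p)) Y \<Phi>"
    and cover: "topspace Y = B \<union> \<Phi> ` (topspace S \<times> standard_simplex p)"
    and bd: "\<And>x u. \<lbrakk>x \<in> topspace S; u \<in> standard_simplex p\<rbrakk> \<Longrightarrow> \<Phi> (x, u) \<in> B \<longleftrightarrow> u \<in> simplex_bd p"
    and inj: "inj_on \<Phi> (topspace S \<times> (standard_simplex p - simplex_bd p))"
  shows "rel_basis p Y B {j} (\<lambda>_. frag_of (restrict (\<lambda>u. \<Phi> (s, u)) (standard_simplex p)))"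
    and "q \<noteq> p \<Longrightarrow> rel_acyclic q Y B"
proof -
  let ?D = "prod_topology S (simplex_top p)" and ?A = "topspace S \<times> simplex_bd p"
  let ?I = "top_of_set {0..1::real}"
  let ?h = "\<lambda>(t, (x, u)). (x, collar_flow p (t, u))"
  let ?W = "topspace S \<times> collar p"
  have bdsub: "simplex_bd p \<subseteq> standard_simplex p" and csub: "collar p \<subseteq> standard_simplex p"
    by (auto simp: simplex_bd_def collar_def)
  have DW: "subtopology ?D ?W = prod_topology S (subtopology (simplex_top p) (collar p))"
    by (simp add: prod_topology_subtopology(2))
  have contW: "continuous_map (prod_topology ?I (subtopology ?D ?W)) (subtopology ?D ?W) ?h"
  proof -
    let ?P = "prod_topology ?I (prod_topology S (subtopology (simplex_top p) (collar p)))"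
    have 1: "continuous_map ?P S (\<lambda>z. fst (snd z))"
      using continuous_map_compose[OF continuous_map_snd continuous_map_fst] by (simp add: o_def)
    have "continuous_map ?P (prod_topology ?I (subtopology (simplex_top p) (collar p))) (\<lambda>z. (fst z, snd (snd z)))"
      using continuous_map_compose[OF continuous_map_snd continuous_map_snd, of ?I]
      by (intro continuous_map_pairedI continuous_map_fst) (simp add: o_def)
    from continuous_map_compose[OF this continuous_map_collar_flow]
    have 2: "continuous_map ?P (subtopology (simplex_top p) (collar p)) (\<lambda>z. collar_flow p (fst z, snd (snd z)))"
      by (simp add: o_def)
    show ?thesis
      unfolding DW using continuous_map_pairedI[OF 1 2] by (simp add: case_prod_unfold)
  qed
  have iso: "hom_induced (int q) ?D ?A Y B \<Phi> \<in> iso (relative_homology_group (int q) ?D ?A) (relative_homology_group (int q) Y B)" for q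
  proof (rule relative_homeomorphism_iso[OF _ Y \<Phi> B _ _ _ _ _ contW])
    show "compact_space ?D"
      by (simp add: compact_space_prod_topology S compact_space_simplex_top)
    show "topspace Y = B \<union> \<Phi> ` topspace ?D"
      using cover by simp
    show "?A = {x \<in> topspace ?D. \<Phi> x \<in> B}"
      using bd bdsub by auto
    show "inj_on \<Phi> (topspace ?D - ?A)"
      by (rule inj_on_subset[OF inj]) auto
    show "openin ?D ?W"
      by (simp add: openin_prod_Times_iff openin_collar)
    show "?A \<subseteq> ?W"
      using simplex_bd_subset_collar by auto
  qed (use csub in \<open>auto simp: collar_flow_0 collar_flow_bd collar_flow_1\<close>)
  let ?\<sigma> = "\<lambda>u. (s, u)"
  have \<sigma>: "continuous_map (simplex_top p) ?D ?\<sigma>"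
    using S(3) by (auto simp: continuous_map_pairwise o_def)
  have \<sigma>bd: "?\<sigma> \<in> simplex_bd p \<rightarrow> ?A"
    using S(3) by auto
  \<comment> \<open>the inclusion of the fibre over \<open>s\<close> is a homotopy equivalence of pairs, as \<open>S\<close> contracts to \<open>s\<close>\<close>
  have sec: "hom_induced (int q) (simplex_top p) (simplex_bd p) ?D ?A ?\<sigma>
      \<in> iso (relative_homology_group (int q) (simplex_top p) (simplex_bd p)) (relative_homology_group (int q) ?D ?A)" for q
  proof (rule homotopy_equivalence_relative_homology_group_isomorphism[OF \<sigma> \<sigma>bd, where g = snd])
    show "continuous_map ?D (simplex_top p) snd"
      by (rule continuous_map_snd)
    show "homotopic_with (\<lambda>h. h \<in> simplex_bd p \<rightarrow> simplex_bd p) (simplex_top p) (simplex_top p) (snd \<circ> ?\<sigma>) id"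
      by (rule homotopic_with_equal) (auto simp: continuous_map_eq[OF continuous_map_id])
    have "homotopic_with (\<lambda>x. True) S S (\<lambda>x. s) id"
      using S by (metis contractible_space_alt homotopic_with_sym)
    then obtain k where k: "continuous_map (prod_topology ?I S) S k" "\<And>x. k (0, x) = s" "\<And>x. k (1, x) = x"
      unfolding homotopic_with_def by auto
    have kS: "k (t, x) \<in> topspace S" if "0 \<le> t" "t \<le> 1" "x \<in> topspace S" for t x
      using k(1) that by (auto simp: continuous_map_def Pi_iff)
    have "continuous_map (prod_topology ?I ?D) ?D (\<lambda>(t, (x, u)). (k (t, x), u))"
    proof -
      have "continuous_map (prod_topology ?I ?D) (prod_topology ?I S) (\<lambda>z. (fst z, fst (snd z)))"
        using continuous_map_compose[OF continuous_map_snd continuous_map_fst, of ?I]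
        by (intro continuous_map_pairedI continuous_map_fst) (simp add: o_def)
      from continuous_map_compose[OF this k(1)]
      have 1: "continuous_map (prod_topology ?I ?D) S (\<lambda>z. k (fst z, fst (snd z)))"
        by (simp add: o_def)
      have 2: "continuous_map (prod_topology ?I ?D) (simplex_top p) (\<lambda>z. snd (snd z))"
        using continuous_map_compose[OF continuous_map_snd continuous_map_snd] by (simp add: o_def)
      show ?thesis
        using continuous_map_pairedI[OF 1 2] by (simp add: case_prod_unfold)
    qed
    then show "homotopic_with (\<lambda>k. k \<in> ?A \<rightarrow> ?A) ?D ?D (?\<sigma> \<circ> snd) id"
      unfolding homotopic_with_def using k kS
      by (intro exI[of _ "\<lambda>(t, (x, u)). (k (t, x), u)"]) auto
  qed auto
  have acyc: "rel_acyclic q (simplex_top p) (simplex_bd p)" if "q \<noteq> p" for q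
    using homology_simplex[of p j] that by blast
  show "rel_acyclic q Y B" if "q \<noteq> p"
    using acyc[OF that] rel_acyclic_iso[OF sec] rel_acyclic_iso[OF iso] by blast
  have AB: "\<Phi> \<in> ?A \<rightarrow> B"
    using bd bdsub by auto
  have "rel_basis p ?D ?A {j} (\<lambda>_. chain_map p ?\<sigma> (frag_of (simplex_id p)))"
    using homology_simplex[of p j] by (intro rel_basis_push[OF \<sigma> \<sigma>bd sec]) auto
  from rel_basis_push[OF \<Phi> AB iso this]
  have "rel_basis p Y B {j} (\<lambda>_. frag_of (simplex_map p \<Phi> (simplex_map p ?\<sigma> (simplex_id p))))"
    by simp
  also have "simplex_map p \<Phi> (simplex_map p ?\<sigma> (simplex_id p)) = restrict (\<lambda>u. \<Phi> (s, u)) (standard_simplex p)"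
    by (auto simp: simplex_map_def simplex_id_def)
  finally show "rel_basis p Y B {j} (\<lambda>_. frag_of (restrict (\<lambda>u. \<Phi> (s, u)) (standard_simplex p)))" .
qed

lemma rel_basis_empty: "rel_acyclic p X S \<Longrightarrow> rel_basis p X S {} z"
  by (simp add: rel_basis_def rel_acyclic_def homologous_rel_def chain_comb_def)

text \<open>
  The cells are attached one at a time. Cells with disjoint interiors do not interfere, since each of
  them is attached along the boundary of its simplex to \<open>B\<close> itself.
\<close>

lemma homology_attach_cells:
  fixes \<Phi> :: "'j \<Rightarrow> 's \<times> (nat \<Rightarrow> real) \<Rightarrow> 'a"
  assumes "finite J" "Hausdorff_space Y" "closedin Y B"
    and "\<And>j. j \<in> J \<Longrightarrow> compact_space (S j)" "\<And>j. j \<in> J \<Longrightarrow> contractible_space (S j)"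
    and "\<And>j. j \<in> J \<Longrightarrow> s j \<in> topspace (S j)"
    and "\<And>j. j \<in> J \<Longrightarrow> continuous_map (prod_topology (S j) (simplex_top p)) Y (\<Phi> j)"
    and "topspace Y = B \<union> (\<Union>j\<in>J. \<Phi> j ` (topspace (S j) \<times> standard_simplex p))"
    and "\<And>j x u. \<lbrakk>j \<in> J; x \<in> topspace (S j); u \<in> standard_simplex p\<rbrakk> \<Longrightarrow> \<Phi> j (x, u) \<in> B \<longleftrightarrow> u \<in> simplex_bd p"
    and "\<And>j. j \<in> J \<Longrightarrow> inj_on (\<Phi> j) (topspace (S j) \<times> (standard_simplex p - simplex_bd p))"
    and "\<And>i j x u y v. \<lbrakk>i \<in> J; j \<in> J; x \<in> topspace (S i); y \<in> topspace (S j);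
           u \<in> standard_simplex p - simplex_bd p; v \<in> standard_simplex p - simplex_bd p;
           \<Phi> i (x, u) = \<Phi> j (y, v)\<rbrakk> \<Longrightarrow> i = j"
  shows "rel_basis p Y B J (\<lambda>j. frag_of (restrict (\<lambda>u. \<Phi> j (s j, u)) (standard_simplex p))) \<and>
    (\<forall>q. q \<noteq> p \<longrightarrow> rel_acyclic q Y B)"
  using assms
proof (induction J arbitrary: Y rule: finite_induct)
  case empty
  then have "topspace Y = B"
    by simp
  then have acyc: "rel_acyclic q Y B" for q
    using rel_acyclic_topspace[of q Y] by simp
  then show ?case
    using rel_basis_empty by blast
next
  case (insert k J)
  note Y = insert.prems(1) and B = insert.prems(2) and cont = insert.prems(6) and cover = insert.prems(7)
    and bd = insert.prems(8) and inj = insert.prems(9) and disj = insert.prems(10)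
  let ?z = "\<lambda>j. frag_of (restrict (\<lambda>u. \<Phi> j (s j, u)) (standard_simplex p))"
  let ?im = "\<lambda>j. \<Phi> j ` (topspace (S j) \<times> standard_simplex p)"
  define A where "A = B \<union> (\<Union>j\<in>J. ?im j)"
  have BA: "B \<subseteq> A"
    by (auto simp: A_def)
  have "closedin Y (?im j)" if "j \<in> J" for j
  proof -
    have "compactin (prod_topology (S j) (simplex_top p)) (topspace (S j) \<times> standard_simplex p)"
      using insert.prems(3)[of j] that compact_space_simplex_top[of p]
      by (simp add: compactin_Times compact_space_def)
    then show ?thesis
      using that by (intro compactin_imp_closedin[OF Y] image_compactin[OF _ cont]) auto
  qed
  then have Acl: "closedin Y A"
    unfolding A_def using insert.hyps B by (intro closedin_Un closedin_Union) auto
  have topA: "topspace (subtopology Y A) = A"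
    using closedin_subset[OF Acl] by auto
  have 1: "rel_basis p (subtopology Y A) B J ?z \<and> (\<forall>q. q \<noteq> p \<longrightarrow> rel_acyclic q (subtopology Y A) B)"
  proof (rule insert.IH)
    show "Hausdorff_space (subtopology Y A)"
      by (rule Hausdorff_space_subtopology[OF Y])
    show "closedin (subtopology Y A) B"
      using B BA by (metis closedin_subset_topspace)
    show "topspace (subtopology Y A) = B \<union> (\<Union>j\<in>J. ?im j)"
      unfolding topA by (rule A_def)
    show "continuous_map (prod_topology (S j) (simplex_top p)) (subtopology Y A) (\<Phi> j)" if "j \<in> J" for j
      using cont[of j] that by (auto simp: continuous_map_in_subtopology A_def)
  next
    fix i j x u y v
    assume "i \<in> J" "j \<in> J" "x \<in> topspace (S i)" "y \<in> topspace (S j)"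
      "u \<in> standard_simplex p - simplex_bd p" "v \<in> standard_simplex p - simplex_bd p" "\<Phi> i (x, u) = \<Phi> j (y, v)"
    then show "i = j"
      by (intro disj[of i j x y u v]) auto
  qed (use insert.prems in auto)
  have k_bd: "\<Phi> k (x, u) \<in> A \<longleftrightarrow> u \<in> simplex_bd p" if xu: "x \<in> topspace (S k)" "u \<in> standard_simplex p" for x u
  proof
    assume a: "\<Phi> k (x, u) \<in> A"
    show "u \<in> simplex_bd p"
    proof (rule ccontr)
      assume u: "u \<notin> simplex_bd p"
      then have nB: "\<Phi> k (x, u) \<notin> B"
        using bd[of k x u] xu by auto
      then obtain j y v where j: "j \<in> J" "y \<in> topspace (S j)" "v \<in> standard_simplex p" "\<Phi> k (x, u) = \<Phi> j (y, v)"
        using a by (auto simp: A_def)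
      then have "v \<notin> simplex_bd p"
        using bd[of j y v] nB by auto
      then have "k = j"
        using j xu u by (intro disj[of k j x y u v]) auto
      then show False
        using j insert.hyps by simp
    qed
  next
    assume "u \<in> simplex_bd p"
    then show "\<Phi> k (x, u) \<in> A"
      using bd[of k x u] xu BA by auto
  qed
  have cov: "topspace Y = A \<union> ?im k"
    using cover by (auto simp: A_def)
  note cell = homology_attach_cell[OF Y Acl _ _ _ cont[of k] cov k_bd inj[of k], of "s k"]
  have 2: "rel_basis p Y A {k} ?z"
  proof -
    have "rel_basis p Y A {k} (\<lambda>_. ?z k)"
      using insert.prems by (intro cell(1)) auto
    then show ?thesis
      by (rule rel_basis_cong) auto
  qed
  have 3: "rel_acyclic q Y A" if "q \<noteq> p" for q
    using insert.prems that by (intro cell(2)[of q]) auto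
  have zk: "singular_relcycle p Y B (?z k)"
  proof -
    let ?g = "\<lambda>u. \<Phi> k (s k, u)"
    have "continuous_map (simplex_top p) (prod_topology (S k) (simplex_top p)) (\<lambda>u. (s k, u))"
      using insert.prems(5)[of k] by (auto simp: continuous_map_pairwise o_def)
    from continuous_map_compose[OF this cont[of k]]
    have g: "continuous_map (simplex_top p) Y ?g"
      by (simp add: o_def)
    have "?g \<in> simplex_bd p \<rightarrow> B"
      using bd[of k "s k"] insert.prems(5)[of k] by (auto simp: simplex_bd_def)
    from singular_relcycle_chain_map[OF relcycle_simplex_id g this]
    show ?thesis
      by (simp add: simplex_map_simplex_id)
  qed
  have eq: "insert k J = J \<union> {k}"
    by auto
  have basis: "rel_basis p Y B (insert k J) ?z"
    unfolding eq
  proof (rule rel_basis_Un[OF BA conjunct1[OF 1] 2])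
    show "J \<inter> {k} = {}"
      using insert.hyps by simp
    show "singular_relcycle p Y B (?z i)" if "i \<in> {k}" for i
      using zk that by simp
    show "rel_acyclic (Suc p) Y A"
      by (rule 3) simp
  qed
  have acyc: "rel_acyclic q Y B" if "q \<noteq> p" for q
    by (rule rel_acyclic_triple_trans[OF BA _ 3[OF that]]) (use conjunct2[OF 1] that in blast)
  show ?case
    by (intro conjI allI impI, rule basis, erule acyc)
qed

section \<open>Symmetric squares\<close>

text \<open>
  The elements of the symmetric square are equivalence classes, that is the sets \<open>{(x, y), (y, x)}\<close>.
\<close>

definition upair :: "'a \<times> 'a \<Rightarrow> ('a \<times> 'a) set" where
  "upair z = {z, prod.swap z}"

lemma upair_eq_iff: "upair z = upair w \<longleftrightarrow> z = w \<or> z = prod.swap w"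
  by (auto simp: upair_def doubleton_eq_iff)

lemma upair_swap [simp]: "upair (prod.swap z) = upair z"
  by (auto simp: upair_def)

lemma upair_commute: "upair (x, y) = upair (y, x)"
  by (auto simp: upair_def)

lemma sym2_rel_class:
  "z \<in> topspace X \<times> topspace X \<Longrightarrow> sym2_rel X `` {z} = upair z"
  by (auto simp: sym2_rel_def upair_def)

lemma quotient_map_upair: "quotient_map (prod_topology X X) (sym2 X) upair"
  unfolding sym2_def
  by (rule quotient_map_eq[OF quotient_map_quotient_topology]) (auto simp: sym2_rel_class)

lemma continuous_map_upair: "continuous_map (prod_topology X X) (sym2 X) upair"
  by (rule quotient_imp_continuous_map[OF quotient_map_upair])

lemma topspace_sym2: "topspace (sym2 X) = upair ` (topspace X \<times> topspace X)"
  using quotient_imp_surjective_map[OF quotient_map_upair, of X] by simp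

lemma sym2_diagonal_eq: "sym2_diagonal X = upair ` ((\<lambda>a. (a, a)) ` topspace X)"
  by (simp add: sym2_diagonal_def image_image sym2_rel_class)

lemma continuous_map_swap: "continuous_map (prod_topology X Y) (prod_topology Y X) prod.swap"
  by (simp add: continuous_map_pairwise o_def prod.swap_def continuous_map_fst continuous_map_snd)

lemma open_map_upair: "open_map (prod_topology X X) (sym2 X) upair"
  unfolding open_map_def
proof (intro allI impI)
  fix U assume U: "openin (prod_topology X X) U"
  \<comment> \<open>saturating an open set only adds its mirror image\<close>
  let ?U' = "{z \<in> topspace (prod_topology X X). prod.swap z \<in> U}"
  have sub: "upair ` U \<subseteq> topspace (sym2 X)"
    unfolding topspace_sym2 using openin_subset[OF U] by (intro image_mono) simp
  have upair_in: "upair z \<in> upair ` U \<longleftrightarrow> z \<in> U \<or> prod.swap z \<in> U" for z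
    unfolding image_iff upair_eq_iff by (metis swap_swap)
  have "openin (prod_topology X X) (U \<union> ?U')"
    by (intro openin_Un U openin_continuous_map_preimage[OF continuous_map_swap U])
  also have "U \<union> ?U' = {z \<in> topspace (prod_topology X X). upair z \<in> upair ` U}"
    using openin_subset[OF U] upair_in by auto
  finally show "openin (sym2 X) (upair ` U)"
    using quotient_map_upair[of X] sub unfolding quotient_map_def by simp
qed

lemma Hausdorff_space_sym2:
  assumes X: "Hausdorff_space X"
  shows "Hausdorff_space (sym2 X)"
  unfolding Hausdorff_space_def
proof (intro allI impI)
  let ?P = "prod_topology X X"
  have P: "Hausdorff_space ?P"
    using X by (simp add: Hausdorff_space_prod_topology)
  fix a b assume "a \<in> topspace (sym2 X) \<and> b \<in> topspace (sym2 X) \<and> a \<noteq> b"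
  then have ab: "a \<in> upair ` topspace ?P" "b \<in> upair ` topspace ?P" "a \<noteq> b"
    by (simp_all add: topspace_sym2)
  then obtain z w where z: "z \<in> topspace ?P" "a = upair z" and w: "w \<in> topspace ?P" "b = upair w"
    by blast
  have ne: "z \<noteq> w" "z \<noteq> prod.swap w"
    using ab(3) z(2) w(2) by auto
  have w': "prod.swap w \<in> topspace ?P"
    using w by auto
  obtain U1 V1 where 1: "openin ?P U1" "openin ?P V1" "z \<in> U1" "w \<in> V1" "disjnt U1 V1"
    using P z w ne unfolding Hausdorff_space_def by blast
  obtain U2 V2 where 2: "openin ?P U2" "openin ?P V2" "z \<in> U2" "prod.swap w \<in> V2" "disjnt U2 V2"
    using P z w' ne unfolding Hausdorff_space_def by blast
  let ?V2' = "{p \<in> topspace ?P. prod.swap p \<in> V2}"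
  have V2': "openin ?P ?V2'"
    by (rule openin_continuous_map_preimage[OF continuous_map_swap 2(2)])
  have "openin (sym2 X) (upair ` (U1 \<inter> U2))" "openin (sym2 X) (upair ` (V1 \<inter> ?V2'))"
    using open_map_upair[of X] 1 2 V2' unfolding open_map_def by (meson openin_Int)+
  moreover have "a \<in> upair ` (U1 \<inter> U2)" "b \<in> upair ` (V1 \<inter> ?V2')"
    using z w 1 2 by auto
  moreover have "disjnt (upair ` (U1 \<inter> U2)) (upair ` (V1 \<inter> ?V2'))"
    using 1(5) 2(5) by (auto simp: disjnt_iff upair_eq_iff)
  ultimately show "\<exists>U V. openin (sym2 X) U \<and> openin (sym2 X) V \<and> a \<in> U \<and> b \<in> V \<and> disjnt U V"
    by blast
qed

lemma quotient_map_upair_subspace: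
  assumes "P \<subseteq> topspace X \<times> topspace X" "\<And>z. z \<in> P \<Longrightarrow> prod.swap z \<in> P"
  shows "quotient_map (subtopology (prod_topology X X) P) (subtopology (sym2 X) (upair ` P)) upair"
proof (rule continuous_open_imp_quotient_map)
  have eq: "{z \<in> topspace (prod_topology X X). upair z \<in> upair ` P} = P"
    using assms by (auto simp: upair_eq_iff image_iff)
  show "open_map (subtopology (prod_topology X X) P) (subtopology (sym2 X) (upair ` P)) upair"
    by (rule open_map_restriction[OF open_map_upair eq])
  show "continuous_map (subtopology (prod_topology X X) P) (subtopology (sym2 X) (upair ` P)) upair"
    using continuous_map_upair[of X] by (auto simp: continuous_map_in_subtopology continuous_map_from_subtopology)
  show "upair ` topspace (subtopology (prod_topology X X) P) = topspace (subtopology (sym2 X) (upair ` P))"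
    using assms by (auto simp: topspace_sym2 Int_absorb1 image_mono)
qed

text \<open>
  Equivariant deformations of pairs of points descend to the symmetric square. Continuity descends
  because the product of a quotient map with the compact interval is a quotient map.
\<close>

lemma rel_acyclic_equivariant_deformation:
  assumes P: "P \<subseteq> topspace X \<times> topspace X" "\<And>z. z \<in> P \<Longrightarrow> prod.swap z \<in> P" and QP: "Q \<subseteq> P"
    and h: "continuous_map (prod_topology (top_of_set {0..1::real}) (subtopology (prod_topology X X) P)) (prod_topology X X) h"
    and hP: "\<And>t z. \<lbrakk>0 \<le> t; t \<le> 1; z \<in> P\<rbrakk> \<Longrightarrow> h (t, z) \<in> P"
    and eqv: "\<And>t z. \<lbrakk>0 \<le> t; t \<le> 1; z \<in> P\<rbrakk> \<Longrightarrow> h (t, prod.swap z) = prod.swap (h (t, z))"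
    and h0: "\<And>z. z \<in> P \<Longrightarrow> h (0, z) = z"
    and hQ: "\<And>t z. \<lbrakk>0 \<le> t; t \<le> 1; z \<in> Q\<rbrakk> \<Longrightarrow> h (t, z) \<in> Q"
    and h1: "\<And>z. z \<in> P \<Longrightarrow> h (1, z) \<in> Q"
  shows "rel_acyclic q (subtopology (sym2 X) (upair ` P)) (upair ` Q)"
proof -
  let ?I = "top_of_set {0..1::real}" and ?S = "subtopology (prod_topology X X) P"
  let ?Y = "subtopology (sym2 X) (upair ` P)"
  define k where "k = (\<lambda>(t, c). upair (h (t, SOME z. z \<in> P \<and> upair z = c)))"
  have k: "k (t, upair z) = upair (h (t, z))" if "0 \<le> t" "t \<le> 1" "z \<in> P" for t z
  proof -
    let ?z = "SOME z'. z' \<in> P \<and> upair z' = upair z"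
    have "?z \<in> P \<and> upair ?z = upair z"
      by (rule someI[where P = "\<lambda>z'. z' \<in> P \<and> upair z' = upair z"]) (use that in simp)
    then have "?z = z \<or> ?z = prod.swap z"
      by (simp add: upair_eq_iff)
    then show ?thesis
      using eqv[OF that] by (auto simp: k_def)
  qed
  have topY: "topspace ?Y = upair ` P"
    using P(1) by (auto simp: topspace_sym2 Int_absorb1 image_mono)
  have q: "quotient_map (prod_topology ?I ?S) (prod_topology ?I ?Y) (\<lambda>(t, z). (t, upair z))"
    by (rule quotient_map_prod_right[OF _ _ quotient_map_upair_subspace[OF P]])
      (auto intro!: compact_imp_locally_compact_space Hausdorff_space_subtopology simp: compact_space_subtopology)
  have "continuous_map (prod_topology ?I ?S) (sym2 X) (\<lambda>x. upair (h x))"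
    using continuous_map_compose[OF h continuous_map_upair] by (simp add: o_def)
  then have "continuous_map (prod_topology ?I ?S) (sym2 X) (k \<circ> (\<lambda>(t, z). (t, upair z)))"
    by (rule continuous_map_eq) (auto simp: k)
  then have "continuous_map (prod_topology ?I ?Y) (sym2 X) k"
    by (rule continuous_compose_quotient_map[OF q])
  moreover have "k x \<in> upair ` P" if "x \<in> topspace (prod_topology ?I ?Y)" for x
    using that hP unfolding topspace_prod_topology topY by (auto simp: k)
  ultimately have "continuous_map (prod_topology ?I ?Y) ?Y k"
    by (auto simp: continuous_map_in_subtopology)
  then show ?thesis
  proof (rule rel_acyclic_deformation)
    show "upair ` Q \<subseteq> topspace ?Y"
      using QP unfolding topY by auto
    show "k (t, c) \<in> upair ` Q" if "0 \<le> t" "t \<le> 1" "c \<in> upair ` Q" for t c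
      using that hQ QP by (auto simp: k)
  qed (unfold topY, use h0 h1 in \<open>auto simp: k\<close>)
qed

section \<open>Graphs as complexes\<close>

text \<open>
  A graph with vertex set \<open>V\<close> and edge set \<open>E\<close>, realised in barycentric coordinates: a point is a
  function on the vertices whose support lies in a vertex or an edge. In this form convex combinations
  of points of one face, and subgraphs on the same set of vertices, are easy to handle.
\<close>

definition complex_faces :: "'v set \<Rightarrow> 'v set set \<Rightarrow> 'v set set" where
  "complex_faces V E = (\<lambda>v. {v}) ` V \<union> E"

definition complex_points :: "'v set \<Rightarrow> 'v set set \<Rightarrow> ('v \<Rightarrow> real) set" where
  "complex_points V E = {x. (\<forall>w. 0 \<le> x w) \<and> (\<Sum>w\<in>V. x w) = 1 \<and> (\<exists>s\<in>complex_faces V E. \<forall>w. w \<notin> s \<longrightarrow> x w = 0)}"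

definition complex_top :: "'v set \<Rightarrow> 'v set set \<Rightarrow> ('v \<Rightarrow> real) topology" where
  "complex_top V E = subtopology (powertop_real UNIV) (complex_points V E)"

lemma topspace_complex_top [simp]: "topspace (complex_top V E) = complex_points V E"
  by (simp add: complex_top_def)

lemma Hausdorff_space_complex_top: "Hausdorff_space (complex_top V E)"
  by (simp add: complex_top_def Hausdorff_space_subtopology Hausdorff_space_product_topology)

lemma continuous_map_complex_coordinate: "continuous_map (complex_top V E) euclideanreal (\<lambda>x. x v)"
  unfolding complex_top_def
  by (rule continuous_map_from_subtopology)
    (use continuous_map_product_projection[of v UNIV "\<lambda>_. euclideanreal"] in simp)

lemma continuous_map_into_complex_top:
  assumes "\<And>v. continuous_map Z euclideanreal (\<lambda>z. f z v)" "\<And>z. z \<in> topspace Z \<Longrightarrow> f z \<in> complex_points V E"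
  shows "continuous_map Z (complex_top V E) f"
  using assms by (auto simp: complex_top_def continuous_map_in_subtopology continuous_map_componentwise_UNIV)

definition point_dist :: "'v set \<Rightarrow> ('v \<Rightarrow> real) \<Rightarrow> ('v \<Rightarrow> real) \<Rightarrow> real" where
  "point_dist V x y = (\<Sum>v\<in>V. \<bar>x v - y v\<bar>)"

text \<open>
  Two points at distance less than \<open>1/4\<close> have a common centre: cutting off the small coordinates of
  their midpoint leaves a point that lies in every face containing one of the two points. For a
  coordinate that vanishes at one of the points is less than \<open>1/4\<close> at the other, so it is less than
  \<open>1/8\<close> at the midpoint; and not all coordinates are cut off, since some coordinate of each point
  is at least \<open>1/2\<close>.
\<close>

definition center_weight :: "('v \<Rightarrow> real) \<Rightarrow> ('v \<Rightarrow> real) \<Rightarrow> 'v \<Rightarrow> real" where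
  "center_weight x y v = max 0 ((x v + y v) / 2 - 1 / 8)"

definition center :: "'v set \<Rightarrow> ('v \<Rightarrow> real) \<Rightarrow> ('v \<Rightarrow> real) \<Rightarrow> 'v \<Rightarrow> real" where
  "center V x y v = center_weight x y v / (\<Sum>w\<in>V. center_weight x y w)"

definition contract_to_center :: "'v set \<Rightarrow> real \<Rightarrow> ('v \<Rightarrow> real) \<Rightarrow> ('v \<Rightarrow> real) \<Rightarrow> 'v \<Rightarrow> real" where
  "contract_to_center V t x y v = (1 - t) * x v + t * center V x y v"

locale graph_complex =
  fixes V :: "'v set" and E :: "'v set set"
  assumes finV: "finite V" and edge: "e \<in> E \<Longrightarrow> \<exists>u\<in>V. \<exists>v\<in>V. u \<noteq> v \<and> e = {u, v}"
begin

lemma finE: "finite E"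
  using edge finV by (intro finite_subset[of E "Pow V"]) auto

lemma faceD: "s \<in> complex_faces V E \<Longrightarrow> s \<subseteq> V \<and> s \<noteq> {} \<and> card s \<le> 2"
  using edge[of s] by (auto simp: complex_faces_def)

lemma point_off: "x \<in> complex_points V E \<Longrightarrow> w \<notin> V \<Longrightarrow> x w = 0"
  using faceD by (fastforce simp: complex_points_def)

lemma point_le_1:
  assumes "x \<in> complex_points V E"
  shows "x w \<le> 1"
proof (cases "w \<in> V")
  case True
  then have "x w \<le> (\<Sum>w\<in>V. x w)"
    using assms finV by (intro member_le_sum) (auto simp: complex_points_def)
  then show ?thesis
    using assms by (simp add: complex_points_def)
qed (use point_off[OF assms] in simp)

lemma point_large_coordinate:
  assumes x: "x \<in> complex_points V E"
  shows "\<exists>v\<in>V. x v \<ge> 1 / 2"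
proof (rule ccontr)
  assume n: "\<not> (\<exists>v\<in>V. x v \<ge> 1 / 2)"
  obtain s where s: "s \<in> complex_faces V E" "\<And>w. w \<notin> s \<Longrightarrow> x w = 0"
    using x by (auto simp: complex_points_def)
  have sV: "s \<subseteq> V" "s \<noteq> {}" "card s \<le> 2"
    using faceD[OF s(1)] by auto
  then have fin: "finite s"
    using finV finite_subset by blast
  have "1 = (\<Sum>w\<in>V. x w)"
    using x by (simp add: complex_points_def)
  also have "\<dots> = (\<Sum>w\<in>s. x w)"
    using s(2) sV finV by (intro sum.mono_neutral_right) auto
  also have "\<dots> < (\<Sum>w\<in>s. 1 / 2)"
    using n sV fin by (intro sum_strict_mono) (auto simp: not_le subset_iff)
  also have "\<dots> \<le> 1"
    using sV(3) by simp
  finally show False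
    by simp
qed

lemma compact_space_complex_top: "compact_space (complex_top V E)"
proof -
  let ?P = "powertop_real (UNIV :: 'v set)"
  have proj: "continuous_map ?P euclideanreal (\<lambda>x. x i)" for i
    using continuous_map_product_projection[of i UNIV "\<lambda>_. euclideanreal"] by simp
  define F where "F s = (\<Inter>i. {x \<in> topspace ?P. x i \<in> {0..}}) \<inter> (\<Inter>i\<in>- s. {x \<in> topspace ?P. x i \<in> {0}}) \<inter>
      {x \<in> topspace ?P. (\<Sum>i\<in>V. x i) \<in> {1}}" for s
  have "closedin ?P {x \<in> topspace ?P. x i \<in> {0..}}" for i
    by (rule closedin_continuous_map_preimage[OF proj]) auto
  then have 1: "closedin ?P (\<Inter>i. {x \<in> topspace ?P. x i \<in> {0..}})"
    by (intro closedin_Inter) auto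
  have 2: "closedin ?P {x \<in> topspace ?P. x i \<in> {0}}" for i
    by (rule closedin_continuous_map_preimage[OF proj]) auto
  have "continuous_map ?P euclideanreal (\<lambda>x. \<Sum>i\<in>V. x i)"
    by (intro continuous_map_sum finV proj)
  then have 3: "closedin ?P {x \<in> topspace ?P. (\<Sum>i\<in>V. x i) \<in> {1}}"
    by (rule closedin_continuous_map_preimage) auto
  have "closedin ?P (F s)" if "s \<in> complex_faces V E" for s
  proof (cases "- s = {}")
    case True
    then show ?thesis
      unfolding F_def using closedin_Int[OF 1 3] by simp
  next
    case False
    then have "closedin ?P (\<Inter>i\<in>- s. {x \<in> topspace ?P. x i \<in> {0}})"
      using 2 by (intro closedin_Inter) auto
    then show ?thesis
      unfolding F_def using 1 3 by (intro closedin_Int)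
  qed
  moreover have "finite (complex_faces V E)"
    by (simp add: complex_faces_def finV finE)
  ultimately have "closedin ?P (\<Union>s\<in>complex_faces V E. F s)"
    by (intro closedin_Union) auto
  also have "(\<Union>s\<in>complex_faces V E. F s) = complex_points V E"
    by (auto simp: F_def complex_points_def)
  finally have "closedin ?P (complex_points V E)" .
  moreover have "complex_points V E \<subseteq> UNIV \<rightarrow>\<^sub>E {0..1}"
  proof
    fix x assume x: "x \<in> complex_points V E"
    show "x \<in> UNIV \<rightarrow>\<^sub>E {0..1}"
      using point_le_1[OF x] x by (simp add: PiE_iff complex_points_def)
  qed
  moreover have "compactin ?P (UNIV \<rightarrow>\<^sub>E {0..1})"
    by (simp add: compactin_PiE)
  ultimately have "compactin ?P (complex_points V E)"
    using closed_compactin by blast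
  then show ?thesis
    by (simp add: complex_top_def compact_space_subtopology)
qed

lemma point_dist_commute: "point_dist V x y = point_dist V y x"
  by (simp add: point_dist_def abs_minus_commute)

lemma point_dist_nonneg: "0 \<le> point_dist V x y"
  by (simp add: point_dist_def sum_nonneg)

lemma point_dist_eq_0:
  assumes "x \<in> complex_points V E" "y \<in> complex_points V E"
  shows "point_dist V x y = 0 \<longleftrightarrow> x = y"
proof
  assume "point_dist V x y = 0"
  then have "\<forall>v\<in>V. \<bar>x v - y v\<bar> = 0"
    unfolding point_dist_def using finV by (subst (asm) sum_nonneg_eq_0_iff) auto
  then show "x = y"
    using point_off[OF assms(1)] point_off[OF assms(2)] by (intro ext) (metis abs_eq_0_iff eq_iff_diff_eq_0)
qed (simp add: point_dist_def)

lemma coordinate_dist: "v \<in> V \<Longrightarrow> \<bar>x v - y v\<bar> \<le> point_dist V x y"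
  unfolding point_dist_def using finV by (intro member_le_sum) auto

lemma center_weight_sum_pos:
  assumes "x \<in> complex_points V E" "point_dist V x y < 1 / 4"
  shows "(\<Sum>w\<in>V. center_weight x y w) > 0"
proof -
  obtain v where v: "v \<in> V" "x v \<ge> 1 / 2"
    using point_large_coordinate[OF assms(1)] by blast
  then have "\<bar>x v - y v\<bar> < 1 / 4"
    using coordinate_dist[of v x y] assms(2) by simp
  then have "x v - y v < 1 / 4"
    unfolding abs_less_iff by simp
  then have "0 < center_weight x y v"
    using v by (simp add: center_weight_def)
  also have "\<dots> \<le> (\<Sum>w\<in>V. center_weight x y w)"
    using finV v by (intro member_le_sum) (auto simp: center_weight_def)
  finally show ?thesis .
qed

lemma center_commute: "center V x y = center V y x"
  by (simp add: center_def center_weight_def add.commute fun_eq_iff)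

lemma center_nonneg: "0 \<le> center V x y v"
  by (auto simp: center_def center_weight_def intro!: divide_nonneg_nonneg sum_nonneg)

lemma center_sum:
  assumes "x \<in> complex_points V E" "point_dist V x y < 1 / 4"
  shows "(\<Sum>v\<in>V. center V x y v) = 1"
  using center_weight_sum_pos[OF assms] by (simp add: center_def flip: sum_divide_distrib)

lemma center_support:
  assumes x: "x \<in> complex_points V E" and y: "y \<in> complex_points V E" and d: "point_dist V x y < 1 / 4" and 0: "x v = 0"
  shows "center V x y v = 0"
proof (cases "v \<in> V")
  case True
  then have "\<bar>x v - y v\<bar> < 1 / 4"
    using coordinate_dist[of v x y] d by simp
  then have "y v \<le> 1 / 4"
    using 0 by simp
  then show ?thesis
    using 0 by (simp add: center_def center_weight_def)
next
  case False
  then show ?thesis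
    using 0 point_off[OF y] by (simp add: center_def center_weight_def)
qed

lemma contract_to_center_in:
  assumes F: "F \<subseteq> E" and x: "x \<in> complex_points V F" and y: "y \<in> complex_points V E"
    and d: "point_dist V x y < 1 / 4" and t: "0 \<le> t" "t \<le> 1"
  shows "contract_to_center V t x y \<in> complex_points V F"
proof -
  have xE: "x \<in> complex_points V E"
    using x F by (auto simp: complex_points_def complex_faces_def)
  obtain s where s: "s \<in> complex_faces V F" "\<And>w. w \<notin> s \<Longrightarrow> x w = 0"
    using x by (auto simp: complex_points_def)
  have "contract_to_center V t x y w = 0" if "w \<notin> s" for w
    using s(2)[OF that] center_support[OF xE y d] by (simp add: contract_to_center_def)
  moreover have "0 \<le> contract_to_center V t x y w" for w
    using t x center_nonneg by (auto simp: contract_to_center_def complex_points_def)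
  moreover have "(\<Sum>w\<in>V. contract_to_center V t x y w) = 1"
    using x center_sum[OF xE d] by (simp add: contract_to_center_def sum.distrib complex_points_def flip: sum_distrib_left)
  ultimately show ?thesis
    using s(1) by (auto simp: complex_points_def)
qed

lemma point_dist_contract_to_center:
  assumes "t \<le> 1"
  shows "point_dist V (contract_to_center V t x y) (contract_to_center V t y x) = (1 - t) * point_dist V x y"
proof -
  have "\<bar>contract_to_center V t x y v - contract_to_center V t y x v\<bar> = (1 - t) * \<bar>x v - y v\<bar>" for v
    using assms center_commute[of x y]
    by (simp add: contract_to_center_def abs_mult flip: right_diff_distrib)
  then show ?thesis
    by (simp add: point_dist_def sum_distrib_left)
qed

abbreviation Gam where "Gam \<equiv> complex_top V E"
abbreviation Gsq where "Gsq \<equiv> prod_topology Gam Gam"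

definition near :: "real \<Rightarrow> (('v \<Rightarrow> real) \<times> ('v \<Rightarrow> real)) set" where
  "near r = {(x, y). x \<in> complex_points V E \<and> y \<in> complex_points V E \<and> point_dist V x y < r}"

definition diag :: "(('v \<Rightarrow> real) \<times> ('v \<Rightarrow> real)) set" where
  "diag = (\<lambda>x. (x, x)) ` complex_points V E"

text \<open>
  Both points of a near pair move linearly to their centre, each within its own face. Their distance
  shrinks by the factor \<open>1 - t\<close>, so up to time \<open>t < 1\<close> distinct points remain distinct.
\<close>

definition push :: "real \<times> (('v \<Rightarrow> real) \<times> ('v \<Rightarrow> real)) \<Rightarrow> ('v \<Rightarrow> real) \<times> ('v \<Rightarrow> real)" where
  "push = (\<lambda>(t, (x, y)). (contract_to_center V t x y, contract_to_center V t y x))"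

lemma push_0: "push (0, z) = z"
  by (cases z) (simp add: push_def contract_to_center_def fun_eq_iff)

lemma push_swap: "push (t, prod.swap z) = prod.swap (push (t, z))"
  by (cases z) (simp add: push_def)

lemma push_in:
  assumes "z \<in> near (1 / 4)" "0 \<le> t" "t \<le> 1"
  shows "push (t, z) \<in> complex_points V E \<times> complex_points V E"
  using assms contract_to_center_in[of E] point_dist_commute
  by (cases z) (auto simp: push_def near_def)

lemma point_dist_push: "t \<le> 1 \<Longrightarrow> point_dist V (fst (push (t, z))) (snd (push (t, z))) = (1 - t) * point_dist V (fst z) (snd z)"
  by (cases z) (simp add: push_def point_dist_contract_to_center)

lemma push_1:
  assumes "z \<in> near (1 / 4)"
  shows "push (1, z) \<in> diag"
proof -
  have "fst (push (1, z)) = snd (push (1, z))"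
    using center_commute by (cases z) (simp add: push_def contract_to_center_def fun_eq_iff)
  then show ?thesis
    using push_in[OF assms, of 1] by (cases "push (1, z)") (auto simp: diag_def)
qed

lemma diag_near: "0 < r \<Longrightarrow> diag \<subseteq> near r"
  by (auto simp: diag_def near_def point_dist_def)

lemma push_diag:
  assumes "z \<in> diag" "0 \<le> t" "t \<le> 1"
  shows "push (t, z) \<in> diag"
proof -
  have "z \<in> near (1 / 4)"
    using assms diag_near[of "1 / 4"] by auto
  then have p: "push (t, z) \<in> complex_points V E \<times> complex_points V E"
    using push_in assms by blast
  have "fst (push (t, z)) = snd (push (t, z))"
    using assms by (auto simp: diag_def push_def)
  then show ?thesis
    using p by (cases "push (t, z)") (auto simp: diag_def)
qed

lemma continuous_map_push:
  assumes P: "P \<subseteq> near (1 / 4)" and g: "continuous_map (top_of_set {0..1::real}) (top_of_set {0..1::real}) g"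
  shows "continuous_map (prod_topology (top_of_set {0..1::real}) (subtopology Gsq P)) Gsq (\<lambda>(t, z). push (g t, z))"
proof -
  let ?Z = "prod_topology (top_of_set {0..1::real}) (subtopology Gsq P)"
  have g01: "0 \<le> g t" "g t \<le> 1" if "0 \<le> t" "t \<le> 1" for t
    using g that by (auto simp: continuous_map_def Pi_iff)
  have ft: "continuous_map ?Z euclideanreal (\<lambda>a. g (fst a))"
    using continuous_map_compose[OF continuous_map_fst continuous_map_into_fulltopology[OF g]] by (simp add: o_def)
  have sd: "continuous_map ?Z Gsq snd"
    using continuous_map_into_fulltopology[OF continuous_map_snd] by blast
  have x: "continuous_map ?Z euclideanreal (\<lambda>a. fst (snd a) v)" for v
    using continuous_map_compose[OF continuous_map_compose[OF sd continuous_map_fst] continuous_map_complex_coordinate]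
    by (simp add: o_def)
  have y: "continuous_map ?Z euclideanreal (\<lambda>a. snd (snd a) v)" for v
    using continuous_map_compose[OF continuous_map_compose[OF sd continuous_map_snd] continuous_map_complex_coordinate]
    by (simp add: o_def)
  have w: "continuous_map ?Z euclideanreal (\<lambda>a. center_weight (fst (snd a)) (snd (snd a)) v)" for v
    unfolding center_weight_def by (intro continuous_intros continuous_map_real_max x y) auto
  have pos: "(\<Sum>w\<in>V. center_weight (fst (snd a)) (snd (snd a)) w) \<noteq> 0" if "a \<in> topspace ?Z" for a
    using center_weight_sum_pos[of "fst (snd a)" "snd (snd a)"] that P by (auto simp: near_def subset_iff)
  have c: "continuous_map ?Z euclideanreal (\<lambda>a. center V (fst (snd a)) (snd (snd a)) v)" for v
    unfolding center_def using pos by (intro continuous_map_real_divide continuous_map_sum finV w) auto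
  have c': "continuous_map ?Z euclideanreal (\<lambda>a. center V (snd (snd a)) (fst (snd a)) v)" for v
    using c[of v] by (simp add: center_commute)
  have in_pts: "push (g (fst a), snd a) \<in> complex_points V E \<times> complex_points V E" if "a \<in> topspace ?Z" for a
    using that P push_in[of "snd a" "g (fst a)"] g01 by (cases a) auto
  have "continuous_map ?Z Gam (\<lambda>a. contract_to_center V (g (fst a)) (fst (snd a)) (snd (snd a)))"
    using in_pts
    by (intro continuous_map_into_complex_top)
      (auto simp: contract_to_center_def push_def case_prod_unfold intro!: continuous_intros ft x y c)
  moreover have "continuous_map ?Z Gam (\<lambda>a. contract_to_center V (g (fst a)) (snd (snd a)) (fst (snd a)))"
    using in_pts
    by (intro continuous_map_into_complex_top)
      (auto simp: contract_to_center_def push_def case_prod_unfold intro!: continuous_intros ft x y c')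
  ultimately show ?thesis
    by (simp add: push_def case_prod_unfold continuous_map_pairedI)
qed

lemma near_swap: "z \<in> near r \<Longrightarrow> prod.swap z \<in> near r"
  using point_dist_commute by (auto simp: near_def)

lemma near_mono: "r \<le> s \<Longrightarrow> near r \<subseteq> near s"
  by (auto simp: near_def)

lemma near_sub: "near r \<subseteq> topspace Gam \<times> topspace Gam"
  by (auto simp: near_def)

lemma rel_acyclic_near_diag:
  assumes P: "P \<subseteq> near (1 / 4)" "\<And>z. z \<in> P \<Longrightarrow> prod.swap z \<in> P" and Q: "Q \<subseteq> P"
    and pP: "\<And>t z. \<lbrakk>0 \<le> t; t \<le> 1; z \<in> P\<rbrakk> \<Longrightarrow> push (t, z) \<in> P"
    and pQ: "\<And>t z. \<lbrakk>0 \<le> t; t \<le> 1; z \<in> Q\<rbrakk> \<Longrightarrow> push (t, z) \<in> Q"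
    and p1: "\<And>z. z \<in> P \<Longrightarrow> push (1, z) \<in> Q"
  shows "rel_acyclic q (subtopology (sym2 Gam) (upair ` P)) (upair ` Q)"
  by (rule rel_acyclic_equivariant_deformation[OF _ P(2) Q continuous_map_push[OF P(1), of "\<lambda>t. t"]])
    (use P(1) near_sub pP pQ p1 in \<open>auto simp: push_0 push_swap\<close>)

end

section \<open>Configurations and the symmetric square relative to its diagonal\<close>

lemma upair_in_symmetric:
  assumes "\<And>z. z \<in> P \<Longrightarrow> prod.swap z \<in> P"
  shows "upair z \<in> upair ` P \<longleftrightarrow> z \<in> P"
  unfolding image_iff upair_eq_iff using assms by (metis swap_swap)

lemma upair_image_diff:
  assumes "\<And>z. z \<in> Q \<Longrightarrow> prod.swap z \<in> Q"
  shows "upair ` P - upair ` Q = upair ` (P - Q)"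
  using upair_in_symmetric[of Q, OF assms] by auto

lemma upair_image_Int:
  assumes "\<And>z. z \<in> Q \<Longrightarrow> prod.swap z \<in> Q"
  shows "upair ` P \<inter> upair ` Q = upair ` (P \<inter> Q)"
  using upair_in_symmetric[of Q, OF assms] by auto

context graph_complex
begin

abbreviation Ysym where "Ysym \<equiv> sym2 Gam"

abbreviation pair_dist where "pair_dist z \<equiv> point_dist V (fst z) (snd z)"

lemma Hausdorff_Ysym: "Hausdorff_space Ysym"
  by (intro Hausdorff_space_sym2 Hausdorff_space_complex_top)

lemma compact_Gsq: "compact_space Gsq"
  by (simp add: compact_space_prod_topology compact_space_complex_top)

lemma topspace_Ysym: "topspace Ysym = upair ` topspace Gsq"
  by (simp add: topspace_sym2)

lemma closedin_upair_image:
  assumes "closedin Gsq C"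
  shows "closedin Ysym (upair ` C)"
  using image_compactin[OF closedin_compact_space[OF compact_Gsq assms] continuous_map_upair]
  by (rule compactin_imp_closedin[OF Hausdorff_Ysym])

lemma continuous_map_pair_dist: "continuous_map Gsq euclideanreal (\<lambda>z. pair_dist z)"
proof -
  have "continuous_map Gsq euclideanreal (\<lambda>z. fst z v)" "continuous_map Gsq euclideanreal (\<lambda>z. snd z v)" for v
    using continuous_map_compose[OF continuous_map_fst continuous_map_complex_coordinate]
      continuous_map_compose[OF continuous_map_snd continuous_map_complex_coordinate]
    by (simp_all add: o_def)
  then show ?thesis
    unfolding point_dist_def
    by (intro continuous_map_sum finV continuous_map_real_abs continuous_map_diff)
qed

lemma near_alt: "near r = {z \<in> topspace Gsq. pair_dist z \<in> {..<r}}"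
  by (auto simp: near_def)

lemma diag_alt: "diag = {z \<in> topspace Gsq. pair_dist z \<in> {..0}}"
proof -
  have "point_dist V x y \<le> 0 \<longleftrightarrow> x = y" if "x \<in> complex_points V E" "y \<in> complex_points V E" for x y
    using point_dist_eq_0[OF that] point_dist_nonneg[of x y] by linarith
  then show ?thesis
    by (auto simp: diag_def)
qed

lemma diag_swap: "z \<in> diag \<Longrightarrow> prod.swap z \<in> diag"
  by (auto simp: diag_def)

lemma openin_near: "openin Gsq (near r)"
  unfolding near_alt by (rule openin_continuous_map_preimage[OF continuous_map_pair_dist]) simp

lemma closedin_diag: "closedin Gsq diag"
  unfolding diag_alt by (rule closedin_continuous_map_preimage[OF continuous_map_pair_dist]) simp

lemma openin_upair_near: "openin Ysym (upair ` near r)"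
  using open_map_upair openin_near unfolding open_map_def by blast

lemma closedin_upair_diag: "closedin Ysym (upair ` diag)"
  by (rule closedin_upair_image[OF closedin_diag])

lemma sym2_diagonal_Gam: "sym2_diagonal Gam = upair ` diag"
  by (simp add: sym2_diagonal_eq diag_def)

lemma config2_Gam: "config2 Gam = subtopology Ysym (topspace Ysym - upair ` diag)"
  by (simp add: config2_def sym2_diagonal_Gam)

text \<open>
  The pairs of distinct points at distance less than \<open>1/4\<close>, \<open>1/8\<close>, \<open>1/16\<close> and so on.
\<close>

definition ends :: "nat \<Rightarrow> (('v \<Rightarrow> real) \<times> ('v \<Rightarrow> real)) set set" where
  "ends m = upair ` (near (1 / 4 / 2 ^ m) - diag)"

lemma near_diff_swap: "z \<in> near r - diag \<Longrightarrow> prod.swap z \<in> near r - diag"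
  using near_swap[of z r] diag_swap[of "prod.swap z"] by auto

lemma ends_alt: "ends m = upair ` near (1 / 4 / 2 ^ m) - upair ` diag"
  by (simp add: ends_def upair_image_diff diag_swap)

text \<open>
  Each of these sets deforms into the next one by pushing the two points half of the way to their
  centre. The complements are compact, because the distance is bounded below on them; conversely a
  compact set of configurations has a positive minimal distance.
\<close>

lemma end_exhaustion_config: "end_exhaustion (config2 Gam) ends"
proof
  have top: "topspace (config2 Gam) = upair ` (topspace Gsq - diag)"
    by (simp add: config2_Gam topspace_Ysym upair_image_diff diag_swap flip: topspace_prod_topology) blast
  fix m
  let ?r = "1 / 4 / 2 ^ m :: real"
  have r: "0 < ?r" "?r \<le> 1 / 4"
    by (simp_all add: field_simps)
  show "ends (Suc m) \<subseteq> ends m"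
    unfolding ends_def by (intro image_mono Diff_mono near_mono) (simp_all add: field_simps)
  show sub: "ends m \<subseteq> topspace (config2 Gam)"
    unfolding ends_def top using near_sub by (intro image_mono) auto
  show "compactin (config2 Gam) (topspace (config2 Gam) - ends m)"
  proof -
    have "topspace (config2 Gam) - ends m = upair ` (topspace Gsq - diag - (near ?r - diag))"
      unfolding top ends_def by (rule upair_image_diff) (rule near_diff_swap)
    also have "topspace Gsq - diag - (near ?r - diag) = {z \<in> topspace Gsq. pair_dist z \<in> {?r..}}"
    proof -
      have "\<not> (?r \<le> s \<and> s \<le> 0)" for s
        using r(1) by linarith
      then show ?thesis
        unfolding near_alt diag_alt by auto
    qed
    finally have eq: "topspace (config2 Gam) - ends m = upair ` {z \<in> topspace Gsq. pair_dist z \<in> {?r..}}" .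
    have "closedin Gsq {z \<in> topspace Gsq. pair_dist z \<in> {?r..}}"
      by (rule closedin_continuous_map_preimage[OF continuous_map_pair_dist]) simp
    then have "compactin Ysym (topspace (config2 Gam) - ends m)"
      unfolding eq by (intro image_compactin[OF closedin_compact_space[OF compact_Gsq] continuous_map_upair])
    then show ?thesis
      unfolding config2_Gam compactin_subtopology by auto
  qed
  show "rel_acyclic p (subtopology (config2 Gam) (ends m)) (ends (Suc m))" for p
  proof -
    have "subtopology (config2 Gam) (ends m) = subtopology Ysym (ends m)"
      using sub unfolding config2_Gam subtopology_subtopology by (simp add: Int_absorb1)
    moreover have "rel_acyclic p (subtopology Ysym (ends m)) (ends (Suc m))"
      unfolding ends_def
    proof (rule rel_acyclic_equivariant_deformation)
      let ?P = "near ?r - diag" and ?Q = "near (1 / 4 / 2 ^ Suc m) - diag"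
      have g: "continuous_map (top_of_set {0..1::real}) (top_of_set {0..1::real}) (\<lambda>t. t / 2)"
        by (auto simp: continuous_map_in_subtopology intro!: continuous_intros)
      show "continuous_map (prod_topology (top_of_set {0..1::real}) (subtopology Gsq ?P)) Gsq (\<lambda>(t, z). push (t / 2, z))"
        by (rule continuous_map_push[OF _ g]) (use near_mono[OF r(2)] in auto)
      show "?P \<subseteq> topspace Gam \<times> topspace Gam"
        using near_sub by auto
      show "?Q \<subseteq> ?P"
        by (intro Diff_mono near_mono) (simp_all add: field_simps)
      have main: "push (s, z) \<in> near r' - diag"
        if "z \<in> ?P" "0 \<le> s" "s \<le> 1 / 2" "(1 - s) * pair_dist z < r'" for s z r'
      proof -
        have z: "z \<in> near (1 / 4)" "pair_dist z > 0"
          using that(1) near_mono[OF r(2)] unfolding near_alt diag_alt by auto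
        have "push (s, z) \<in> topspace Gsq"
          using push_in[OF z(1)] that by simp
        moreover have "pair_dist (push (s, z)) = (1 - s) * pair_dist z"
          using that by (intro point_dist_push) simp
        moreover have "(1 - s) * pair_dist z > 0"
          using that z by simp
        ultimately show ?thesis
          using that(4) unfolding near_alt diag_alt by auto
      qed
      have le: "(1 - s) * pair_dist z \<le> pair_dist z" if "0 \<le> s" for s z
        using that point_dist_nonneg by (simp add: mult_left_le_one_le algebra_simps)
      show "(\<lambda>(t, z). push (t / 2, z)) (t, z) \<in> ?P" if "0 \<le> t" "t \<le> 1" "z \<in> ?P" for t z
        using main[of z "t / 2" ?r] le[of "t / 2" z] that by (simp add: near_alt)
      show "(\<lambda>(t, z). push (t / 2, z)) (t, z) \<in> ?Q" if "0 \<le> t" "t \<le> 1" "z \<in> ?Q" for t z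
      proof -
        have "z \<in> ?P"
          using that(3) near_mono[of "1 / 4 / 2 ^ Suc m" ?r] by (auto simp: field_simps)
        then show ?thesis
          using main[of z "t / 2" "1 / 4 / 2 ^ Suc m"] le[of "t / 2" z] that by (simp add: near_alt)
      qed
      show "(\<lambda>(t, z). push (t / 2, z)) (1, z) \<in> ?Q" if "z \<in> ?P" for z
        using main[of z "1 / 2" "1 / 4 / 2 ^ Suc m"] that by (simp add: near_alt)
    qed (use near_diff_swap push_swap push_0 in auto)
    ultimately show ?thesis
      by simp
  qed
next
  fix K assume "compactin (config2 Gam) K"
  then have K: "compactin Ysym K" "K \<subseteq> topspace Ysym - upair ` diag"
    by (auto simp: config2_Gam compactin_subtopology)
  define L where "L = {z \<in> topspace Gsq. upair z \<in> K}"
  have "closedin Ysym K"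
    by (rule compactin_imp_closedin[OF Hausdorff_Ysym K(1)])
  then have "closedin Gsq L"
    unfolding L_def by (rule closedin_continuous_map_preimage[OF continuous_map_upair])
  then have "compactin euclideanreal (pair_dist ` L)"
    by (intro image_compactin[OF closedin_compact_space[OF compact_Gsq] continuous_map_pair_dist])
  then have cpt: "compact (pair_dist ` L)"
    by simp
  have "\<exists>e>0. \<forall>z\<in>L. e \<le> pair_dist z"
  proof (cases "L = {}")
    case True
    then show ?thesis
      by (intro exI[of _ 1]) simp
  next
    case False
    then obtain z where z: "z \<in> L" "\<And>w. w \<in> L \<Longrightarrow> pair_dist z \<le> pair_dist w"
      using compact_attains_inf[OF cpt] by auto
    have "z \<notin> diag"
      using z(1) K(2) by (auto simp: L_def)
    then have "pair_dist z > 0"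
      using z(1) unfolding diag_alt L_def by auto
    then show ?thesis
      using z(2) by blast
  qed
  then obtain e where e: "e > 0" "\<And>z. z \<in> L \<Longrightarrow> e \<le> pair_dist z"
    by blast
  obtain m where "(1 / 2) ^ m < e"
    using real_arch_pow_inv[OF e(1), of "1 / 2"] by auto
  then have m: "1 / 4 / 2 ^ m < e"
    by (simp add: power_divide field_simps)
  have "K \<inter> ends m = {}"
  proof (rule ccontr)
    assume "K \<inter> ends m \<noteq> {}"
    then obtain z where z: "z \<in> near (1 / 4 / 2 ^ m)" "upair z \<in> K"
      by (auto simp: ends_def)
    then have "z \<in> L"
      using near_sub by (auto simp: L_def)
    then show False
      using e(2)[of z] m z(1) by (simp add: near_alt)
  qed
  then show "\<exists>m. K \<inter> ends m = {}"
    by blast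
qed

text \<open>
  By excision of the diagonal, and since a neighbourhood of the diagonal contracts to it, the
  Borel--Moore homology of the configuration space is that of the symmetric square relative to its
  diagonal.
\<close>

lemma BM_homology_config2_Gam:
  "BM_homology_group (int p) (config2 Gam) \<cong> relative_homology_group (int p) Ysym (upair ` diag)"
proof -
  interpret end_exhaustion "config2 Gam" ends
    by (rule end_exhaustion_config)
  let ?N = "upair ` near (1 / 4)" and ?D = "upair ` diag"
  have DN: "?D \<subseteq> ?N"
    using diag_near[of "1 / 4"] by (intro image_mono) simp
  have "?N \<subseteq> topspace Ysym"
    using openin_subset[OF openin_upair_near] .
  then have "hom_induced (int p) (config2 Gam) (ends 0) Ysym ?N id
      \<in> iso (relative_homology_group (int p) (config2 Gam) (ends 0)) (relative_homology_group (int p) Ysym ?N)"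
    using homology_excision_axiom[of Ysym ?D ?N "topspace Ysym" "int p"] DN
    by (simp add: config2_Gam ends_alt closure_of_closedin[OF closedin_upair_diag] interior_of_openin[OF openin_upair_near])
  then have 1: "relative_homology_group (int p) (config2 Gam) (ends 0) \<cong> relative_homology_group (int p) Ysym ?N"
    by (rule is_isoI)
  have "rel_acyclic q (subtopology Ysym ?N) ?D" for q
  proof (rule rel_acyclic_near_diag)
    show "push (t, z) \<in> near (1 / 4)" if "0 \<le> t" "t \<le> 1" "z \<in> near (1 / 4)" for t z
    proof -
      have "push (t, z) \<in> topspace Gsq"
        using push_in that by simp
      moreover have "pair_dist (push (t, z)) \<le> pair_dist z"
        using that point_dist_nonneg by (simp add: point_dist_push mult_left_le_one_le)
      ultimately show ?thesis
        using that by (simp add: near_alt)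
    qed
  qed (use near_swap diag_near push_diag push_1 in auto)
  then have "relative_homology_group (int p) Ysym ?D \<cong> relative_homology_group (int p) Ysym ?N"
    by (intro is_isoI[OF hom_induced_triple_iso] DN)
  then have "relative_homology_group (int p) Ysym ?N \<cong> relative_homology_group (int p) Ysym ?D"
    by (rule group.iso_sym[OF group_relative_homology_group])
  then show ?thesis
    using BM_homology_iso_relative[of p] 1 iso_trans by blast
qed

lemma complex_points_mono: "F \<subseteq> E \<Longrightarrow> complex_points V F \<subseteq> complex_points V E"
  by (auto simp: complex_points_def complex_faces_def)

definition tree_square :: "'v set set \<Rightarrow> (('v \<Rightarrow> real) \<times> ('v \<Rightarrow> real)) set" where
  "tree_square F = complex_points V F \<times> complex_points V F"

text \<open>
  A contraction of the subcomplex, applied to both points of a pair simultaneously, is equivariant,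
  preserves the diagonal and ends in a single pair of equal points.
\<close>

lemma rel_acyclic_tree_square:
  assumes F: "F \<subseteq> E" and contr: "contractible_space (complex_top V F)"
  shows "rel_acyclic q (subtopology Ysym (upair ` tree_square F)) (upair ` (diag \<inter> tree_square F))"
proof -
  let ?I = "top_of_set {0..1::real}" and ?T = "complex_points V F" and ?P = "tree_square F"
  have TE: "?T \<subseteq> complex_points V E"
    by (rule complex_points_mono[OF F])
  have sub: "complex_top V F = subtopology Gam ?T"
    using TE by (simp add: complex_top_def subtopology_subtopology Int_absorb1)
  obtain a where "homotopic_with (\<lambda>x. True) (complex_top V F) (complex_top V F) id (\<lambda>x. a)"
    using contr by (auto simp: contractible_space_def)
  then obtain k where k: "continuous_map (prod_topology ?I (complex_top V F)) (complex_top V F) k"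
    and k0: "\<And>x. k (0, x) = x" and k1: "\<And>x. k (1, x) = a"
    unfolding homotopic_with_def by auto
  have kT: "k (t, x) \<in> ?T" if "0 \<le> t" "t \<le> 1" "x \<in> ?T" for t x
    using k that by (auto simp: continuous_map_def Pi_iff)
  let ?h = "\<lambda>(t, z). (k (t, fst z), k (t, snd z))"
  have PT: "subtopology Gsq ?P = prod_topology (complex_top V F) (complex_top V F)"
    by (simp add: sub tree_square_def subtopology_Times)
  have kE: "continuous_map (prod_topology ?I (complex_top V F)) Gam k"
    using continuous_map_into_fulltopology[OF k[unfolded sub]] unfolding sub .
  show ?thesis
  proof (rule rel_acyclic_equivariant_deformation)
    let ?Z = "prod_topology ?I (prod_topology (complex_top V F) (complex_top V F))"
    have "continuous_map ?Z (prod_topology ?I (complex_top V F)) (\<lambda>z. (fst z, fst (snd z)))"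
      using continuous_map_compose[OF continuous_map_snd continuous_map_fst, of ?I]
      by (intro continuous_map_pairedI continuous_map_fst) (simp add: o_def)
    from continuous_map_compose[OF this kE]
    have 1: "continuous_map ?Z Gam (\<lambda>z. k (fst z, fst (snd z)))"
      by (simp add: o_def)
    have "continuous_map ?Z (prod_topology ?I (complex_top V F)) (\<lambda>z. (fst z, snd (snd z)))"
      using continuous_map_compose[OF continuous_map_snd continuous_map_snd, of ?I]
      by (intro continuous_map_pairedI continuous_map_fst) (simp add: o_def)
    from continuous_map_compose[OF this kE]
    have 2: "continuous_map ?Z Gam (\<lambda>z. k (fst z, snd (snd z)))"
      by (simp add: o_def)
    show "continuous_map (prod_topology ?I (subtopology Gsq ?P)) Gsq ?h"
      unfolding PT using continuous_map_pairedI[OF 1 2] by (simp add: case_prod_unfold)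
    have "a \<in> ?T" if "x \<in> ?T" for x
      using kT[of 1 x] k1 that by simp
    then show "?h (1, z) \<in> diag \<inter> ?P" if "z \<in> ?P" for z
      using that TE k1 by (cases z) (auto simp: tree_square_def diag_def)
    show "?h (t, z) \<in> diag \<inter> ?P" if "0 \<le> t" "t \<le> 1" "z \<in> diag \<inter> ?P" for t z
      using that kT[of t] TE by (cases z) (auto simp: tree_square_def diag_def)
  qed (use TE kT k0 in \<open>auto simp: tree_square_def\<close>)
qed

lemma push_subcomplex:
  assumes F: "F \<subseteq> E" and z: "z \<in> tree_square F \<inter> near (1 / 4)" and t: "0 \<le> t" "t \<le> 1"
  shows "push (t, z) \<in> tree_square F \<inter> near (1 / 4)"
proof -
  obtain x y where xy: "z = (x, y)"
    by (cases z)
  have d: "point_dist V x y < 1 / 4" "point_dist V y x < 1 / 4"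
    using z point_dist_commute by (auto simp: xy near_def)
  have x: "x \<in> complex_points V F" "x \<in> complex_points V E" and y: "y \<in> complex_points V F" "y \<in> complex_points V E"
    using z complex_points_mono[OF F] by (auto simp: xy tree_square_def)
  have "push (t, z) \<in> tree_square F"
    using contract_to_center_in[OF F x(1) y(2) d(1) t] contract_to_center_in[OF F y(1) x(2) d(2) t]
    by (simp add: xy push_def tree_square_def)
  moreover have "pair_dist (push (t, z)) \<le> pair_dist z"
    using t point_dist_nonneg by (simp add: point_dist_push mult_left_le_one_le)
  ultimately show ?thesis
    using z complex_points_mono[OF F] by (auto simp: near_alt tree_square_def)
qed

text \<open>
  Excising the part of the diagonal outside the symmetric square \<open>S\<close> of the contractible subcomplex
  reduces the claim to the acyclicity of \<open>S\<close> relative to its own diagonal. Excision needs a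
  neighbourhood of the diagonal, so the diagonals are replaced by the sets of near pairs, which
  push onto them; pushing preserves \<open>S\<close>, since the centre lies in the faces of both points.
\<close>

lemma rel_acyclic_diag_tree:
  assumes F: "F \<subseteq> E" and contr: "contractible_space (complex_top V F)"
  shows "rel_acyclic q (subtopology Ysym (upair ` (tree_square F \<union> diag))) (upair ` diag)"
proof -
  let ?T2 = "tree_square F" and ?n = "near (1 / 4)"
  let ?X0 = "upair ` (?T2 \<union> diag)" and ?A = "upair ` ((?T2 \<union> diag) \<inter> ?n)"
  have TE: "?T2 \<subseteq> topspace Gsq"
    using complex_points_mono[OF F] by (auto simp: tree_square_def)
  have Tswap: "prod.swap z \<in> ?T2" if "z \<in> ?T2" for z
    using that by (auto simp: tree_square_def)
  have dn: "diag \<subseteq> ?n"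
    by (rule diag_near) simp
  have 1: "rel_acyclic r (subtopology Ysym ?A) (upair ` diag)" for r
  proof (rule rel_acyclic_near_diag)
    show "push (t, z) \<in> (?T2 \<union> diag) \<inter> ?n" if "0 \<le> t" "t \<le> 1" "z \<in> (?T2 \<union> diag) \<inter> ?n" for t z
      using push_subcomplex[OF F, of z t] push_diag[of z t] that dn by blast
  qed (use dn near_swap diag_swap Tswap push_diag push_1 in auto)
  have 2: "rel_acyclic r (subtopology Ysym (upair ` (?T2 \<inter> ?n))) (upair ` (diag \<inter> ?T2))" for r
  proof (rule rel_acyclic_near_diag)
    show "push (t, z) \<in> ?T2 \<inter> ?n" if "0 \<le> t" "t \<le> 1" "z \<in> ?T2 \<inter> ?n" for t z
      using push_subcomplex[OF F that(3,1,2)] .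
    show "push (t, z) \<in> diag \<inter> ?T2" if "0 \<le> t" "t \<le> 1" "z \<in> diag \<inter> ?T2" for t z
      using push_subcomplex[OF F, of z t] push_diag[of z t] that dn by blast
    show "push (1, z) \<in> diag \<inter> ?T2" if "z \<in> ?T2 \<inter> ?n" for z
      using push_subcomplex[OF F that, of 1] push_1[of z] that by simp
  qed (use dn near_swap Tswap in auto)
  have Tn_swap: "prod.swap z \<in> ?T2 \<inter> ?n" if "z \<in> ?T2 \<inter> ?n" for z
    using that Tswap near_swap by blast
  have 3: "rel_acyclic r (subtopology Ysym (upair ` ?T2)) (upair ` (?T2 \<inter> ?n))" for r
  proof (rule rel_acyclic_triple_quotient)
    show "upair ` (diag \<inter> ?T2) \<subseteq> upair ` (?T2 \<inter> ?n)"
      using dn by (intro image_mono) auto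
    have "subtopology (subtopology Ysym (upair ` ?T2)) (upair ` (?T2 \<inter> ?n)) = subtopology Ysym (upair ` (?T2 \<inter> ?n))"
      unfolding subtopology_subtopology by (rule arg_cong[where f = "subtopology Ysym"]) blast
    then show "r = 0 \<or> rel_acyclic (r - Suc 0) (subtopology (subtopology Ysym (upair ` ?T2)) (upair ` (?T2 \<inter> ?n))) (upair ` (diag \<inter> ?T2))"
      using 2 by simp
    show "rel_acyclic r (subtopology Ysym (upair ` ?T2)) (upair ` (diag \<inter> ?T2))"
      by (rule rel_acyclic_tree_square[OF F contr])
  qed
  let ?Z = "subtopology Ysym ?X0" and ?U = "?X0 - upair ` ?T2"
  have X0Y: "?X0 \<subseteq> topspace Ysym"
    unfolding topspace_Ysym using TE near_sub dn by (intro image_mono) auto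
  have U: "?U \<subseteq> upair ` diag"
    by auto
  have "closedin ?Z (upair ` diag)"
    unfolding closedin_subtopology using closedin_upair_diag by (intro exI[of _ "upair ` diag"]) auto
  then have clU: "?Z closure_of ?U \<subseteq> upair ` diag"
    using U by (rule closure_of_minimal[rotated])
  have A_alt: "?A = upair ` ?n \<inter> ?X0"
    using near_swap by (subst Int_commute, subst upair_image_Int) auto
  have "openin ?Z ?A"
    unfolding openin_subtopology A_alt using openin_upair_near by blast
  moreover have dA: "upair ` diag \<subseteq> ?A"
    using dn by (intro image_mono) auto
  ultimately have "?Z closure_of ?U \<subseteq> ?Z interior_of ?A"
    using clU by (simp add: interior_of_openin)
  moreover have "?A \<subseteq> ?X0"
    by auto
  ultimately have exc: "hom_induced (int r) (subtopology ?Z (?X0 - ?U)) (?A - ?U) (subtopology ?Z ?X0) ?A id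
      \<in> iso (relative_homology_group (int r) (subtopology ?Z (?X0 - ?U)) (?A - ?U)) (relative_homology_group (int r) (subtopology ?Z ?X0) ?A)" for r
    by (rule homology_excision_axiom)
  have XU: "?X0 - ?U = upair ` ?T2"
    by auto
  have "?A - ?U = ?A \<inter> upair ` ?T2"
    by auto
  also have "\<dots> = upair ` (((?T2 \<union> diag) \<inter> ?n) \<inter> ?T2)"
    by (rule upair_image_Int[OF Tswap])
  also have "((?T2 \<union> diag) \<inter> ?n) \<inter> ?T2 = ?T2 \<inter> ?n"
    by auto
  finally have AU: "?A - ?U = upair ` (?T2 \<inter> ?n)" .
  have ZT: "subtopology ?Z (upair ` ?T2) = subtopology Ysym (upair ` ?T2)"
    unfolding subtopology_subtopology by (rule arg_cong[where f = "subtopology Ysym"]) blast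
  have ZZ: "subtopology ?Z ?X0 = ?Z"
    by (simp add: subtopology_subtopology)
  have 4: "rel_acyclic r ?Z ?A" for r
    using rel_acyclic_iso[OF exc[of r]] 3[of r] unfolding XU AU ZT ZZ by blast
  have ZA: "subtopology ?Z ?A = subtopology Ysym ?A"
    unfolding subtopology_subtopology by (rule arg_cong[where f = "subtopology Ysym"]) blast
  show ?thesis
    by (rule rel_acyclic_triple_trans[OF dA _ 4]) (unfold ZA, rule 1)
qed

lemma BM_homology_config2_tree:
  assumes F: "F \<subseteq> E" and contr: "contractible_space (complex_top V F)"
  shows "BM_homology_group (int p) (config2 Gam) \<cong> relative_homology_group (int p) Ysym (upair ` (tree_square F \<union> diag))"
proof -
  have "hom_induced (int p) Ysym (upair ` diag) Ysym (upair ` (tree_square F \<union> diag)) id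
      \<in> iso (relative_homology_group (int p) Ysym (upair ` diag)) (relative_homology_group (int p) Ysym (upair ` (tree_square F \<union> diag)))"
    by (rule hom_induced_triple_iso[OF _ rel_acyclic_diag_tree[OF assms]]) auto
  then show ?thesis
    using BM_homology_config2_Gam[of p] iso_trans is_isoI by blast
qed

end

section \<open>Contractible spanning trees\<close>

lemma edge_point_apply: "edge_point u v t w = (if w = u then 1 - t else 0) + (if w = v then t else 0)"
  by (simp add: edge_point_def unit_vec_def)

definition collapse_leaf :: "'v \<Rightarrow> 'v \<Rightarrow> ('v \<Rightarrow> real) \<Rightarrow> 'v \<Rightarrow> real" where
  "collapse_leaf u v x = (\<lambda>w. if w = v then 0 else if w = u then x u + x v else x w)"

lemma sum_collapse_leaf:
  assumes "finite S" "u \<in> S" "v \<notin> S"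
  shows "(\<Sum>w\<in>S. collapse_leaf u v x w) = (\<Sum>w\<in>insert v S. x w)"
    and "(\<Sum>w\<in>insert v S. collapse_leaf u v x w) = (\<Sum>w\<in>insert v S. x w)"
proof -
  have "(\<Sum>w\<in>S. collapse_leaf u v x w) = (\<Sum>w\<in>S. x w + (if w = u then x v else 0))"
    using assms by (intro sum.cong) (auto simp: collapse_leaf_def)
  also have "\<dots> = (\<Sum>w\<in>insert v S. x w)"
    using assms by (simp add: sum.distrib)
  finally show "(\<Sum>w\<in>S. collapse_leaf u v x w) = (\<Sum>w\<in>insert v S. x w)" .
  then show "(\<Sum>w\<in>insert v S. collapse_leaf u v x w) = (\<Sum>w\<in>insert v S. x w)"
    using assms by (simp add: collapse_leaf_def)
qed

text \<open>Attaching a leaf does not change the homotopy type: the leaf collapses linearly.\<close>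

lemma contractible_attach_leaf:
  assumes fin: "finite S" and uv: "u \<in> S" "v \<notin> S" and F: "\<And>e. e \<in> F \<Longrightarrow> e \<subseteq> S"
    and contr: "contractible_space (complex_top S F)"
  shows "contractible_space (complex_top (insert v S) (insert {u, v} F))"
proof -
  let ?X = "complex_top S F" and ?X' = "complex_top (insert v S) (insert {u, v} F)"
  let ?P = "complex_points S F" and ?P' = "complex_points (insert v S) (insert {u, v} F)"
  let ?r = "collapse_leaf u v"
  have face_no_v: "v \<notin> s" if "s \<in> complex_faces S F" for s
    using that F uv by (auto simp: complex_faces_def)
  have PP': "?P \<subseteq> ?P'"
  proof
    fix x assume "x \<in> ?P"
    then obtain s where s: "\<And>w. 0 \<le> x w" "(\<Sum>w\<in>S. x w) = 1" "s \<in> complex_faces S F" "\<And>w. w \<notin> s \<Longrightarrow> x w = 0"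
      by (auto simp: complex_points_def)
    moreover have "x v = 0"
      using s face_no_v by blast
    ultimately show "x \<in> ?P'"
      using fin uv by (auto simp: complex_points_def complex_faces_def)
  qed
  have face_cases: "s \<in> complex_faces S F \<or> s \<subseteq> {u, v}" if "s \<in> complex_faces (insert v S) (insert {u, v} F)" for s
    using that by (auto simp: complex_faces_def)
  have r_id: "?r x = x" if "x v = 0" for x
    using that by (auto simp: collapse_leaf_def fun_eq_iff)
  have r_nonneg: "0 \<le> ?r x w" if "\<And>w. 0 \<le> x w" for x w
    using that by (auto simp: collapse_leaf_def)
  have r_in: "?r x \<in> ?P" if "x \<in> ?P'" for x
  proof -
    obtain s where s: "\<And>w. 0 \<le> x w" "(\<Sum>w\<in>insert v S. x w) = 1" "s \<in> complex_faces (insert v S) (insert {u, v} F)" "\<And>w. w \<notin> s \<Longrightarrow> x w = 0"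
      using \<open>x \<in> ?P'\<close> by (auto simp: complex_points_def)
    have "\<exists>s\<in>complex_faces S F. \<forall>w. w \<notin> s \<longrightarrow> ?r x w = 0"
      using face_cases[OF s(3)]
    proof
      assume "s \<in> complex_faces S F"
      moreover from this have "x v = 0"
        using face_no_v s(4) by blast
      ultimately show ?thesis
        using s(4) by (intro bexI[of _ s]) (simp_all add: r_id)
    next
      assume "s \<subseteq> {u, v}"
      then have "?r x w = 0" if "w \<noteq> u" for w
        using s(4)[of w] that by (auto simp: collapse_leaf_def)
      moreover have "{u} \<in> complex_faces S F"
        using uv by (auto simp: complex_faces_def)
      ultimately show ?thesis
        by blast
    qed
    then show ?thesis
      using s r_nonneg[of x] sum_collapse_leaf(1)[OF fin uv, of x] by (auto simp: complex_points_def)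
  qed
  have coord: "continuous_map ?X' euclideanreal (\<lambda>x. x w)" for w
    by (rule continuous_map_complex_coordinate)
  have r_coord: "continuous_map ?X' euclideanreal (\<lambda>x. ?r x w)" for w
    unfolding collapse_leaf_def by (auto intro!: continuous_map_add coord)
  have r: "continuous_map ?X' ?X ?r"
    using r_in by (intro continuous_map_into_complex_top r_coord) simp
  have i: "continuous_map ?X ?X' id"
    using PP' by (intro continuous_map_into_complex_top) (auto simp: continuous_map_complex_coordinate)
  have "homotopic_with (\<lambda>x. True) ?X ?X (?r \<circ> id) id"
  proof (rule homotopic_with_equal)
    fix x assume "x \<in> topspace ?X"
    then have "x v = 0"
      using face_no_v by (auto simp: complex_points_def)
    then show "(?r \<circ> id) x = id x"
      using r_id by simp
  qed (use continuous_map_compose[OF i r] in auto)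
  moreover have "homotopic_with (\<lambda>x. True) ?X' ?X' (id \<circ> ?r) id"
    unfolding homotopic_with_def
  proof (intro exI[of _ "\<lambda>(t, x) w. (1 - t) * ?r x w + t * x w"] conjI)
    let ?Z = "prod_topology (top_of_set {0..1::real}) ?X'"
    show "continuous_map ?Z ?X' (\<lambda>(t, x) w. (1 - t) * ?r x w + t * x w)"
    proof (rule continuous_map_into_complex_top)
      fix w
      have "continuous_map ?Z euclideanreal fst"
        using continuous_map_into_fulltopology[OF continuous_map_fst] by blast
      moreover have "continuous_map ?Z euclideanreal (\<lambda>z. snd z w)" "continuous_map ?Z euclideanreal (\<lambda>z. ?r (snd z) w)"
        using continuous_map_compose[OF continuous_map_snd coord] continuous_map_compose[OF continuous_map_snd r_coord]
        by (simp_all add: o_def)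
      ultimately have "continuous_map ?Z euclideanreal (\<lambda>z. (1 - fst z) * ?r (snd z) w + fst z * snd z w)"
        by (intro continuous_intros) auto
      then show "continuous_map ?Z euclideanreal (\<lambda>z. (case z of (t, x) \<Rightarrow> \<lambda>w. (1 - t) * ?r x w + t * x w) w)"
        by (simp add: case_prod_unfold)
    next
      fix z assume "z \<in> topspace ?Z"
      then obtain t x where z: "z = (t, x)" "0 \<le> t" "t \<le> 1" "x \<in> ?P'"
        by auto
      obtain s where s: "\<And>w. 0 \<le> x w" "(\<Sum>w\<in>insert v S. x w) = 1" "s \<in> complex_faces (insert v S) (insert {u, v} F)" "\<And>w. w \<notin> s \<Longrightarrow> x w = 0"
        using \<open>x \<in> ?P'\<close> by (auto simp: complex_points_def)
      let ?y = "\<lambda>w. (1 - t) * ?r x w + t * x w"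
      have "(\<Sum>w\<in>insert v S. ?y w) = 1"
        using s(2) sum_collapse_leaf(2)[OF fin uv, of x]
        by (simp only: sum.distrib sum_distrib_left[symmetric]) simp
      moreover have "0 \<le> ?y w" for w
        using z s(1) r_nonneg[of x] by simp
      moreover have "\<exists>s\<in>complex_faces (insert v S) (insert {u, v} F). \<forall>w. w \<notin> s \<longrightarrow> ?y w = 0"
        using face_cases[OF s(3)]
      proof
        assume "s \<in> complex_faces S F"
        then have "x v = 0"
          using face_no_v s(4) by blast
        then have "?r x = x"
          by (rule r_id)
        then show ?thesis
          using s(3,4) by (intro bexI[of _ s]) auto
      next
        assume "s \<subseteq> {u, v}"
        have "?y w = 0" if "w \<notin> {u, v}" for w
        proof -
          have "x w = 0"
            using s(4)[of w] that \<open>s \<subseteq> {u, v}\<close> by blast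
          then show ?thesis
            using that by (simp add: collapse_leaf_def)
        qed
        then show ?thesis
          by (intro bexI[of _ "{u, v}"]) (auto simp: complex_faces_def)
      qed
      ultimately have "?y \<in> ?P'"
        by (auto simp: complex_points_def)
      then show "(case z of (t, x) \<Rightarrow> \<lambda>w. (1 - t) * ?r x w + t * x w) \<in> ?P'"
        by (simp add: z)
    qed
  qed auto
  ultimately have "?X homotopy_equivalent_space ?X'"
    unfolding homotopy_equivalent_space_def using i r by blast
  then show ?thesis
    using contr homotopy_equivalent_space_contractibility by blast
qed

lemma contractible_single_vertex: "contractible_space (complex_top {v} {})"
proof (rule contractible_space_subset_singleton)
  show "topspace (complex_top {v} {}) \<subseteq> {unit_vec v}"
    by (auto simp: complex_points_def complex_faces_def unit_vec_def fun_eq_iff)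
qed

text \<open>
  The tree grows by one leaf at a time, along edges that leave the set of vertices reached so far.
\<close>

lemma (in graph_complex) contractible_spanning_tree:
  assumes ne: "V \<noteq> {}"
    and conn: "\<And>S. \<lbrakk>S \<subseteq> V; S \<noteq> {}; S \<noteq> V\<rbrakk> \<Longrightarrow> \<exists>u\<in>S. \<exists>v\<in>V - S. {u, v} \<in> E"
  shows "\<exists>F\<subseteq>E. card F + 1 = card V \<and> contractible_space (complex_top V F)"
proof -
  have "\<exists>S F. S \<subseteq> V \<and> F \<subseteq> E \<and> (\<forall>e\<in>F. e \<subseteq> S) \<and> card S = Suc n \<and> card F = n \<and> contractible_space (complex_top S F)"
    if "Suc n \<le> card V" for n
    using that
  proof (induction n)
    case 0
    obtain v where "v \<in> V"
      using ne by blast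
    then show ?case
      by (intro exI[of _ "{v}"] exI[of _ "{}"]) (simp add: contractible_single_vertex)
  next
    case (Suc n)
    then have "Suc n \<le> card V"
      by simp
    from Suc.IH[OF this] obtain S F where S: "S \<subseteq> V" "F \<subseteq> E" "\<forall>e\<in>F. e \<subseteq> S" "card S = Suc n" "card F = n"
      "contractible_space (complex_top S F)"
      by (elim exE conjE) (rule that)
    have fin: "finite S" "finite F"
      using finite_subset[OF S(1) finV] finite_subset[OF S(2) finE] .
    have "S \<noteq> {}" "S \<noteq> V"
      using S(4) Suc.prems by auto
    then obtain u v where uv: "u \<in> S" "v \<in> V - S" "{u, v} \<in> E"
      using conn[OF S(1)] by blast
    have uvF: "{u, v} \<notin> F"
      using S(3) uv(2) by blast
    have "contractible_space (complex_top (insert v S) (insert {u, v} F))"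
      by (rule contractible_attach_leaf[OF fin(1) uv(1) _ _ S(6)]) (use uv S(3) in blast)+
    moreover have "card (insert {u, v} F) = Suc n" "card (insert v S) = Suc (Suc n)"
      using fin S(4,5) uv(2) uvF by simp_all
    moreover have "insert v S \<subseteq> V" "insert {u, v} F \<subseteq> E" "\<forall>e\<in>insert {u, v} F. e \<subseteq> insert v S"
      using S(1-3) uv by blast+
    ultimately show ?case
      by blast
  qed
  note tree = this
  have V1: "Suc (card V - 1) = card V"
    using ne finV by (simp add: card_gt_0_iff)
  from tree[of "card V - 1", unfolded V1, OF order_refl]
  obtain S F where S: "S \<subseteq> V" "F \<subseteq> E" "card S = card V" "card F = card V - 1" "contractible_space (complex_top S F)"
    by (elim exE conjE) (rule that)
  have SV: "S = V"
    by (rule card_subset_eq[OF finV S(1,3)])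
  have "card F + 1 = card V"
    using S(4) V1 by linarith
  then show ?thesis
    using S(2,5) unfolding SV by blast
qed

section \<open>The cells of the symmetric square\<close>

text \<open>
  The edges outside a contractible spanning tree \<open>F\<close> are enumerated as \<open>{a i, w i}\<close> for \<open>i < b\<close>.
\<close>

locale graph_cells = graph_complex V E for V :: "'v set" and E +
  fixes F :: "'v set set" and b :: nat and a w :: "nat \<Rightarrow> 'v" and r :: "'v \<Rightarrow> real"
  assumes F: "F \<subseteq> E" and contr: "contractible_space (complex_top V F)"
    and enum: "bij_betw (\<lambda>i. {a i, w i}) {..<b} (E - F)"
    and r: "r \<in> complex_points V F"
begin

abbreviation \<gamma> where "\<gamma> i t \<equiv> edge_point (a i) (w i) t"
abbreviation T where "T \<equiv> complex_points V F"

lemma ends_edge: "i < b \<Longrightarrow> {a i, w i} \<in> E - F"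
  using enum by (auto simp: bij_betw_def)

lemma ends_neq: "i < b \<Longrightarrow> a i \<noteq> w i"
  using ends_edge[of i] edge[of "{a i, w i}"] by (auto simp: doubleton_eq_iff)

lemma ends_in: "i < b \<Longrightarrow> a i \<in> V \<and> w i \<in> V"
  using ends_edge[of i] edge[of "{a i, w i}"] by (auto simp: doubleton_eq_iff)

lemma ends_inj: "i < b \<Longrightarrow> j < b \<Longrightarrow> {a i, w i} = {a j, w j} \<Longrightarrow> i = j"
  using enum by (auto simp: bij_betw_def inj_on_def)

lemma TE: "T \<subseteq> complex_points V E"
  by (rule complex_points_mono[OF F])

lemma vertex_in_T: "v \<in> V \<Longrightarrow> unit_vec v \<in> T"
  using finV by (auto simp: complex_points_def complex_faces_def unit_vec_def)

lemma \<gamma>_in: "i < b \<Longrightarrow> 0 \<le> t \<Longrightarrow> t \<le> 1 \<Longrightarrow> \<gamma> i t \<in> complex_points V E"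
  using ends_edge[of i] ends_in[of i] finV
  by (auto simp: complex_points_def complex_faces_def edge_point_apply sum.distrib intro!: bexI[of _ "{a i, w i}"])

lemma \<gamma>_in_T:
  assumes i: "i < b" and t: "0 \<le> t" "t \<le> 1"
  shows "\<gamma> i t \<in> T \<longleftrightarrow> t = 0 \<or> t = 1"
proof
  assume T: "\<gamma> i t \<in> T"
  show "t = 0 \<or> t = 1"
  proof (rule ccontr)
    assume n: "\<not> (t = 0 \<or> t = 1)"
    obtain s where s: "s \<in> complex_faces V F" "\<And>v. v \<notin> s \<Longrightarrow> \<gamma> i t v = 0"
      using T by (auto simp: complex_points_def)
    have "a i \<in> s" "w i \<in> s"
      using s(2)[of "a i"] s(2)[of "w i"] n ends_neq[OF i] by (auto simp: edge_point_apply)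
    moreover from this have "s \<in> E"
      using s(1) F ends_neq[OF i] by (auto simp: complex_faces_def)
    ultimately have "s = {a i, w i}"
      using edge[of s] ends_neq[OF i] by auto
    then show False
      using s(1) ends_edge[OF i] ends_neq[OF i] by (auto simp: complex_faces_def)
  qed
next
  assume "t = 0 \<or> t = 1"
  then show "\<gamma> i t \<in> T"
    using ends_in[OF i] vertex_in_T by (auto simp: edge_point_ends)
qed

lemma \<gamma>_inj:
  assumes "i < b" "j < b" "0 < t" "t < 1" "0 < s" "s < 1" "\<gamma> i t = \<gamma> j s"
  shows "i = j \<and> t = s"
proof -
  have "a i = a j \<and> w i = w j \<and> t = s \<or> a i = w j \<and> w i = a j \<and> t = 1 - s"
    using edge_point_eq_iff[OF ends_neq[OF assms(1)] assms(3,4) ends_neq[OF assms(2)] assms(5,6)] assms(7) by blast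
  moreover from this have "i = j"
    using ends_inj[OF assms(1,2)] by (auto simp: insert_commute)
  ultimately show ?thesis
    using ends_neq[OF assms(2)] by auto
qed

lemma point_cases:
  assumes x: "x \<in> complex_points V E" "x \<notin> T"
  shows "\<exists>i t. i < b \<and> 0 < t \<and> t < 1 \<and> x = \<gamma> i t"
proof -
  obtain s where s: "s \<in> complex_faces V E" "\<And>v. v \<notin> s \<Longrightarrow> x v = 0"
    using x(1) by (auto simp: complex_points_def)
  have "s \<notin> complex_faces V F"
    using x s(2) by (auto simp: complex_points_def)
  then have "s \<in> E - F"
    using s(1) by (auto simp: complex_faces_def)
  then obtain i where i: "i < b" "s = {a i, w i}"
    using enum by (auto simp: bij_betw_def image_iff)
  have "(\<Sum>v\<in>V. x v) = (\<Sum>v\<in>{a i, w i}. x v)"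
    using ends_in[OF i(1)] finV s(2) i(2) by (intro sum.mono_neutral_right) auto
  then have sum: "x (a i) + x (w i) = 1"
    using x(1) ends_neq[OF i(1)] by (simp add: complex_points_def)
  then have eq: "x = \<gamma> i (x (w i))"
    using s(2) i(2) ends_neq[OF i(1)] by (auto simp: edge_point_apply fun_eq_iff)
  have "0 \<le> x (w i)" "x (w i) \<le> 1"
    using x(1) point_le_1[OF x(1)] by (auto simp: complex_points_def)
  moreover have "x (w i) \<noteq> 0" "x (w i) \<noteq> 1"
    using \<gamma>_in_T[OF i(1)] eq x(2) calculation by (metis order_refl zero_le_one)+
  ultimately show ?thesis
    using i(1) eq by (intro exI[of _ i] exI[of _ "x (w i)"]) auto
qed

lemma continuous_map_\<gamma>:
  assumes "i < b" "continuous_map Z euclideanreal g" "\<And>z. z \<in> topspace Z \<Longrightarrow> 0 \<le> g z \<and> g z \<le> 1"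
  shows "continuous_map Z Gam (\<lambda>z. \<gamma> i (g z))"
proof (rule continuous_map_into_complex_top)
  show "continuous_map Z euclideanreal (\<lambda>z. \<gamma> i (g z) v)" for v
    unfolding edge_point_def by (intro continuous_intros assms(2)) auto
qed (use \<gamma>_in assms in auto)

lemma continuous_map_upair_pair:
  "continuous_map Z Gam f \<Longrightarrow> continuous_map Z Gam g \<Longrightarrow> continuous_map Z Ysym (\<lambda>z. upair (f z, g z))"
  using continuous_map_compose[OF continuous_map_pairedI continuous_map_upair, of Z Gam f g] by (simp add: o_def)

lemma T_topology: "complex_top V F = subtopology Gam T"
  using TE by (simp add: complex_top_def subtopology_subtopology Int_absorb1)

definition X0 where "X0 = upair ` (tree_square F \<union> diag)"

text \<open>
  \<open>edge_pairs\<close> is the preimage of the 1-skeleton relative to \<open>X0\<close>, and the 1-cells are indexed by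
  the pairs \<open>i \<le> j\<close>: for \<open>i = j\<close> a tree times the edge \<open>i\<close>, for \<open>i < j\<close> the diagonal of the
  square of the edges \<open>i\<close> and \<open>j\<close>.
\<close>

definition edge_pairs where
  "edge_pairs = {(x, y) \<in> complex_points V E \<times> complex_points V E. x \<in> T \<or> y \<in> T \<or> x = y \<or>
     (\<exists>i<b. \<exists>j<b. \<exists>t. 0 < t \<and> t < 1 \<and> x = \<gamma> i t \<and> y = \<gamma> j t)}"

definition X1 where "X1 = upair ` edge_pairs"

definition J1 :: "(nat \<times> nat) set" where "J1 = {(i, j). i \<le> j \<and> j < b}"

definition cell1 :: "nat \<times> nat \<Rightarrow> ('v \<Rightarrow> real) \<times> (nat \<Rightarrow> real) \<Rightarrow> (('v \<Rightarrow> real) \<times> ('v \<Rightarrow> real)) set" where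
  "cell1 = (\<lambda>(i, j) (x, u). if i = j then upair (x, \<gamma> i (u 1)) else upair (\<gamma> i (u 1), \<gamma> j (u 1)))"

text \<open>
  The cells for \<open>i < j\<close> have a one-point fibre; taking the base point \<open>r\<close> of the tree for it gives all
  cells the same type and the same base point.
\<close>

definition fibre1 :: "nat \<times> nat \<Rightarrow> ('v \<Rightarrow> real) topology" where
  "fibre1 = (\<lambda>(i, j). if i = j then complex_top V F else subtopology Gam {r})"

text \<open>
  In the coordinates \<open>s = u 2\<close> and \<open>t = u 1 + u 2\<close> the standard simplex is the triangle
  \<open>0 \<le> s \<le> t \<le> 1\<close>. For \<open>i \<noteq> j\<close>, the square of the edges \<open>i\<close> and \<open>j\<close> is cut along its diagonal into the
  cells \<open>(i, j)\<close> and \<open>(j, i)\<close>; for \<open>i = j\<close>, the square is folded along its diagonal, and the cell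
  \<open>(i, i)\<close> remains.
\<close>

definition cell2 :: "nat \<times> nat \<Rightarrow> unit \<times> (nat \<Rightarrow> real) \<Rightarrow> (('v \<Rightarrow> real) \<times> ('v \<Rightarrow> real)) set" where
  "cell2 = (\<lambda>(i, j) (x, u). upair (\<gamma> i (u 2), \<gamma> j (u 1 + u 2)))"

lemma simplex1: "u \<in> standard_simplex 1 \<longleftrightarrow> 0 \<le> u 1 \<and> u 1 \<le> 1 \<and> u = (\<lambda>i. if i = 0 then 1 - u 1 else if i = 1 then u 1 else 0)"
proof
  assume u: "u \<in> standard_simplex 1"
  then have "0 \<le> u 1" "0 \<le> u 0" "u 0 + u 1 = 1" "u i = 0" if "i > 1" for i
    using that by (auto simp: standard_simplex_iff)
  moreover have "u 0 + u 1 = 1" "0 \<le> u 1" "0 \<le> u 0"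
    using u by (auto simp: standard_simplex_iff)
  ultimately show "0 \<le> u 1 \<and> u 1 \<le> 1 \<and> u = (\<lambda>i. if i = 0 then 1 - u 1 else if i = 1 then u 1 else 0)"
    by (auto simp: fun_eq_iff)
next
  assume h: "0 \<le> u 1 \<and> u 1 \<le> 1 \<and> u = (\<lambda>i. if i = 0 then 1 - u 1 else if i = 1 then u 1 else 0)"
  define t where "t = u 1"
  have "u = (\<lambda>i. if i = 0 then 1 - t else if i = 1 then t else 0)" "0 \<le> t" "t \<le> 1"
    unfolding t_def using h by blast+
  then show "u \<in> standard_simplex 1"
    by (simp add: standard_simplex_iff)
qed

lemma simplex1_eq: "u \<in> standard_simplex 1 \<Longrightarrow> v \<in> standard_simplex 1 \<Longrightarrow> u 1 = v 1 \<Longrightarrow> u = v"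
  using simplex1 by metis

lemma simplex1_bd: "u \<in> standard_simplex 1 \<Longrightarrow> u \<in> simplex_bd 1 \<longleftrightarrow> u 1 = 0 \<or> u 1 = 1"
  by (auto simp: simplex_bd_def standard_simplex_iff le_Suc_eq)

lemma simplex2:
  assumes "u \<in> standard_simplex 2"
  shows "0 \<le> u 2" "u 2 \<le> u 1 + u 2" "u 1 + u 2 \<le> 1" "u 0 = 1 - (u 1 + u 2)"
    "u \<in> simplex_bd 2 \<longleftrightarrow> u 2 = 0 \<or> u 2 = u 1 + u 2 \<or> u 1 + u 2 = 1"
proof -
  have 1: "0 \<le> u 2" "0 \<le> u 1" "0 \<le> u 0" "u 0 + u 1 + u 2 = 1"
    using assms by (auto simp: standard_simplex_iff numeral_2_eq_2)
  then show "0 \<le> u 2" "u 2 \<le> u 1 + u 2" "u 1 + u 2 \<le> 1" "u 0 = 1 - (u 1 + u 2)"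
    by linarith+
  have "(\<exists>i\<le>2. u i = 0) \<longleftrightarrow> u 0 = 0 \<or> u 1 = 0 \<or> u 2 = 0"
    by (auto simp: numeral_2_eq_2 le_Suc_eq)
  then show "u \<in> simplex_bd 2 \<longleftrightarrow> u 2 = 0 \<or> u 2 = u 1 + u 2 \<or> u 1 + u 2 = 1"
    using assms 1 by (auto simp: simplex_bd_def)
qed

lemma simplex2_eq:
  assumes "u \<in> standard_simplex 2" "v \<in> standard_simplex 2" "u 2 = v 2" "u 1 + u 2 = v 1 + v 2"
  shows "u = v"
proof
  fix i :: nat
  have "i = 0 \<or> i = 1 \<or> i = 2 \<or> i > 2"
    by linarith
  then show "u i = v i"
    using assms simplex2(4)[OF assms(1)] simplex2(4)[OF assms(2)] by (auto simp: standard_simplex_iff)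
qed

lemma X0_iff: "upair (x, y) \<in> X0 \<longleftrightarrow> x \<in> T \<and> y \<in> T \<or> x = y \<and> x \<in> complex_points V E"
  unfolding X0_def by (subst upair_in_symmetric) (auto simp: tree_square_def diag_def)

lemma edge_pairs_swap: "z \<in> edge_pairs \<Longrightarrow> prod.swap z \<in> edge_pairs"
  by (cases z) (auto simp: edge_pairs_def)

lemma X1_iff: "upair (x, y) \<in> X1 \<longleftrightarrow> (x, y) \<in> edge_pairs"
  unfolding X1_def by (rule upair_in_symmetric) (rule edge_pairs_swap)

lemma X0_X1: "X0 \<subseteq> X1"
  using TE unfolding X0_def X1_def by (intro image_mono) (auto simp: tree_square_def diag_def edge_pairs_def)

lemma X1_Y: "X1 \<subseteq> topspace Ysym"
  unfolding X1_def topspace_Ysym by (intro image_mono) (auto simp: edge_pairs_def)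

lemma closedin_T: "closedin Gam T"
proof -
  interpret T: graph_complex V F
    using finV edge F by unfold_locales auto
  have "compactin Gam T"
    using T.compact_space_complex_top unfolding T_topology
    by (simp add: compact_space_subtopology compactin_subtopology compact_space_def Int_absorb1 TE)
  then show ?thesis
    by (rule compactin_imp_closedin[OF Hausdorff_space_complex_top])
qed

lemma closedin_X0: "closedin Ysym X0"
  unfolding X0_def tree_square_def
  by (intro closedin_upair_image closedin_Un closedin_diag) (simp add: closedin_prod_Times_iff closedin_T)

lemma fibre1: "j \<in> J1 \<Longrightarrow> compact_space (fibre1 j) \<and> contractible_space (fibre1 j) \<and> r \<in> topspace (fibre1 j)"
proof -
  interpret T: graph_complex V F
    using finV edge F by unfold_locales auto
  show "j \<in> J1 \<Longrightarrow> ?thesis"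
    using T.compact_space_complex_top contr r TE
    by (auto simp: fibre1_def compact_space_subtopology compactin_sing split: prod.splits)
qed

lemma topspace_fibre1: "topspace (fibre1 (i, j)) = (if i = j then T else {r})"
  using r TE by (auto simp: fibre1_def)

lemma continuous_map_cell1:
  assumes "j \<in> J1"
  shows "continuous_map (prod_topology (fibre1 j) (simplex_top 1)) Ysym (cell1 j)"
proof -
  obtain i k where j: "j = (i, k)" "i \<le> k" "k < b"
    using assms by (auto simp: J1_def)
  let ?Z = "prod_topology (fibre1 j) (simplex_top 1)"
  have u: "continuous_map ?Z euclideanreal (\<lambda>z. snd z 1)"
    using continuous_map_compose[OF continuous_map_snd continuous_map_simplex_coordinate] by (simp add: o_def)
  have u01: "0 \<le> snd z 1 \<and> snd z 1 \<le> 1" if "z \<in> topspace ?Z" for z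
    using that simplex1[of "snd z"] by auto
  have x: "continuous_map ?Z Gam fst"
  proof -
    have "continuous_map (prod_topology (subtopology Gam A) (simplex_top 1)) Gam fst" for A
      by (rule continuous_map_into_fulltopology[OF continuous_map_fst])
    from this[of T] this[of "{r}"] show ?thesis
      by (simp add: fibre1_def j T_topology)
  qed
  have "continuous_map ?Z Gam (\<lambda>z. \<gamma> i (snd z 1))" "continuous_map ?Z Gam (\<lambda>z. \<gamma> k (snd z 1))"
    using j by (intro continuous_map_\<gamma> u u01; simp)+
  then show ?thesis
    using continuous_map_upair_pair[OF x] continuous_map_upair_pair
    by (cases "i = k") (simp_all add: cell1_def j case_prod_unfold)
qed

lemma cover1: "X1 = X0 \<union> (\<Union>j\<in>J1. cell1 j ` (topspace (fibre1 j) \<times> standard_simplex 1))"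
proof
  define e :: "real \<Rightarrow> nat \<Rightarrow> real" where "e t = (\<lambda>i. if i = 0 then 1 - t else if i = 1 then t else 0)" for t
  have e: "e t \<in> standard_simplex 1" "e t 1 = t" if "0 \<le> t" "t \<le> 1" for t
    using that simplex1[of "e t"] by (auto simp: e_def)
  have one: "upair (x, \<gamma> i t) \<in> (\<Union>j\<in>J1. cell1 j ` (topspace (fibre1 j) \<times> standard_simplex 1))"
    if "x \<in> T" "i < b" "0 < t" "t < 1" for x i t
    using that e[of t] by (intro UN_I[of "(i, i)"] image_eqI[of _ _ "(x, e t)"]) (auto simp: J1_def cell1_def topspace_fibre1)
  have two: "upair (\<gamma> i t, \<gamma> j t) \<in> (\<Union>j\<in>J1. cell1 j ` (topspace (fibre1 j) \<times> standard_simplex 1))"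
    if "i < j" "j < b" "0 < t" "t < 1" for i j t
    using that e[of t] by (intro UN_I[of "(i, j)"] image_eqI[of _ _ "(r, e t)"]) (auto simp: J1_def cell1_def topspace_fibre1)
  show "X1 \<subseteq> X0 \<union> (\<Union>j\<in>J1. cell1 j ` (topspace (fibre1 j) \<times> standard_simplex 1))"
  proof
    fix c assume "c \<in> X1"
    then obtain x y where c: "c = upair (x, y)" and xy: "(x, y) \<in> edge_pairs"
      by (auto simp: X1_def)
    have pts: "x \<in> complex_points V E" "y \<in> complex_points V E"
      using xy by (auto simp: edge_pairs_def)
    consider "x \<in> T" "y \<in> T" | "x = y" | "x \<in> T" "y \<notin> T" | "y \<in> T" "x \<notin> T"
      | i j t where "i < b" "j < b" "0 < t" "t < 1" "x = \<gamma> i t" "y = \<gamma> j t"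
      using xy unfolding edge_pairs_def by blast
    then show "c \<in> X0 \<union> (\<Union>j\<in>J1. cell1 j ` (topspace (fibre1 j) \<times> standard_simplex 1))"
    proof cases
      case 3
      then show ?thesis
        using point_cases[OF pts(2)] one by (auto simp: c)
    next
      case 4
      then show ?thesis
        using point_cases[OF pts(1)] one by (auto simp: c upair_commute[of x y])
    next
      case 5
      then consider "i = j" | "i < j" | "j < i"
        by linarith
      then show ?thesis
      proof cases
        case 1
        then show ?thesis
          using 5 pts by (simp add: c X0_iff)
      next
        case 2
        then show ?thesis
          using 5 two by (simp add: c)
      next
        case 3
        then show ?thesis
          using 5 two[of j i t] by (simp add: c upair_commute[of "\<gamma> i t" "\<gamma> j t"])
      qed
    qed (use pts in \<open>auto simp: c X0_iff\<close>)
  qed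
  have "cell1 (i, j) (x, u) \<in> X1" if "i \<le> j" "j < b" "x \<in> topspace (fibre1 (i, j))" "u \<in> standard_simplex 1" for i j x u
  proof -
    have u: "0 \<le> u 1" "u 1 \<le> 1"
      using simplex1[of u] that(4) by auto
    have x: "x \<in> complex_points V E"
      using that r TE by (auto simp: topspace_fibre1 split: if_splits)
    show ?thesis
    proof (cases "i = j")
      case True
      then show ?thesis
        using that u x \<gamma>_in by (auto simp: cell1_def X1_iff edge_pairs_def topspace_fibre1)
    next
      case False
      have ib: "i < b"
        using that by simp
      have "\<gamma> i (u 1) \<in> T \<or> (\<exists>i'<b. \<exists>j'<b. \<exists>t. 0 < t \<and> t < 1 \<and> \<gamma> i (u 1) = \<gamma> i' t \<and> \<gamma> j (u 1) = \<gamma> j' t)"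
      proof (cases "u 1 = 0 \<or> u 1 = 1")
        case True
        then show ?thesis
          using \<gamma>_in_T[OF ib u] by simp
      next
        case False
        then have "0 < u 1 \<and> u 1 < 1"
          using u by auto
        then show ?thesis
          using ib that(2) by blast
      qed
      then have "(\<gamma> i (u 1), \<gamma> j (u 1)) \<in> edge_pairs"
        using \<gamma>_in[OF ib u] \<gamma>_in[OF that(2) u] unfolding edge_pairs_def by blast
      then show ?thesis
        using False by (simp add: cell1_def X1_iff)
    qed
  qed
  then show "X0 \<union> (\<Union>j\<in>J1. cell1 j ` (topspace (fibre1 j) \<times> standard_simplex 1)) \<subseteq> X1"
    using X0_X1 by (auto simp: J1_def)
qed

lemma cell1_bd:
  assumes "j \<in> J1" "x \<in> topspace (fibre1 j)" "u \<in> standard_simplex 1"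
  shows "cell1 j (x, u) \<in> X0 \<longleftrightarrow> u \<in> simplex_bd 1"
proof -
  obtain i k where j: "j = (i, k)" "i \<le> k" "k < b"
    using assms by (auto simp: J1_def)
  have u: "0 \<le> u 1" "u 1 \<le> 1"
    using simplex1[of u] assms by auto
  have g: "\<gamma> i (u 1) \<in> T \<longleftrightarrow> u 1 = 0 \<or> u 1 = 1" "\<gamma> k (u 1) \<in> T \<longleftrightarrow> u 1 = 0 \<or> u 1 = 1"
    using \<gamma>_in_T u j by auto
  show ?thesis
  proof (cases "i = k")
    case True
    then have "x \<in> T"
      using assms(2) by (simp add: j topspace_fibre1)
    then show ?thesis
      using True g TE by (auto simp: j cell1_def X0_iff simplex1_bd[OF assms(3)] simp del: One_nat_def)
  next
    case False
    have "\<gamma> i (u 1) \<noteq> \<gamma> k (u 1)" if "0 < u 1" "u 1 < 1"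
      using \<gamma>_inj[of i k "u 1" "u 1"] that j False by auto
    then show ?thesis
      using False g u by (auto simp: j cell1_def X0_iff simplex1_bd[OF assms(3)] simp del: One_nat_def)
  qed
qed

lemma cell1_inj:
  assumes j: "j \<in> J1" and j': "j' \<in> J1" and x: "x \<in> topspace (fibre1 j)" and x': "x' \<in> topspace (fibre1 j')"
    and u: "u \<in> standard_simplex 1 - simplex_bd 1" and u': "u' \<in> standard_simplex 1 - simplex_bd 1"
    and eq: "cell1 j (x, u) = cell1 j' (x', u')"
  shows "j = j' \<and> x = x' \<and> u = u'"
proof -
  obtain i k where ik: "j = (i, k)" "i \<le> k" "k < b"
    using j by (auto simp: J1_def)
  obtain i' k' where ik': "j' = (i', k')" "i' \<le> k'" "k' < b"
    using j' by (auto simp: J1_def)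
  have t: "0 < u 1" "u 1 < 1" and t': "0 < u' 1" "u' 1 < 1"
    using u u' simplex1[of u] simplex1[of u'] simplex1_bd[of u] simplex1_bd[of u'] by (auto simp: less_le)
  have nT: "\<gamma> m (u 1) \<notin> T" "\<gamma> m (u' 1) \<notin> T" if "m < b" for m
    using \<gamma>_in_T[OF that] t t' by auto
  have inj: "m = n \<and> u 1 = u' 1" if "m < b" "n < b" "\<gamma> m (u 1) = \<gamma> n (u' 1)" for m n
    using \<gamma>_inj[OF that(1,2) t t' that(3)] .
  have uu: "u = u'" if "u 1 = u' 1"
    using simplex1_eq[of u u'] u u' that by auto
  have lt: "i < b" "i' < b"
    using ik ik' by auto
  show ?thesis
  proof (cases "i = k"; cases "i' = k'")
    assume c: "i = k" "i' = k'"
    then have "x \<in> T" "x' \<in> T" and "upair (x, \<gamma> i (u 1)) = upair (x', \<gamma> i' (u' 1))"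
      using x x' eq by (auto simp: ik ik' cell1_def topspace_fibre1)
    then show ?thesis
      using inj[of i i'] nT[of i] nT[of i'] lt c uu by (auto simp: upair_eq_iff ik ik')
  next
    assume c: "i = k" "i' \<noteq> k'"
    then have "x \<in> T" and "upair (x, \<gamma> i (u 1)) = upair (\<gamma> i' (u' 1), \<gamma> k' (u' 1))"
      using x eq by (auto simp: ik ik' cell1_def topspace_fibre1)
    then show ?thesis
      using nT[of i'] nT[of k'] lt ik' by (auto simp: upair_eq_iff)
  next
    assume c: "i \<noteq> k" "i' = k'"
    then have "x' \<in> T" and "upair (\<gamma> i (u 1), \<gamma> k (u 1)) = upair (x', \<gamma> i' (u' 1))"
      using x' eq by (auto simp: ik ik' cell1_def topspace_fibre1)
    then show ?thesis
      using nT[of i] nT[of k] lt ik by (auto simp: upair_eq_iff)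
  next
    assume c: "i \<noteq> k" "i' \<noteq> k'"
    then have xr: "x = r" "x' = r" and "upair (\<gamma> i (u 1), \<gamma> k (u 1)) = upair (\<gamma> i' (u' 1), \<gamma> k' (u' 1))"
      using x x' eq by (auto simp: ik ik' cell1_def topspace_fibre1)
    then consider "\<gamma> i (u 1) = \<gamma> i' (u' 1)" "\<gamma> k (u 1) = \<gamma> k' (u' 1)" | "\<gamma> i (u 1) = \<gamma> k' (u' 1)" "\<gamma> k (u 1) = \<gamma> i' (u' 1)"
      by (auto simp: upair_eq_iff)
    then show ?thesis
    proof cases
      case 1
      then show ?thesis
        using inj[of i i'] inj[of k k'] lt ik ik' uu xr by auto
    next
      case 2
      then have "i = k'" "k = i'"
        using inj[of i k'] inj[of k i'] lt ik ik' by auto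
      then show ?thesis
        using ik ik' c by auto
    qed
  qed
qed

definition chain1 :: "nat \<times> nat \<Rightarrow> (('v \<Rightarrow> real) \<times> ('v \<Rightarrow> real)) set chain" where
  "chain1 j = frag_of (restrict (\<lambda>u. cell1 j (r, u)) (standard_simplex 1))"

lemma finite_J1: "finite J1"
  by (rule finite_subset[of _ "{..b} \<times> {..b}"]) (auto simp: J1_def)

lemma homology_X1:
  "rel_basis 1 (subtopology Ysym X1) X0 J1 chain1 \<and> (\<forall>q. q \<noteq> 1 \<longrightarrow> rel_acyclic q (subtopology Ysym X1) X0)"
  unfolding chain1_def
proof (rule homology_attach_cells[OF finite_J1, where S = fibre1])
  have top: "topspace (subtopology Ysym X1) = X1"
    using X1_Y by auto
  show "Hausdorff_space (subtopology Ysym X1)"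
    by (rule Hausdorff_space_subtopology[OF Hausdorff_Ysym])
  show "closedin (subtopology Ysym X1) X0"
    using closedin_X0 X0_X1 by (metis closedin_subset_topspace)
  show "topspace (subtopology Ysym X1) = X0 \<union> (\<Union>j\<in>J1. cell1 j ` (topspace (fibre1 j) \<times> standard_simplex 1))"
    unfolding top by (rule cover1)
  show "continuous_map (prod_topology (fibre1 j) (simplex_top 1)) (subtopology Ysym X1) (cell1 j)" if "j \<in> J1" for j
    unfolding continuous_map_in_subtopology
  proof
    show "cell1 j \<in> topspace (prod_topology (fibre1 j) (simplex_top 1)) \<rightarrow> X1"
      using that unfolding cover1 by auto
  qed (rule continuous_map_cell1[OF that])
  show "inj_on (cell1 j) (topspace (fibre1 j) \<times> (standard_simplex 1 - simplex_bd 1))" if "j \<in> J1" for j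
    using cell1_inj[OF that that] by (auto simp: inj_on_def)
  show "i = j" if "i \<in> J1" "j \<in> J1" "x \<in> topspace (fibre1 i)" "y \<in> topspace (fibre1 j)"
    "u \<in> standard_simplex 1 - simplex_bd 1" "v \<in> standard_simplex 1 - simplex_bd 1" "cell1 i (x, u) = cell1 j (y, v)"
    for i j x u y v
    using cell1_inj[OF that] by blast
qed (use fibre1 cell1_bd in auto)

definition J2 :: "(nat \<times> nat) set" where "J2 = {..<b} \<times> {..<b}"

definition chain2 :: "nat \<times> nat \<Rightarrow> (('v \<Rightarrow> real) \<times> ('v \<Rightarrow> real)) set chain" where
  "chain2 j = frag_of (restrict (\<lambda>u. cell2 j ((), u)) (standard_simplex 2))"

lemma continuous_map_cell2:
  assumes "j \<in> J2"
  shows "continuous_map (prod_topology (discrete_topology {()}) (simplex_top 2)) Ysym (cell2 j)"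
proof -
  obtain i k where j: "j = (i, k)" "i < b" "k < b"
    using assms by (auto simp: J2_def)
  let ?Z = "prod_topology (discrete_topology {()}) (simplex_top 2)"
  have u: "continuous_map ?Z euclideanreal (\<lambda>z. snd z m)" for m
    using continuous_map_compose[OF continuous_map_snd continuous_map_simplex_coordinate] by (simp add: o_def)
  have u01: "0 \<le> snd z 2" "snd z 2 \<le> snd z 1 + snd z 2" "snd z 1 + snd z 2 \<le> 1" if "z \<in> topspace ?Z" for z
    using that simplex2[of "snd z"] by auto
  have "continuous_map ?Z Gam (\<lambda>z. \<gamma> i (snd z 2))"
    using u01 by (intro continuous_map_\<gamma>[OF j(2)] u) force
  moreover have "continuous_map ?Z Gam (\<lambda>z. \<gamma> k (snd z 1 + snd z 2))"
    using u01 by (intro continuous_map_\<gamma>[OF j(3)] continuous_map_add u) force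
  ultimately show ?thesis
    using continuous_map_upair_pair by (simp add: cell2_def j case_prod_unfold)
qed

lemma cell2_bd:
  assumes "j \<in> J2" "u \<in> standard_simplex 2"
  shows "cell2 j (x, u) \<in> X1 \<longleftrightarrow> u \<in> simplex_bd 2"
proof -
  obtain i k where j: "j = (i, k)" "i < b" "k < b"
    using assms by (auto simp: J2_def)
  let ?s = "u 2" and ?t = "u 1 + u 2"
  have st: "0 \<le> ?s" "?s \<le> ?t" "?t \<le> 1" and bd: "u \<in> simplex_bd 2 \<longleftrightarrow> ?s = 0 \<or> ?s = ?t \<or> ?t = 1"
    using simplex2[OF assms(2)] by auto
  have pts: "\<gamma> i ?s \<in> complex_points V E" "\<gamma> k ?t \<in> complex_points V E"
    using st by (auto intro!: \<gamma>_in j)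
  have gT: "\<gamma> i ?s \<in> T \<longleftrightarrow> ?s = 0 \<or> ?s = 1" "\<gamma> k ?t \<in> T \<longleftrightarrow> ?t = 0 \<or> ?t = 1"
    using st j \<gamma>_in_T[of i ?s] \<gamma>_in_T[of k ?t] by auto
  have "(\<gamma> i ?s, \<gamma> k ?t) \<in> edge_pairs \<longleftrightarrow> ?s = 0 \<or> ?s = ?t \<or> ?t = 1"
  proof
    assume e: "(\<gamma> i ?s, \<gamma> k ?t) \<in> edge_pairs"
    show "?s = 0 \<or> ?s = ?t \<or> ?t = 1"
    proof (rule ccontr)
      assume n: "\<not> (?s = 0 \<or> ?s = ?t \<or> ?t = 1)"
      then have in01: "0 < ?s" "?s < 1" "0 < ?t" "?t < 1"
        using st by auto
      then consider "\<gamma> i ?s = \<gamma> k ?t"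
        | m l t where "m < b" "l < b" "0 < t" "t < 1" "\<gamma> i ?s = \<gamma> m t" "\<gamma> k ?t = \<gamma> l t"
        using e gT unfolding edge_pairs_def by auto
      then show False
      proof cases
        case 1
        then show ?thesis
          using \<gamma>_inj[OF j(2,3) in01] n by auto
      next
        case 2
        then show ?thesis
          using \<gamma>_inj[OF j(2) 2(1) in01(1,2) 2(3,4)] \<gamma>_inj[OF j(3) 2(2) in01(3,4) 2(3,4)] n by auto
      qed
    qed
  next
    assume "?s = 0 \<or> ?s = ?t \<or> ?t = 1"
    then consider "?s = 0 \<or> ?s = 1 \<or> ?t = 1" | "?s = ?t" "0 < ?s" "?s < 1"
      using st by force
    then show "(\<gamma> i ?s, \<gamma> k ?t) \<in> edge_pairs"
    proof cases
      case 1
      then show ?thesis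
        using pts gT unfolding edge_pairs_def by auto
    next
      case 2
      have "(\<gamma> i ?s, \<gamma> k ?s) \<in> edge_pairs"
        using 2 pts j unfolding edge_pairs_def by auto
      then show ?thesis
        using 2(1) by simp
    qed
  qed
  then show ?thesis
    by (simp add: j cell2_def X1_iff bd)
qed

lemma cell2_inj:
  assumes j: "j \<in> J2" and j': "j' \<in> J2"
    and u: "u \<in> standard_simplex 2 - simplex_bd 2" and u': "u' \<in> standard_simplex 2 - simplex_bd 2"
    and eq: "cell2 j (x, u) = cell2 j' (x', u')"
  shows "j = j' \<and> u = u'"
proof -
  obtain i k where ik: "j = (i, k)" "i < b" "k < b"
    using j by (auto simp: J2_def)
  obtain i' k' where ik': "j' = (i', k')" "i' < b" "k' < b"
    using j' by (auto simp: J2_def)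
  let ?s = "u 2" and ?t = "u 1 + u 2" and ?s' = "u' 2" and ?t' = "u' 1 + u' 2"
  have st: "0 < ?s" "?s < ?t" "?t < 1" and st': "0 < ?s'" "?s' < ?t'" "?t' < 1"
    using simplex2[of u] simplex2[of u'] u u' by (auto simp: less_le)
  then have l: "?s < 1" "0 < ?t" "?s' < 1" "0 < ?t'"
    by auto
  have "\<gamma> i ?s = \<gamma> i' ?s' \<and> \<gamma> k ?t = \<gamma> k' ?t' \<or> \<gamma> i ?s = \<gamma> k' ?t' \<and> \<gamma> k ?t = \<gamma> i' ?s'"
    using eq by (auto simp: ik ik' cell2_def upair_eq_iff)
  then show ?thesis
  proof
    assume "\<gamma> i ?s = \<gamma> i' ?s' \<and> \<gamma> k ?t = \<gamma> k' ?t'"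
    then have "i = i' \<and> ?s = ?s'" "k = k' \<and> ?t = ?t'"
      using \<gamma>_inj[OF ik(2) ik'(2) st(1) l(1) st'(1) l(3)] \<gamma>_inj[OF ik(3) ik'(3) l(2) st(3) l(4) st'(3)] by auto
    then show ?thesis
      using simplex2_eq[of u u'] u u' ik ik' by auto
  next
    assume "\<gamma> i ?s = \<gamma> k' ?t' \<and> \<gamma> k ?t = \<gamma> i' ?s'"
    then have "?s = ?t'" "?t = ?s'"
      using \<gamma>_inj[OF ik(2) ik'(3) st(1) l(1) l(4) st'(3)] \<gamma>_inj[OF ik(3) ik'(2) l(2) st(3) st'(1) l(3)] by auto
    then show ?thesis
      using st st' by auto
  qed
qed

lemma cover2: "topspace Ysym = X1 \<union> (\<Union>j\<in>J2. cell2 j ` (topspace (discrete_topology {()}) \<times> standard_simplex 2))"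
proof
  define e :: "real \<Rightarrow> real \<Rightarrow> nat \<Rightarrow> real" where
    "e s t = (\<lambda>i. if i = 0 then 1 - t else if i = 1 then t - s else if i = 2 then s else 0)" for s t
  have e: "e s t \<in> standard_simplex 2" "e s t 2 = s" "e s t 1 + e s t 2 = t" if "0 \<le> s" "s \<le> t" "t \<le> 1" for s t
    using that by (auto simp: e_def standard_simplex_iff numeral_2_eq_2)
  have cell: "upair (\<gamma> i s, \<gamma> j t) \<in> (\<Union>j\<in>J2. cell2 j ` (topspace (discrete_topology {()}) \<times> standard_simplex 2))"
    if "i < b" "j < b" "0 \<le> s" "s \<le> t" "t \<le> 1" for i j s t
    using that e[of s t] by (intro UN_I[of "(i, j)"] image_eqI[of _ _ "((), e s t)"]) (auto simp: J2_def cell2_def)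
  show "topspace Ysym \<subseteq> X1 \<union> (\<Union>j\<in>J2. cell2 j ` (topspace (discrete_topology {()}) \<times> standard_simplex 2))"
  proof
    fix c assume "c \<in> topspace Ysym"
    then obtain x y where c: "c = upair (x, y)" and pts: "x \<in> complex_points V E" "y \<in> complex_points V E"
      by (auto simp: topspace_Ysym)
    show "c \<in> X1 \<union> (\<Union>j\<in>J2. cell2 j ` (topspace (discrete_topology {()}) \<times> standard_simplex 2))"
    proof (cases "x \<in> T \<or> y \<in> T")
      case True
      then show ?thesis
        using pts by (auto simp: c X1_iff edge_pairs_def)
    next
      case False
      then obtain i s j t where "i < b" "0 < s" "s < 1" "x = \<gamma> i s" "j < b" "0 < t" "t < 1" "y = \<gamma> j t"
        using point_cases[OF pts(1)] point_cases[OF pts(2)] by blast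
      then have "upair (\<gamma> i s, \<gamma> j t) \<in> (\<Union>j\<in>J2. cell2 j ` (topspace (discrete_topology {()}) \<times> standard_simplex 2))"
        using cell[of i j s t] cell[of j i t s] upair_commute[of "\<gamma> i s" "\<gamma> j t"] by (cases "s \<le> t") simp_all
      then show ?thesis
        using \<open>x = \<gamma> i s\<close> \<open>y = \<gamma> j t\<close> c by blast
    qed
  qed
  have "cell2 j z \<in> topspace Ysym" if "j \<in> J2" "z \<in> topspace (discrete_topology {()}) \<times> standard_simplex 2" for j z
    using continuous_map_image_subset_topspace[OF continuous_map_cell2[OF that(1)]] that(2) by auto
  then show "X1 \<union> (\<Union>j\<in>J2. cell2 j ` (topspace (discrete_topology {()}) \<times> standard_simplex 2)) \<subseteq> topspace Ysym"
    using X1_Y by blast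
qed

lemma closedin_X1: "closedin Ysym X1"
proof -
  have "closedin Ysym (cell1 j ` (topspace (fibre1 j) \<times> standard_simplex 1))" if "j \<in> J1" for j
  proof -
    have "compact_space (prod_topology (fibre1 j) (simplex_top 1))"
      using fibre1[OF that] by (simp add: compact_space_prod_topology compact_space_simplex_top)
    then have "compactin Ysym (cell1 j ` topspace (prod_topology (fibre1 j) (simplex_top 1)))"
      unfolding compact_space_def by (rule image_compactin[OF _ continuous_map_cell1[OF that]])
    then show ?thesis
      using compactin_imp_closedin[OF Hausdorff_Ysym] by simp
  qed
  then show ?thesis
    unfolding cover1 using finite_J1 by (intro closedin_Un closedin_X0 closedin_Union) auto
qed

lemma homology_X2:
  "rel_basis 2 Ysym X1 J2 chain2 \<and> (\<forall>q. q \<noteq> 2 \<longrightarrow> rel_acyclic q Ysym X1)"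
  unfolding chain2_def
proof (rule homology_attach_cells[where S = "\<lambda>_. discrete_topology {()}"])
  show "finite J2"
    by (simp add: J2_def)
  show "topspace Ysym = X1 \<union> (\<Union>j\<in>J2. cell2 j ` (topspace (discrete_topology {()}) \<times> standard_simplex 2))"
    by (rule cover2)
  show "inj_on (cell2 j) (topspace (discrete_topology {()}) \<times> (standard_simplex 2 - simplex_bd 2))" if "j \<in> J2" for j
    using cell2_inj[OF that that] by (auto simp: inj_on_def)
  show "i = j" if "i \<in> J2" "j \<in> J2" "x \<in> topspace (discrete_topology {()})" "y \<in> topspace (discrete_topology {()})"
    "u \<in> standard_simplex 2 - simplex_bd 2" "v \<in> standard_simplex 2 - simplex_bd 2" "cell2 i (x, u) = cell2 j (y, v)"
    for i j x u y v
    using cell2_inj[OF that(1,2,5,6,7)] by blast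
qed (use Hausdorff_Ysym closedin_X1 continuous_map_cell2 cell2_bd in \<open>auto simp: compact_space_discrete_topology\<close>)

end

section \<open>Homology of a two-step filtration with free layers\<close>

text \<open>
  Let \<open>C \<subseteq> A \<subseteq> X\<close>, where \<open>(A, C)\<close> has homology only in degree 1, with basis \<open>d\<close>, and \<open>(X, A)\<close> only
  in degree 2, with basis \<open>s\<close>, and let \<open>M\<close> be the matrix of the boundary map between them. Then the
  homology of \<open>(X, C)\<close> is the kernel and the cokernel of \<open>M\<close>.
\<close>

lemma chain_comb_comb:
  assumes "finite J" "finite I"
  shows "chain_comb J a (\<lambda>j. chain_comb I (M j) d) = chain_comb I (\<lambda>i. \<Sum>j\<in>J. a j * M j i) d"
proof (rule poly_mapping_eqI)
  fix f
  show "Poly_Mapping.lookup (chain_comb J a (\<lambda>j. chain_comb I (M j) d)) f =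
      Poly_Mapping.lookup (chain_comb I (\<lambda>i. \<Sum>j\<in>J. a j * M j i) d) f"
    by (simp add: chain_comb_def lookup_sum sum_distrib_left sum_distrib_right mult.assoc)
      (rule sum.swap)
qed

lemma chain_comb_add: "chain_comb J (\<lambda>j. a j + b j) z = chain_comb J a z + chain_comb J b z"
  by (simp add: chain_comb_def frag_cmul_distrib sum.distrib)

lemma chain_comb_add2: "chain_comb J a (\<lambda>j. z j + y j) = chain_comb J a z + chain_comb J a y"
  by (simp add: chain_comb_def frag_cmul_distrib2 sum.distrib)

lemma chain_comb_minus: "chain_comb J (\<lambda>j. - a j) z = - chain_comb J a z"
proof (rule poly_mapping_eqI)
  fix f show "Poly_Mapping.lookup (chain_comb J (\<lambda>j. - a j) z) f = Poly_Mapping.lookup (- chain_comb J a z) f"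
    by (simp add: chain_comb_def lookup_sum sum_negf)
qed

lemma chain_comb_zero: "(\<And>j. j \<in> J \<Longrightarrow> a j = 0) \<Longrightarrow> chain_comb J a z = 0"
  by (simp add: chain_comb_def)

lemma singular_chain_comb: "(\<And>j. j \<in> J \<Longrightarrow> singular_chain p X (z j)) \<Longrightarrow> singular_chain p X (chain_comb J a z)"
  unfolding chain_comb_def by (intro singular_chain_sum singular_chain_cmul)

lemma move_terms:
  fixes x y h :: "'a :: ab_group_add"
  assumes "x - y + h = 0"
  shows "h = y + - x"
proof -
  have "h = (x - y + h) + (y + - x)"
    by (simp add: algebra_simps)
  then show ?thesis
    using assms by simp
qed

locale two_step_filtration =
  fixes X :: "'a topology" and A C :: "'a set" and I :: "'i set" and J :: "'j set"
    and d :: "'i \<Rightarrow> 'a chain" and s :: "'j \<Rightarrow> 'a chain" and M :: "'j \<Rightarrow> 'i \<Rightarrow> int"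
  assumes CA: "C \<subseteq> A" and d: "rel_basis 1 (subtopology X A) C I d" and s: "rel_basis 2 X A J s"
    and acycC: "\<And>q. q \<noteq> 1 \<Longrightarrow> rel_acyclic q (subtopology X A) C"
    and acycA: "\<And>q. q \<noteq> 2 \<Longrightarrow> rel_acyclic q X A"
    and M: "\<And>j. j \<in> J \<Longrightarrow> homologous_rel 1 (subtopology X A) C (chain_boundary 2 (s j)) (chain_comb I (M j) d)"
begin

lemma finI: "finite I" and finJ: "finite J"
  using d s by (simp_all add: rel_basis_def)

abbreviation bdry :: "('j \<Rightarrow> int) \<Rightarrow> 'i \<Rightarrow> int" where
  "bdry a \<equiv> \<lambda>i. \<Sum>j\<in>J. a j * M j i"

lemma s_relcycle: "singular_relcycle 2 X A (chain_comb J a s)"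
  using s by (intro singular_relcycle_comb) (auto simp: rel_basis_def)

lemma d_relcycle_sub: "singular_relcycle 1 (subtopology X A) C (chain_comb I c d)"
  using d by (intro singular_relcycle_comb) (auto simp: rel_basis_def)

lemma relcycle_sub: "singular_relcycle p (subtopology X A) C e \<Longrightarrow> singular_relcycle p X C e"
  unfolding singular_relcycle sub_chain[OF CA] using singular_chain_subtopology_in[of p X A e] by blast

lemma bdry_homologous:
  "homologous_rel 1 (subtopology X A) C (chain_boundary 2 (chain_comb J a s)) (chain_comb I (bdry a) d)"
  unfolding chain_boundary_comb chain_comb_comb[OF finJ finI, symmetric]
  by (rule homologous_rel_comb[OF finJ M])

lemma rel_acyclic_filtration: "q \<noteq> 1 \<Longrightarrow> q \<noteq> 2 \<Longrightarrow> rel_acyclic q X C"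
  by (rule rel_acyclic_triple_trans[OF CA acycC acycA])

lemma degree1_span:
  assumes c: "singular_relcycle 1 X C c"
  shows "\<exists>a. homologous_rel 1 X C c (chain_comb I a d)"
proof -
  have cA: "singular_relcycle 1 X A c"
    using c singular_chain_mono[OF _ CA] by (auto simp: singular_relcycle)
  then obtain g e where g: "singular_chain (Suc 1) X g" and e: "singular_chain 1 (subtopology X A) e"
    and ge: "chain_boundary (Suc 1) g = c + e"
    using acycA[of 1] unfolding rel_acyclic_def singular_relboundary_alt by auto
  have "chain_boundary 1 c + chain_boundary 1 e = 0"
    using chain_boundary_boundary_alt[OF g] by (simp only: ge chain_boundary_add)
  then have "chain_boundary 1 (- e) = chain_boundary 1 c"
    by (metis chain_boundary_minus eq_neg_iff_add_eq_0)
  then have "singular_relcycle 1 (subtopology X A) C (- e)"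
    using c e unfolding singular_relcycle sub_chain[OF CA] by (simp add: singular_chain_minus)
  then obtain a where "homologous_rel 1 (subtopology X A) C (- e) (chain_comb I a d)"
    using d by (auto simp: rel_basis_def)
  then obtain g' f where g': "singular_chain (Suc 1) (subtopology X A) g'" and f: "singular_chain 1 (subtopology X C) f"
    and gf: "chain_boundary (Suc 1) g' = (- e - chain_comb I a d) + f"
    unfolding homologous_rel_def singular_relboundary_alt sub_chain[OF CA] by blast
  have "chain_boundary (Suc 1) (g + g') = (c - chain_comb I a d) + f"
    by (simp only: chain_boundary_add ge gf) simp
  then show ?thesis
    using singular_chain_add[OF g singular_chain_subtopology_in[OF g']] f
    unfolding homologous_rel_def singular_relboundary_alt by blast
qed

text \<open>
  A relative boundary of \<open>(X, C)\<close> in \<open>A\<close> is the boundary of a cycle of \<open>(X, A)\<close>, which is a combination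
  of the cycles \<open>s j\<close>.
\<close>

lemma degree1_relation:
  "singular_relboundary 1 X C (chain_comb I c d) \<longleftrightarrow> (\<exists>a. \<forall>i\<in>I. c i = bdry a i)"
proof
  assume "singular_relboundary 1 X C (chain_comb I c d)"
  then obtain g e where g: "singular_chain 2 X g" and e: "singular_chain 1 (subtopology X C) e"
    and ge: "chain_boundary 2 g = chain_comb I c d + e"
    unfolding singular_relboundary_alt Suc_1 by blast
  have eA: "singular_chain 1 (subtopology X A) e"
    by (rule singular_chain_mono[OF e CA])
  have cA: "singular_chain 1 (subtopology X A) (chain_comb I c d)"
    using d_relcycle_sub by (simp add: singular_relcycle)
  have "singular_relcycle 2 X A g"
    using g singular_chain_add[OF cA eA] by (simp add: singular_relcycle ge)
  then obtain a where "homologous_rel 2 X A g (chain_comb J a s)"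
    using s by (auto simp: rel_basis_def)
  then obtain h k where h: "singular_chain (Suc 2) X h" and k: "singular_chain 2 (subtopology X A) k"
    and hk: "chain_boundary (Suc 2) h = (g - chain_comb J a s) + k"
    unfolding homologous_rel_def singular_relboundary_alt by blast
  have "chain_boundary 2 ((g - chain_comb J a s) + k) = 0"
    using chain_boundary_boundary_alt[OF h] by (simp only: hk)
  then have "chain_boundary 2 g - chain_boundary 2 (chain_comb J a s) + chain_boundary 2 k = 0"
    by (simp only: chain_boundary_add chain_boundary_diff)
  then have "chain_boundary 2 k = chain_boundary 2 (chain_comb J a s) + - chain_boundary 2 g"
    by (rule move_terms)
  then have k_bd: "chain_boundary 2 (- k) = (chain_comb I c d - chain_boundary 2 (chain_comb J a s)) + e"
    by (simp add: chain_boundary_minus ge)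
  have "singular_relboundary 1 (subtopology X A) C (chain_comb I c d - chain_boundary 2 (chain_comb J a s))"
    unfolding singular_relboundary_alt sub_chain[OF CA]
  proof (intro exI conjI)
    show "singular_chain (Suc 1) (subtopology X A) (- k)"
      using k by (simp add: singular_chain_minus numeral_2_eq_2)
    show "singular_chain 1 (subtopology X C) e"
      by (rule e)
    show "chain_boundary (Suc 1) (- k) = chain_comb I c d - chain_boundary 2 (chain_comb J a s) + e"
      using k_bd by (simp add: numeral_2_eq_2)
  qed
  then have "homologous_rel 1 (subtopology X A) C (chain_comb I c d) (chain_boundary 2 (chain_comb J a s))"
    by (simp only: homologous_rel_def)
  then have "homologous_rel 1 (subtopology X A) C (chain_comb I c d) (chain_comb I (bdry a) d)"
    by (rule homologous_rel_trans[OF bdry_homologous])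
  then have "singular_relboundary 1 (subtopology X A) C (chain_comb I (\<lambda>i. c i + - bdry a i) d)"
    unfolding chain_comb_add chain_comb_minus by (simp add: homologous_rel_def)
  then have "\<forall>i\<in>I. c i + - bdry a i = 0"
    using d unfolding rel_basis_def by blast
  then have "\<forall>i\<in>I. c i = bdry a i"
    by simp
  then show "\<exists>a. \<forall>i\<in>I. c i = bdry a i"
    by blast
next
  assume "\<exists>a. \<forall>i\<in>I. c i = bdry a i"
  then obtain a where "\<forall>i\<in>I. c i = bdry a i"
    by blast
  then have eq: "chain_comb I c d = chain_comb I (bdry a) d"
    by (intro chain_comb_cong) auto
  have "homologous_rel 1 X C (chain_boundary 2 (chain_comb J a s)) (chain_comb I (bdry a) d)"
    using bdry_homologous[of a] singular_chain_subtopology_in[of "Suc 1" X A]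
    unfolding homologous_rel_def singular_relboundary_alt sub_chain[OF CA] by blast
  moreover have "singular_relboundary 1 X C (chain_boundary 2 (chain_comb J a s))"
    unfolding singular_relboundary_alt Suc_1
  proof (intro exI conjI)
    show "singular_chain 2 X (chain_comb J a s)"
      using s_relcycle by (simp add: singular_relcycle)
    show "chain_boundary 2 (chain_comb J a s) = chain_boundary 2 (chain_comb J a s) + 0"
      by simp
  qed simp
  ultimately show "singular_relboundary 1 X C (chain_comb I c d)"
    unfolding eq using homologous_rel_relboundary by blast
qed

text \<open>
  A basis \<open>K\<close> of the kernel of \<open>bdry\<close> gives a basis in degree 2: the boundary of the combination of the
  \<open>s j\<close> with coefficients \<open>K l\<close> bounds in \<open>(A, C)\<close>, and subtracting a chain that it bounds yields a
  cycle relative to \<open>C\<close>.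
\<close>

lemma degree2_basis:
  fixes L :: "'l set" and K :: "'l \<Rightarrow> 'j \<Rightarrow> int"
  assumes finL: "finite L"
    and K0: "\<And>l i. \<lbrakk>l \<in> L; i \<in> I\<rbrakk> \<Longrightarrow> bdry (K l) i = 0"
    and span: "\<And>a. (\<And>i. i \<in> I \<Longrightarrow> bdry a i = 0) \<Longrightarrow> \<exists>b. \<forall>j\<in>J. a j = (\<Sum>l\<in>L. b l * K l j)"
    and indep: "\<And>b. (\<And>j. j \<in> J \<Longrightarrow> (\<Sum>l\<in>L. b l * K l j) = 0) \<Longrightarrow> \<forall>l\<in>L. b l = 0"
  shows "\<exists>z. rel_basis 2 X C L z"
proof -
  have "\<exists>e. singular_chain 2 (subtopology X A) e \<and> singular_relcycle 2 X C (chain_comb J (K l) s + e)" if l: "l \<in> L" for l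
  proof -
    have "chain_comb I (bdry (K l)) d = 0"
      using K0[OF l] by (intro chain_comb_zero)
    then have "singular_relboundary 1 (subtopology X A) C (chain_boundary 2 (chain_comb J (K l) s))"
      using bdry_homologous[of "K l"] by (simp add: homologous_rel_def)
    then obtain e f where e: "singular_chain 2 (subtopology X A) e" and f: "singular_chain 1 (subtopology X C) f"
      and ef: "chain_boundary 2 e = chain_boundary 2 (chain_comb J (K l) s) + f"
      unfolding singular_relboundary_alt sub_chain[OF CA] Suc_1 by blast
    have "singular_relcycle 2 X C (chain_comb J (K l) s + (- e))"
      using s_relcycle[of "K l"] f singular_chain_subtopology_in[OF e]
      by (simp add: singular_relcycle chain_boundary_diff ef singular_chain_diff singular_chain_minus)
    then show ?thesis
      using e by (intro exI[of _ "- e"]) (simp add: singular_chain_minus)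
  qed
  then obtain e where e: "\<And>l. l \<in> L \<Longrightarrow> singular_chain 2 (subtopology X A) (e l)"
    and z: "\<And>l. l \<in> L \<Longrightarrow> singular_relcycle 2 X C (chain_comb J (K l) s + e l)"
    by metis
  let ?z = "\<lambda>l. chain_comb J (K l) s + e l"
  have comb: "chain_comb L b ?z = chain_comb J (\<lambda>j. \<Sum>l\<in>L. b l * K l j) s + chain_comb L b e" for b
    by (simp add: chain_comb_add2 chain_comb_comb[OF finL finJ])
  have eA: "singular_chain 2 (subtopology X A) (chain_comb L b e)" for b
    by (rule singular_chain_comb[OF e])
  have "rel_basis 2 X C L ?z"
    unfolding rel_basis_def
  proof (intro conjI ballI allI impI)
    fix c assume c: "singular_relcycle 2 X C c"
    then have "singular_relcycle 2 X A c"
      using singular_chain_mono[OF _ CA] by (auto simp: singular_relcycle)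
    then obtain a where "homologous_rel 2 X A c (chain_comb J a s)"
      using s by (auto simp: rel_basis_def)
    then obtain g h where g: "singular_chain (Suc 2) X g" and h: "singular_chain 2 (subtopology X A) h"
      and gh: "chain_boundary (Suc 2) g = (c - chain_comb J a s) + h"
      unfolding homologous_rel_def singular_relboundary_alt by blast
    have "chain_boundary 2 ((c - chain_comb J a s) + h) = 0"
      using chain_boundary_boundary_alt[OF g] by (simp only: gh)
    then have "chain_boundary 2 c - chain_boundary 2 (chain_comb J a s) + chain_boundary 2 h = 0"
      by (simp only: chain_boundary_add chain_boundary_diff)
    then have h_bd: "chain_boundary 2 h = chain_boundary 2 (chain_comb J a s) + - chain_boundary 2 c"
      by (rule move_terms)
    have "singular_relboundary 1 (subtopology X A) C (chain_boundary 2 (chain_comb J a s))"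
      unfolding singular_relboundary_alt sub_chain[OF CA] Suc_1
    proof (intro exI conjI)
      show "singular_chain 2 (subtopology X A) h"
        by (rule h)
      show "singular_chain 1 (subtopology X C) (- chain_boundary 2 c)"
        using c by (simp add: singular_relcycle singular_chain_minus)
    qed (rule h_bd)
    then have "singular_relboundary 1 (subtopology X A) C (chain_comb I (bdry a) d)"
      using homologous_rel_relboundary[OF bdry_homologous] by blast
    then have "\<forall>i\<in>I. bdry a i = 0"
      using d unfolding rel_basis_def by blast
    then obtain b where b: "\<forall>j\<in>J. a j = (\<Sum>l\<in>L. b l * K l j)"
      using span by blast
    have "chain_comb J a s = chain_comb J (\<lambda>j. \<Sum>l\<in>L. b l * K l j) s"
      using b by (intro chain_comb_cong) auto
    then have eq: "chain_boundary (Suc 2) g = (c - chain_comb L b ?z) + (chain_comb L b e + h)"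
      by (simp only: gh comb) (simp add: algebra_simps)
    have "singular_relboundary 2 X A (c - chain_comb L b ?z)"
      unfolding singular_relboundary_alt using g singular_chain_add[OF eA h] eq by blast
    then have "singular_relboundary 2 X C (c - chain_comb L b ?z)"
      by (intro relboundary_restrict[OF CA acycC] singular_relcycle_diff c singular_relcycle_comb z) simp_all
    then show "\<exists>b. homologous_rel 2 X C c (chain_comb L b ?z)"
      unfolding homologous_rel_def by blast
  next
    fix b l assume b: "singular_relboundary 2 X C (chain_comb L b ?z)" and l: "l \<in> L"
    then obtain g h where g: "singular_chain (Suc 2) X g" and h: "singular_chain 2 (subtopology X C) h"
      and gh: "chain_boundary (Suc 2) g = chain_comb L b ?z + h"
      unfolding singular_relboundary_alt by blast
    have "chain_boundary (Suc 2) g = chain_comb J (\<lambda>j. \<Sum>l\<in>L. b l * K l j) s + (chain_comb L b e + h)"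
      by (simp only: gh comb add.assoc)
    then have "singular_relboundary 2 X A (chain_comb J (\<lambda>j. \<Sum>l\<in>L. b l * K l j) s)"
      unfolding singular_relboundary_alt using g singular_chain_add[OF eA singular_chain_mono[OF h CA]] by blast
    then have "\<forall>j\<in>J. (\<Sum>l\<in>L. b l * K l j) = 0"
      using s unfolding rel_basis_def by blast
    then show "b l = 0"
      using indep l by blast
  qed (use finL z in auto)
  then show ?thesis
    by blast
qed

end

subsection \<open>From bases to groups\<close>

lemma chain_comb_class_hom:
  assumes fin: "finite J" and z: "\<And>j. j \<in> J \<Longrightarrow> singular_relcycle p X S (z j)"
  shows "group_hom (product_group J (\<lambda>_. integer_group)) (relative_homology_group (int p) X S)
    (\<lambda>a. homologous_rel_set p X S (chain_comb J a z))"
proof -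
  let ?P = "product_group J (\<lambda>_. integer_group)" and ?H = "relative_homology_group (int p) X S"
  have cyc: "singular_relcycle p X S (chain_comb J a z)" for a
    by (rule singular_relcycle_comb[OF z])
  have "(\<lambda>a. homologous_rel_set p X S (chain_comb J a z)) \<in> hom ?P ?H"
  proof (rule homI)
    fix a b
    have "chain_comb J (a \<otimes>\<^bsub>?P\<^esub> b) z = chain_comb J (\<lambda>j. a j + b j) z"
      by (rule chain_comb_cong) auto
    then show "homologous_rel_set p X S (chain_comb J (a \<otimes>\<^bsub>?P\<^esub> b) z) =
        homologous_rel_set p X S (chain_comb J a z) \<otimes>\<^bsub>?H\<^esub> homologous_rel_set p X S (chain_comb J b z)"
      using hom_mult[OF homologous_class_hom[of p X S], of "chain_comb J a z" "chain_comb J b z"] cyc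
      by (simp add: chain_comb_add)
  qed (use cyc in \<open>auto simp: carrier_relative_homology_group\<close>)
  then show ?thesis
    by (simp add: group_hom_def group_hom_axioms_def)
qed

lemma rel_basis_iso:
  assumes z: "rel_basis p X S J z"
  shows "relative_homology_group (int p) X S \<cong> product_group J (\<lambda>_. integer_group)"
proof -
  let ?P = "product_group J (\<lambda>_. integer_group)" and ?H = "relative_homology_group (int p) X S"
  let ?f = "\<lambda>a. homologous_rel_set p X S (chain_comb J a z)"
  have fin: "finite J" and cyc: "\<And>j. j \<in> J \<Longrightarrow> singular_relcycle p X S (z j)"
    using z by (auto simp: rel_basis_def)
  interpret group_hom ?P ?H ?f
    by (rule chain_comb_class_hom[OF fin cyc])
  have "?f ` carrier ?P = carrier ?H"
  proof
    show "carrier ?H \<subseteq> ?f ` carrier ?P"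
    proof
      fix y assume "y \<in> carrier ?H"
      then obtain c where c: "singular_relcycle p X S c" "y = homologous_rel_set p X S c"
        by (auto simp: carrier_relative_homology_group)
      then obtain a where a: "homologous_rel p X S c (chain_comb J a z)"
        using z by (auto simp: rel_basis_def)
      have "chain_comb J a z = chain_comb J (restrict a J) z"
        by (rule chain_comb_cong) auto
      then have "y = ?f (restrict a J)"
        using a c(2) homologous_rel_set_eq by metis
      moreover have "restrict a J \<in> carrier ?P"
        by auto
      ultimately show "y \<in> ?f ` carrier ?P"
        by blast
    qed
  qed (use hom_closed in blast)
  moreover have "inj_on ?f (carrier ?P)"
    unfolding inj_on_one_iff
  proof (intro allI impI)
    fix a assume a: "a \<in> carrier ?P" "?f a = \<one>\<^bsub>?H\<^esub>"
    then have "singular_relboundary p X S (chain_comb J a z)"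
      by (simp add: homologous_rel_set_eq_relboundary)
    then have "\<forall>j\<in>J. a j = 0"
      using z by (auto simp: rel_basis_def)
    then show "a = \<one>\<^bsub>?P\<^esub>"
      using a(1) by (auto simp: PiE_def extensional_def restrict_def fun_eq_iff)
  qed
  ultimately have "?f \<in> iso ?P ?H"
    using homh by (simp add: iso_def bij_betw_def)
  then show ?thesis
    using group.iso_sym[OF _ is_isoI] by auto
qed

lemma rel_basis_reindex:
  assumes z: "rel_basis p X S J z" and h: "bij_betw h I J"
  shows "rel_basis p X S I (\<lambda>i. z (h i))"
proof -
  have eq: "chain_comb J a z = chain_comb I (\<lambda>i. a (h i)) (\<lambda>i. z (h i))" for a
    unfolding chain_comb_def by (rule sum.reindex_bij_betw[OF h, symmetric])
  have inv: "inv_into I h (h i) = i" if "i \<in> I" for i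
    using h that by (simp add: bij_betw_def)
  have eq': "chain_comb I a (\<lambda>i. z (h i)) = chain_comb J (\<lambda>j. a (inv_into I h j)) z" for a
    unfolding eq by (rule chain_comb_cong) (simp_all add: inv)
  have hJ: "h i \<in> J" if "i \<in> I" for i
    using h that by (auto simp: bij_betw_def)
  show ?thesis
    unfolding rel_basis_def
  proof (intro conjI ballI allI impI)
    show "finite I"
      using z bij_betw_finite[OF h] by (simp add: rel_basis_def)
    show "singular_relcycle p X S (z (h i))" if "i \<in> I" for i
      using z hJ[OF that] by (simp add: rel_basis_def)
    fix c assume "singular_relcycle p X S c"
    then obtain a where "homologous_rel p X S c (chain_comb J a z)"
      using z by (auto simp: rel_basis_def)
    then show "\<exists>a. homologous_rel p X S c (chain_comb I a (\<lambda>i. z (h i)))"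
      unfolding eq by blast
  next
    fix a i assume "singular_relboundary p X S (chain_comb I a (\<lambda>i. z (h i)))" and i: "i \<in> I"
    then have "\<forall>j\<in>J. a (inv_into I h j) = 0"
      using z unfolding eq' rel_basis_def by blast
    then show "a i = 0"
      using hJ[OF i] inv[OF i] by metis
  qed
qed

lemma iso_same_kernel:
  assumes f: "group_hom P H f" "f ` carrier P = carrier H" and g: "group_hom P K g" "g ` carrier P = carrier K"
    and ker: "\<And>x. x \<in> carrier P \<Longrightarrow> f x = \<one>\<^bsub>H\<^esub> \<longleftrightarrow> g x = \<one>\<^bsub>K\<^esub>"
  shows "H \<cong> K"
proof -
  interpret f: group_hom P H f by fact
  interpret g: group_hom P K g by fact
  have "kernel P H f = kernel P K g"
    using ker by (auto simp: kernel_def)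
  then have "P Mod kernel P H f \<cong> K"
    using g.FactGroup_iso[OF g(2)] by simp
  moreover have "H \<cong> P Mod kernel P H f"
    by (rule group.iso_sym[OF normal.factorgroup_is_group[OF f.normal_kernel] f.FactGroup_iso[OF f(2)]])
  ultimately show ?thesis
    using iso_trans by blast
qed

section \<open>Kernel and cokernel of the cellular boundary map\<close>

text \<open>
  The boundary of the 2-cell \<open>(i, k)\<close> is the sum of the edges \<open>i\<close> and \<open>k\<close> minus, for \<open>i \<noteq> k\<close>, the
  diagonal \<open>{i, k}\<close>; the row \<open>(p, q)\<close> with \<open>p = q\<close> stands for an edge, with \<open>p < q\<close> for a diagonal.
\<close>

definition cell_matrix :: "nat \<times> nat \<Rightarrow> nat \<times> nat \<Rightarrow> int" where
  "cell_matrix = (\<lambda>(i, k) (p, q). if p = q then (if p = i then 1 else 0) + (if p = k then 1 else 0)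
     else if p = min i k \<and> q = max i k then - 1 else 0)"

lemma cell_matrix_diagonal:
  assumes "p < b"
  shows "(\<Sum>j\<in>{..<b} \<times> {..<b}. a j * cell_matrix j (p, p)) = (\<Sum>k<b. a (p, k)) + (\<Sum>i<b. a (i, p))"
proof -
  have "(\<Sum>j\<in>{..<b} \<times> {..<b}. a j * cell_matrix j (p, p))
      = (\<Sum>i<b. \<Sum>k<b. a (i, k) * ((if p = i then 1 else 0) + (if p = k then 1 else 0)))"
    unfolding sum.cartesian_product by (intro sum.cong) (auto simp: cell_matrix_def)
  also have "\<dots> = (\<Sum>i<b. \<Sum>k<b. (if p = i then a (i, k) else 0)) + (\<Sum>i<b. \<Sum>k<b. (if p = k then a (i, k) else 0))"
    unfolding sum.distrib[symmetric] by (intro sum.cong) auto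
  also have "(\<Sum>i<b. \<Sum>k<b. (if p = i then a (i, k) else 0)) = (\<Sum>i<b. if p = i then (\<Sum>k<b. a (i, k)) else 0)"
    by (intro sum.cong) auto
  finally show ?thesis
    using assms by simp
qed

lemma cell_matrix_off_diagonal:
  assumes "p < q" "q < b"
  shows "(\<Sum>j\<in>{..<b} \<times> {..<b}. a j * cell_matrix j (p, q)) = - (a (p, q) + a (q, p))"
proof -
  have "(\<Sum>j\<in>{..<b} \<times> {..<b}. a j * cell_matrix j (p, q)) = (\<Sum>j\<in>{(p, q), (q, p)}. a j * cell_matrix j (p, q))"
    using assms by (intro sum.mono_neutral_right) (auto simp: cell_matrix_def min_def max_def split: if_splits)
  also have "\<dots> = - (a (p, q) + a (q, p))"
    using assms by (simp add: cell_matrix_def)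
  finally show ?thesis .
qed

lemma sum_split_row:
  fixes a :: "nat \<times> nat \<Rightarrow> int"
  assumes "p < b"
  shows "(\<Sum>k<b. a (p, k)) + (\<Sum>i<b. a (i, p)) = 2 * a (p, p) + (\<Sum>k\<in>{..<b} - {p}. a (p, k) + a (k, p))"
proof -
  have "(\<Sum>k<b. a (p, k)) = a (p, p) + (\<Sum>k\<in>{..<b} - {p}. a (p, k))"
    "(\<Sum>i<b. a (i, p)) = a (p, p) + (\<Sum>k\<in>{..<b} - {p}. a (k, p))"
    using assms by (auto intro!: sum.remove)
  then show ?thesis
    by (simp add: sum.distrib)
qed

definition upper_pairs :: "nat \<Rightarrow> (nat \<times> nat) set" where
  "upper_pairs b = {(i, j). i < j \<and> j < b}"

lemma finite_upper_pairs: "finite (upper_pairs b)"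
  by (rule finite_subset[of _ "{..<b} \<times> {..<b}"]) (auto simp: upper_pairs_def)

lemma card_upper_pairs: "card (upper_pairs b) = b * (b - 1) div 2"
proof -
  have "upper_pairs b = prod.swap ` (SIGMA j:{..<b}. {..<j})"
    by (force simp: upper_pairs_def image_iff)
  then have "card (upper_pairs b) = (\<Sum>j<b. j)"
    by (simp add: card_image)
  moreover have "2 * (\<Sum>j<b. j) = b * (b - 1)"
  proof (induction b)
    case (Suc n)
    then show ?case
      by (cases n) (simp_all add: algebra_simps)
  qed simp
  ultimately show ?thesis
    by simp
qed

text \<open>
  For \<open>i < k\<close>, the elementary antisymmetric matrix of the pair \<open>(i, k)\<close>; the second argument is the
  position of an entry.
\<close>

definition swap_matrix :: "nat \<times> nat \<Rightarrow> nat \<times> nat \<Rightarrow> int" where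
  "swap_matrix = (\<lambda>(i, k) (p, q). (if i = p \<and> k = q then 1 else 0) - (if i = q \<and> k = p then 1 else 0))"

lemma indicator_diff:
  fixes c :: int
  shows "c * ((if P then 1 else 0) - (if Q then 1 else 0)) = (if P then c else 0) - (if Q then c else 0)"
  by (cases P; cases Q) simp_all

lemma sum_swap_matrix:
  "(\<Sum>l\<in>upper_pairs b. c l * swap_matrix l (p, q)) =
    (if (p, q) \<in> upper_pairs b then c (p, q) else 0) - (if (q, p) \<in> upper_pairs b then c (q, p) else 0)"
proof -
  have "c l * swap_matrix l (p, q) = (if l = (p, q) then c l else 0) - (if l = (q, p) then c l else 0)" for l
  proof -
    obtain i k where l: "l = (i, k)"
      by (cases l)
    have "swap_matrix l (p, q) = (if l = (p, q) then 1 else 0) - (if l = (q, p) then 1 else 0)"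
      by (simp add: swap_matrix_def l)
    then show ?thesis
      by (simp only: indicator_diff)
  qed
  then show ?thesis
    by (simp only: sum_subtractf sum.delta[OF finite_upper_pairs])
qed

section \<open>The boundaries of the cells\<close>

context graph_cells
begin

lemma sub_X1_X0_chain:
  assumes g: "continuous_map (simplex_top p) Ysym g" and im: "\<And>u. u \<in> standard_simplex p \<Longrightarrow> g u \<in> X0"
  shows "singular_chain p (subtopology (subtopology Ysym X1) X0) (frag_of (restrict g (standard_simplex p)))"
  unfolding sub_chain[OF X0_X1] unfolding singular_chain_of singular_simplex_subtopology
proof
  show "singular_simplex p Ysym (restrict g (standard_simplex p))"
    unfolding singular_simplex_def simplex_top_def[symmetric]
    using continuous_map_eq[OF g, of "restrict g (standard_simplex p)"] by auto
qed (use im in auto)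

lemma continuous_map_\<gamma>_simplex:
  assumes i: "i < b" and f: "continuous_map (simplex_top p) euclideanreal f"
    and 01: "\<And>u. u \<in> standard_simplex p \<Longrightarrow> 0 \<le> f u \<and> f u \<le> 1"
  shows "continuous_map (simplex_top p) Gam (\<lambda>u. \<gamma> i (f u))"
  by (rule continuous_map_\<gamma>[OF i f]) (use 01 in auto)

lemma simplex1_coordinate: "u \<in> standard_simplex 1 \<Longrightarrow> 0 \<le> u 1 \<and> u 1 \<le> 1"
  using simplex1[of u] by blast

text \<open>
  Sliding the first point of an edge cell along the tree to the base point is a homotopy of pairs,
  since the ends of the edge lie in the tree as well.
\<close>

lemma edge_cell_slide:
  assumes x: "x \<in> T" and i: "i < b"
  shows "homologous_rel 1 (subtopology Ysym X1) X0
    (frag_of (restrict (\<lambda>u. upair (x, \<gamma> i (u 1))) (standard_simplex 1))) (chain1 (i, i))"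
proof -
  let ?I = "top_of_set {0..1::real}" and ?Y1 = "subtopology Ysym X1"
  have J: "(i, i) \<in> J1"
    using i by (simp add: J1_def)
  obtain k where k: "continuous_map (prod_topology ?I (complex_top V F)) (complex_top V F) k"
    and k0: "\<And>y. k (0, y) = y" and k1: "\<And>y. k (1, y) = r"
  proof -
    have "homotopic_with (\<lambda>x. True) (complex_top V F) (complex_top V F) id (\<lambda>x. r)"
      using contr r unfolding contractible_space_alt by simp
    then show ?thesis
      using that unfolding homotopic_with_def by auto
  qed
  have fib: "fibre1 (i, i) = complex_top V F"
    by (simp add: fibre1_def)
  have kT: "k (t, y) \<in> T" if "0 \<le> t" "t \<le> 1" "y \<in> T" for t y
    using k that by (auto simp: continuous_map_def Pi_iff)
  let ?h = "\<lambda>(t, u). cell1 (i, i) (k (t, x), u)"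
  let ?Z = "prod_topology ?I (simplex_top 1)"
  have "continuous_map ?Z (prod_topology ?I (complex_top V F)) (\<lambda>z. (fst z, x))"
    using x by (intro continuous_map_pairedI continuous_map_fst) simp
  from continuous_map_compose[OF this k]
  have "continuous_map ?Z (complex_top V F) (\<lambda>z. k (fst z, x))"
    by (simp add: o_def)
  then have "continuous_map ?Z (prod_topology (complex_top V F) (simplex_top 1)) (\<lambda>z. (k (fst z, x), snd z))"
    by (intro continuous_map_pairedI continuous_map_snd)
  from continuous_map_compose[OF this continuous_map_cell1[OF J, unfolded fib]]
  have hY: "continuous_map ?Z Ysym ?h"
    by (simp add: o_def case_prod_unfold)
  have cell: "cell1 (i, i) (y, u) \<in> X1" if "y \<in> T" "u \<in> standard_simplex 1" for y u
    unfolding cover1 using that J fib by (intro UnI2 UN_I[of "(i, i)"] imageI) auto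
  have bd: "cell1 (i, i) (y, u) \<in> X0" if "y \<in> T" "u \<in> simplex_bd 1" for y u
    using cell1_bd[OF J, of y u] that fib by (auto simp: simplex_bd_def)
  have "continuous_map ?Z ?Y1 ?h"
    unfolding continuous_map_in_subtopology using hY cell kT x by auto
  then have "homotopic_with (\<lambda>h. h \<in> simplex_bd 1 \<rightarrow> X0) (simplex_top 1) ?Y1 (\<lambda>u. cell1 (i, i) (x, u)) (\<lambda>u. cell1 (i, i) (r, u))"
    unfolding homotopic_with_def using bd kT x by (intro exI[of _ ?h]) (auto simp: k0 k1)
  from homotopic_imp_homologous_rel_chain_maps[OF this relcycle_simplex_id]
  show ?thesis
    by (simp add: simplex_map_simplex_id chain1_def cell1_def)
qed

definition diagonal_chain :: "nat \<Rightarrow> nat \<Rightarrow> (('v \<Rightarrow> real) \<times> ('v \<Rightarrow> real)) set chain" where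
  "diagonal_chain i k = frag_of (restrict (\<lambda>u. upair (\<gamma> i (u 1), \<gamma> k (u 1))) (standard_simplex 1))"

text \<open>
  The sides of the triangle \<open>0 \<le> s \<le> t \<le> 1\<close> are \<open>t = 1\<close>, \<open>s = t\<close> and \<open>s = 0\<close>, in the order of the
  faces.
\<close>

lemma chain_boundary_chain2:
  assumes ik: "i < b" "k < b"
  shows "chain_boundary 2 (chain2 (i, k)) =
    frag_of (restrict (\<lambda>u. upair (unit_vec (w k), \<gamma> i (u 1))) (standard_simplex 1)) - diagonal_chain i k
    + frag_of (restrict (\<lambda>u. upair (unit_vec (a i), \<gamma> k (u 1))) (standard_simplex 1))"
proof -
  let ?c = "restrict (\<lambda>u. cell2 (i, k) ((), u)) (standard_simplex 2)"
  have face: "singular_face 2 m ?c = restrict (\<lambda>u. cell2 (i, k) ((), simplical_face m u)) (standard_simplex 1)"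
    if "m \<le> 2" for m
    using simplical_face_in_standard_simplex[of 2 m] that
    by (auto simp: singular_face_def fun_eq_iff restrict_def)
  have s1: "u 0 + u 1 = 1" if "u \<in> standard_simplex 1" for u :: "nat \<Rightarrow> real"
    using that by (simp add: standard_simplex_iff)
  have f: "simplical_face m u 1 = (if m = 0 then u 0 else if m = 1 then 0 else u 1)"
    "simplical_face m u 2 = (if m = 2 then 0 else u 1)" if "m \<le> 2" for m and u :: "nat \<Rightarrow> real"
    using that by (auto simp: simplical_face_def)
  have "singular_face 2 0 ?c = restrict (\<lambda>u. upair (unit_vec (w k), \<gamma> i (u 1))) (standard_simplex 1)"
    unfolding face[OF le0]
  proof (rule restrict_ext)
    fix u :: "nat \<Rightarrow> real" assume "u \<in> standard_simplex 1"
    then have "cell2 (i, k) ((), simplical_face 0 u) = upair (\<gamma> i (u 1), unit_vec (w k))"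
      by (simp add: cell2_def f s1 edge_point_ends del: One_nat_def)
    then show "cell2 (i, k) ((), simplical_face 0 u) = upair (unit_vec (w k), \<gamma> i (u 1))"
      by (simp only: upair_commute[of "unit_vec (w k)"])
  qed
  moreover have "singular_face 2 1 ?c = restrict (\<lambda>u. upair (\<gamma> i (u 1), \<gamma> k (u 1))) (standard_simplex 1)"
    by (subst face, simp, rule restrict_ext) (simp add: cell2_def f del: One_nat_def)
  moreover have "singular_face 2 2 ?c = restrict (\<lambda>u. upair (unit_vec (a i), \<gamma> k (u 1))) (standard_simplex 1)"
    by (subst face, simp, rule restrict_ext) (simp add: cell2_def f edge_point_ends del: One_nat_def)
  moreover have "chain_boundary 2 (frag_of ?c) =
      frag_of (singular_face 2 0 ?c) - frag_of (singular_face 2 1 ?c) + frag_of (singular_face 2 2 ?c)"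
    by (simp add: chain_boundary_of numeral_2_eq_2)
  ultimately show ?thesis
    by (simp add: chain2_def diagonal_chain_def)
qed

lemma diagonal_chain_class:
  assumes ik: "i < b" "k < b"
  shows "homologous_rel 1 (subtopology Ysym X1) X0 (diagonal_chain i k)
    (if i = k then 0 else chain1 (min i k, max i k))"
proof (cases "i = k")
  case True
  have "continuous_map (simplex_top 1) Gam (\<lambda>u. \<gamma> i (u 1))"
    using simplex1_coordinate by (intro continuous_map_\<gamma>_simplex[OF ik(1)] continuous_map_simplex_coordinate) auto
  then have "continuous_map (simplex_top 1) Ysym (\<lambda>u. upair (\<gamma> i (u 1), \<gamma> i (u 1)))"
    by (intro continuous_map_upair_pair)
  then have "singular_chain 1 (subtopology (subtopology Ysym X1) X0) (diagonal_chain i k)"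
    unfolding diagonal_chain_def True[symmetric]
    using simplex1_coordinate \<gamma>_in[OF ik(1)] by (intro sub_X1_X0_chain) (auto simp: X0_iff)
  then show ?thesis
    using True by (simp add: homologous_rel_def singular_chain_imp_relboundary)
next
  case False
  then have "i < k \<or> k < i"
    by auto
  then have "diagonal_chain i k = chain1 (min i k, max i k)"
  proof
    assume "i < k"
    then show ?thesis
      by (simp add: diagonal_chain_def chain1_def cell1_def)
  next
    assume ki: "k < i"
    have "diagonal_chain i k = diagonal_chain k i"
      unfolding diagonal_chain_def
      by (intro arg_cong[where f = frag_of] restrict_ext) (rule upair_commute)
    also have "\<dots> = chain1 (k, i)"
      using ki by (simp add: diagonal_chain_def chain1_def cell1_def)
    also have "(k, i) = (min i k, max i k)"
      using ki by simp
    finally show ?thesis .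
  qed
  then show ?thesis
    using False by simp
qed

lemma chain_comb_cell_matrix:
  assumes ik: "i < b" "k < b"
  shows "chain_comb J1 (cell_matrix (i, k)) d =
    d (i, i) - (if i = k then 0 else d (min i k, max i k)) + d (k, k)"
proof (rule poly_mapping_eqI)
  fix f
  let ?l = "\<lambda>j. Poly_Mapping.lookup (d j) f"
  have "cell_matrix (i, k) j * ?l j = (if j = (i, i) then ?l j else 0) + (if j = (k, k) then ?l j else 0)
      - (if j = (min i k, max i k) then (if i = k then 0 else ?l j) else 0)" for j
  proof -
    obtain p q where j: "j = (p, q)"
      by (cases j)
    show ?thesis
      by (cases "p = q"; cases "i = k") (auto simp: j cell_matrix_def min_def max_def)
  qed
  then have "(\<Sum>j\<in>J1. cell_matrix (i, k) j * ?l j) =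
      (\<Sum>j\<in>J1. if j = (i, i) then ?l j else 0) + (\<Sum>j\<in>J1. if j = (k, k) then ?l j else 0)
      - (\<Sum>j\<in>J1. if j = (min i k, max i k) then (if i = k then 0 else ?l j) else 0)"
    by (simp only: sum_subtractf sum.distrib)
  moreover have "(i, i) \<in> J1" "(k, k) \<in> J1" "(min i k, max i k) \<in> J1"
    using ik by (auto simp: J1_def)
  ultimately have "(\<Sum>j\<in>J1. cell_matrix (i, k) j * ?l j) =
      ?l (i, i) + ?l (k, k) - (if i = k then 0 else ?l (min i k, max i k))"
    by (simp only: sum.delta[OF finite_J1] if_True)
  then show "Poly_Mapping.lookup (chain_comb J1 (cell_matrix (i, k)) d) f =
      Poly_Mapping.lookup (d (i, i) - (if i = k then 0 else d (min i k, max i k)) + d (k, k)) f"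
    by (simp add: chain_comb_def lookup_sum lookup_add lookup_minus)
qed

lemma boundary_chain2_class:
  assumes "j \<in> J2"
  shows "homologous_rel 1 (subtopology Ysym X1) X0 (chain_boundary 2 (chain2 j)) (chain_comb J1 (cell_matrix j) chain1)"
proof -
  obtain i k where j: "j = (i, k)" and ik: "i < b" "k < b"
    using assms by (auto simp: J2_def)
  have "unit_vec (w k) \<in> T" "unit_vec (a i) \<in> T"
    using ends_in ik vertex_in_T by auto
  then show ?thesis
    unfolding j chain_comb_cell_matrix[OF ik] chain_boundary_chain2[OF ik]
    by (intro homologous_rel_add homologous_rel_diff edge_cell_slide diagonal_chain_class ik)
qed

sublocale two_step_filtration Ysym X1 X0 J1 J2 chain1 chain2 cell_matrix
  using X0_X1 homology_X1 homology_X2 boundary_chain2_class by unfold_locales auto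

lemma bdry_diagonal: "p < b \<Longrightarrow> bdry c (p, p) = 2 * c (p, p) + (\<Sum>k\<in>{..<b} - {p}. c (p, k) + c (k, p))"
  unfolding J2_def cell_matrix_diagonal by (rule sum_split_row)

lemma bdry_off_diagonal: "p < q \<Longrightarrow> q < b \<Longrightarrow> bdry c (p, q) = - (c (p, q) + c (q, p))"
  unfolding J2_def by (rule cell_matrix_off_diagonal)

text \<open>
  The rows of the diagonals force antisymmetry off the diagonal of \<open>c\<close>; the rows of the edges then
  give \<open>2 * c (p, p) = 0\<close>.
\<close>

lemma bdry_eq_0_iff: "(\<forall>j\<in>J1. bdry c j = 0) \<longleftrightarrow> (\<forall>p<b. \<forall>q<b. c (p, q) = - c (q, p))"
proof
  assume h: "\<forall>j\<in>J1. bdry c j = 0"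
  have off: "c (p, q) = - c (q, p)" if "p < q" "q < b" for p q
    using bspec[OF h, of "(p, q)"] bdry_off_diagonal[OF that, of c] that by (simp add: J1_def)
  have off': "c (p, q) = - c (q, p)" if "p \<noteq> q" "p < b" "q < b" for p q
    using off[of p q] off[of q p] that by (cases "p < q") auto
  have "c (p, p) = 0" if "p < b" for p
  proof -
    have "(\<Sum>k\<in>{..<b} - {p}. c (p, k) + c (k, p)) = 0"
      using off'[of p] that by (intro sum.neutral) auto
    then show ?thesis
      using bspec[OF h, of "(p, p)"] bdry_diagonal[OF that, of c] that by (simp add: J1_def)
  qed
  then show "\<forall>p<b. \<forall>q<b. c (p, q) = - c (q, p)"
    using off' by (metis minus_zero)
next
  assume h: "\<forall>p<b. \<forall>q<b. c (p, q) = - c (q, p)"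
  show "\<forall>j\<in>J1. bdry c j = 0"
  proof
    fix j assume "j \<in> J1"
    then obtain p q where j: "j = (p, q)" "p \<le> q" "q < b"
      by (auto simp: J1_def)
    have anti: "c (p', q') + c (q', p') = 0" if "p' < b" "q' < b" for p' q'
    proof -
      have "c (p', q') = - c (q', p')"
        using h that by blast
      then show ?thesis
        by linarith
    qed
    show "bdry c j = 0"
    proof (cases "p = q")
      case True
      have "(\<Sum>k\<in>{..<b} - {q}. c (q, k) + c (k, q)) = 0"
        using anti[OF j(3)] by (intro sum.neutral) blast
      moreover have "c (q, q) = 0"
        using anti[OF j(3) j(3)] by linarith
      ultimately show ?thesis
        unfolding j(1) True bdry_diagonal[OF j(3)] by simp
    next
      case False
      then have "p < q" "p < b"
        using j by auto
      then show ?thesis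
        unfolding j(1) using bdry_off_diagonal[of p q c] anti[of p q] j(3) by linarith
    qed
  qed
qed

theorem homology_degree2:
  "relative_homology_group 2 Ysym X0 \<cong> product_group {..<b * (b - 1) div 2} (\<lambda>_. integer_group)"
proof -
  have sw: "(\<Sum>l\<in>upper_pairs b. c l * swap_matrix l (p, q)) =
      (if p < q then c (p, q) else if q < p then - c (q, p) else 0)" if "p < b" "q < b" for c p q
    using that unfolding sum_swap_matrix by (auto simp: upper_pairs_def)
  have "\<exists>z. rel_basis 2 Ysym X0 (upper_pairs b) z"
  proof (rule degree2_basis[OF finite_upper_pairs, where K = swap_matrix])
    fix l j assume l: "l \<in> upper_pairs b" and j: "j \<in> J1"
    have "swap_matrix l (p, q) = - swap_matrix l (q, p)" for p q
      by (cases l) (simp add: swap_matrix_def)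
    then have "\<forall>p<b. \<forall>q<b. swap_matrix l (p, q) = - swap_matrix l (q, p)"
      by blast
    then show "bdry (swap_matrix l) j = 0"
      using bdry_eq_0_iff j by blast
  next
    fix c assume "\<And>i. i \<in> J1 \<Longrightarrow> bdry c i = 0"
    then have c: "\<forall>p<b. \<forall>q<b. c (p, q) = - c (q, p)"
      using bdry_eq_0_iff by blast
    have "c j = (\<Sum>l\<in>upper_pairs b. c l * swap_matrix l j)" if jJ: "j \<in> J2" for j
    proof -
      obtain p q where j: "j = (p, q)" "p < b" "q < b"
        using jJ by (auto simp: J2_def)
      have c1: "c (p, q) = - c (q, p)"
        using c j by blast
      have "c (p, q) = (if p < q then c (p, q) else if q < p then - c (q, p) else 0)"
      proof (cases p q rule: linorder_cases)
        case equal
        have "c (q, q) = 0"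
          using c1 unfolding equal by linarith
        then show ?thesis
          by (simp add: equal)
      next
        case greater
        then show ?thesis
          using c1 by simp
      qed simp
      then show ?thesis
        unfolding j(1) sw[OF j(2,3)] .
    qed
    then show "\<exists>e. \<forall>j\<in>J2. c j = (\<Sum>l\<in>upper_pairs b. e l * swap_matrix l j)"
      by blast
  next
    fix c assume c: "\<And>j. j \<in> J2 \<Longrightarrow> (\<Sum>l\<in>upper_pairs b. c l * swap_matrix l j) = 0"
    show "\<forall>l\<in>upper_pairs b. c l = 0"
    proof
      fix l assume "l \<in> upper_pairs b"
      then obtain p q where l: "l = (p, q)" "p < q" "q < b"
        by (auto simp: upper_pairs_def)
      then show "c l = 0"
        using c[of "(p, q)"] sw[of p q c] by (simp add: J2_def)
    qed
  qed
  then obtain z where z: "rel_basis 2 Ysym X0 (upper_pairs b) z"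
    by blast
  obtain h where "bij_betw h {0..<card (upper_pairs b)} (upper_pairs b)"
    using ex_bij_betw_nat_finite[OF finite_upper_pairs] by blast
  then have "bij_betw h {..<b * (b - 1) div 2} (upper_pairs b)"
    by (simp add: card_upper_pairs atLeast0LessThan)
  from rel_basis_iso[OF rel_basis_reindex[OF z this]] show ?thesis
    by simp
qed

text \<open>
  Modulo boundaries, the diagonal of the edges \<open>i\<close> and \<open>k\<close> is the sum of these two edges, so a
  1-chain is equivalent to the combination of the edges alone with coefficients \<open>edge_sum c i\<close>. As
  twice an edge is a boundary, only their parities matter.
\<close>

definition edge_sum :: "(nat \<times> nat \<Rightarrow> int) \<Rightarrow> nat \<Rightarrow> int" where
  "edge_sum c i = c (i, i) + (\<Sum>k\<in>{..<b} - {i}. c (min i k, max i k))"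

lemma bdry_image_iff: "(\<exists>e. \<forall>j\<in>J1. c j = bdry e j) \<longleftrightarrow> (\<forall>i<b. even (edge_sum c i))"
proof
  assume "\<exists>e. \<forall>j\<in>J1. c j = bdry e j"
  then obtain e where e: "\<forall>j\<in>J1. c j = bdry e j"
    by blast
  have off: "c (min i k, max i k) = - (e (i, k) + e (k, i))" if ik: "i < b" "k < b" "k \<noteq> i" for i k
  proof (cases "i < k")
    case True
    then show ?thesis
      using bspec[OF e, of "(i, k)"] bdry_off_diagonal[of i k e] ik by (simp add: J1_def min_def max_def)
  next
    case False
    then have "k < i"
      using ik by simp
    then show ?thesis
      using bspec[OF e, of "(k, i)"] bdry_off_diagonal[of k i e] ik by (simp add: J1_def min_def max_def)
  qed
  show "\<forall>i<b. even (edge_sum c i)"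
  proof (intro allI impI)
    fix i assume i: "i < b"
    have 1: "(\<Sum>k\<in>{..<b} - {i}. c (min i k, max i k)) = (\<Sum>k\<in>{..<b} - {i}. - (e (i, k) + e (k, i)))"
      using off[OF i] by (intro sum.cong) auto
    have 2: "c (i, i) = 2 * e (i, i) + (\<Sum>k\<in>{..<b} - {i}. e (i, k) + e (k, i))"
      using bspec[OF e, of "(i, i)"] bdry_diagonal[OF i, of e] i by (simp add: J1_def)
    have "edge_sum c i = 2 * e (i, i)"
      unfolding edge_sum_def 1 2 sum_negf by simp
    then show "even (edge_sum c i)"
      by simp
  qed
next
  assume ev: "\<forall>i<b. even (edge_sum c i)"
  \<comment> \<open>the cells above the diagonal remove the coefficients of the diagonals, and the cells \<open>(i, i)\<close>
      then remove the even coefficients of the edges\<close>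
  define e where "e = (\<lambda>(i, k). if i = k then edge_sum c i div 2 else if i < k then - c (i, k) else 0)"
  have "c j = bdry e j" if jJ: "j \<in> J1" for j
  proof -
    obtain p q where j: "j = (p, q)" "p \<le> q" "q < b"
      using jJ by (auto simp: J1_def)
    show ?thesis
    proof (cases "p = q")
      case True
      have "e (q, k) + e (k, q) = - c (min q k, max q k)" if "k \<noteq> q" for k
        using that by (cases "q < k") (auto simp: e_def min_def max_def)
      then have 1: "(\<Sum>k\<in>{..<b} - {q}. e (q, k) + e (k, q)) = (\<Sum>k\<in>{..<b} - {q}. - c (min q k, max q k))"
        by (intro sum.cong) auto
      have "2 * e (q, q) = edge_sum c q"
        using ev j(3) by (simp add: e_def)
      then show ?thesis
        unfolding j(1) True bdry_diagonal[OF j(3)] 1 by (simp add: edge_sum_def sum_negf)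
    next
      case False
      then have "p < q"
        using j by simp
      then show ?thesis
        unfolding j(1) using bdry_off_diagonal[of p q e] j by (simp add: e_def)
    qed
  qed
  then show "\<exists>e. \<forall>j\<in>J1. c j = bdry e j"
    by blast
qed

text \<open>
  Both groups are quotients of the group of combinations of 1-cells: the homology by sending a
  combination to its class, the other one by the parities of \<open>edge_sum\<close>.
\<close>

theorem homology_degree1:
  "relative_homology_group 1 Ysym X0 \<cong> product_group {..<b} (\<lambda>_. integer_mod_group 2)"
proof -
  let ?P = "product_group J1 (\<lambda>_. integer_group)" and ?H = "relative_homology_group 1 Ysym X0"
  let ?K = "product_group {..<b} (\<lambda>_. integer_mod_group 2)"
  let ?f = "\<lambda>c. homologous_rel_set 1 Ysym X0 (chain_comb J1 c chain1)"
  let ?g = "\<lambda>c. \<lambda>i\<in>{..<b}. edge_sum c i mod 2"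
  have cyc: "singular_relcycle 1 Ysym X0 (chain1 j)" if "j \<in> J1" for j
    using homology_X1 that by (intro relcycle_sub) (auto simp: rel_basis_def)
  have f: "group_hom ?P ?H ?f"
    using chain_comb_class_hom[OF finite_J1, of 1 Ysym X0 chain1] cyc by simp
  then interpret f: group_hom ?P ?H ?f .
  have f_surj: "?f ` carrier ?P = carrier ?H"
  proof
    show "carrier ?H \<subseteq> ?f ` carrier ?P"
    proof
      fix y assume "y \<in> carrier ?H"
      then obtain c where c: "singular_relcycle 1 Ysym X0 c" "y = homologous_rel_set 1 Ysym X0 c"
        using carrier_relative_homology_group[of 1 Ysym X0] by auto
      then obtain e where e: "homologous_rel 1 Ysym X0 c (chain_comb J1 e chain1)"
        using degree1_span by blast
      have "chain_comb J1 e chain1 = chain_comb J1 (restrict e J1) chain1"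
        by (rule chain_comb_cong) auto
      then have "y = ?f (restrict e J1)"
        using e c(2) homologous_rel_set_eq by metis
      moreover have "restrict e J1 \<in> carrier ?P"
        by auto
      ultimately show "y \<in> ?f ` carrier ?P"
        by blast
    qed
  qed (use f.hom_closed in blast)
  have in_J1: "(min i k, max i k) \<in> J1" if "i < b" "k < b" for i k
    using that by (auto simp: J1_def)
  have "?g \<in> hom ?P ?K"
  proof (rule homI)
    show "?g c \<in> carrier ?K" for c
      by (auto simp: carrier_integer_mod_group)
    fix c e
    have "edge_sum (c \<otimes>\<^bsub>?P\<^esub> e) i = edge_sum c i + edge_sum e i" if "i < b" for i
    proof -
      have "(\<Sum>k\<in>{..<b} - {i}. (c \<otimes>\<^bsub>?P\<^esub> e) (min i k, max i k))
          = (\<Sum>k\<in>{..<b} - {i}. c (min i k, max i k) + e (min i k, max i k))"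
        using in_J1[OF that] by (intro sum.cong) auto
      moreover have "(c \<otimes>\<^bsub>?P\<^esub> e) (i, i) = c (i, i) + e (i, i)"
        using in_J1[OF that that] by simp
      ultimately show ?thesis
        by (simp only: edge_sum_def sum.distrib)
    qed
    then show "?g (c \<otimes>\<^bsub>?P\<^esub> e) = ?g c \<otimes>\<^bsub>?K\<^esub> ?g e"
      by (auto simp: fun_eq_iff restrict_def mod_add_eq simp del: mult_product_group) (auto simp: mod_add_eq)
  qed
  then have g: "group_hom ?P ?K ?g"
    by (simp add: group_hom_def group_hom_axioms_def)
  have g_surj: "?g ` carrier ?P = carrier ?K"
  proof
    show "?g ` carrier ?P \<subseteq> carrier ?K"
      by (intro image_subsetI) (rule group_hom.hom_closed[OF g])
    show "carrier ?K \<subseteq> ?g ` carrier ?P"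
    proof
      fix y assume y: "y \<in> carrier ?K"
      define c where "c = (\<lambda>j\<in>J1. if fst j = snd j then y (fst j) else 0)"
      have "edge_sum c i mod 2 = y i" if i: "i < b" for i
      proof -
        have "(\<Sum>k\<in>{..<b} - {i}. c (min i k, max i k)) = 0"
          using in_J1[OF i] by (intro sum.neutral) (auto simp: c_def min_def max_def)
        moreover have "c (i, i) = y i"
          using in_J1[OF i i] by (simp add: c_def)
        moreover have "0 \<le> y i" "y i < 2"
          using y i by (auto simp: carrier_integer_mod_group PiE_iff)
        ultimately show ?thesis
          by (simp add: edge_sum_def)
      qed
      then have "?g c = y"
        using y by (auto simp: fun_eq_iff restrict_def PiE_iff extensional_def)
      moreover have "c \<in> carrier ?P"
        by (auto simp: c_def)
      ultimately show "y \<in> ?g ` carrier ?P"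
        by blast
    qed
  qed
  show ?thesis
  proof (rule iso_same_kernel[OF f f_surj g g_surj])
    fix c
    have "?f c = \<one>\<^bsub>?H\<^esub> \<longleftrightarrow> singular_relboundary 1 Ysym X0 (chain_comb J1 c chain1)"
      using one_relative_homology_group[of 1 Ysym X0] homologous_rel_set_eq_relboundary[of 1 Ysym X0] by simp
    also have "\<dots> \<longleftrightarrow> (\<forall>i<b. even (edge_sum c i))"
      unfolding degree1_relation by (rule bdry_image_iff)
    also have "\<dots> \<longleftrightarrow> ?g c = \<one>\<^bsub>?K\<^esub>"
      by (auto simp: fun_eq_iff restrict_def even_iff_mod_2_eq_zero)
    finally show "?f c = \<one>\<^bsub>?H\<^esub> \<longleftrightarrow> ?g c = \<one>\<^bsub>?K\<^esub>" .
  qed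
qed

end

section \<open>Configurations on a graph\<close>

lemma trivial_group_iso_singleton:
  assumes "trivial_group H"
  shows "H \<cong> singleton_group x"
proof (rule is_isoI)
  show "(\<lambda>_. x) \<in> iso H (singleton_group x)"
    using assms by (auto simp: trivial_group_def iso_def hom_def bij_betw_def singleton_group_def)
qed

lemma graph_space_eq_complex_top:
  assumes "pair_graph G"
  shows "graph_space G = complex_top (pverts G) (edge_set G)"
proof -
  interpret pair_graph G by fact
  let ?V = "pverts G" and ?E = "edge_set G"
  let ?S = "unit_vec ` ?V \<union> {edge_point u v t | u v t. (u, v) \<in> parcs G \<and> 0 \<le> t \<and> t \<le> 1}"
  have fin: "finite ?V"
    by (rule pair_finite_verts)
  have arc: "u \<in> ?V" "v \<in> ?V" "u \<noteq> v" "{u, v} \<in> ?E" if "(u, v) \<in> parcs G" for u v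
    using that in_arcsD1 in_arcsD2 pair_no_loops[of "(u, v)"] by (auto simp: edge_set_def)
  have "?S = complex_points ?V ?E"
  proof
    show "?S \<subseteq> complex_points ?V ?E"
    proof
      fix x assume "x \<in> ?S"
      then consider v where "v \<in> ?V" "x = unit_vec v"
        | u v t where "(u, v) \<in> parcs G" "0 \<le> t" "t \<le> 1" "x = edge_point u v t"
        by auto
      then show "x \<in> complex_points ?V ?E"
      proof cases
        case 1
        then show ?thesis
          using fin by (auto simp: complex_points_def complex_faces_def unit_vec_def)
      next
        case 2
        then show ?thesis
          using fin arc[OF 2(1)]
          by (auto simp: complex_points_def complex_faces_def edge_point_apply sum.distrib intro!: bexI[of _ "{u, v}"])
      qed
    qed
    show "complex_points ?V ?E \<subseteq> ?S"
    proof
      fix x assume x: "x \<in> complex_points ?V ?E"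
      then obtain s where s: "s \<in> complex_faces ?V ?E" "\<And>v. v \<notin> s \<Longrightarrow> x v = 0"
        and x0: "\<And>v. 0 \<le> x v" and x1: "(\<Sum>v\<in>?V. x v) = 1"
        by (auto simp: complex_points_def)
      from s(1) consider v where "v \<in> ?V" "s = {v}" | u v where "(u, v) \<in> parcs G" "s = {u, v}"
        by (auto simp: complex_faces_def edge_set_def)
      then show "x \<in> ?S"
      proof cases
        case 1
        have "(\<Sum>u\<in>?V. x u) = (\<Sum>u\<in>{v}. x u)"
          using 1 s(2) fin by (intro sum.mono_neutral_right) auto
        then have "x = unit_vec v"
          using x1 s(2) 1(2) by (auto simp: unit_vec_def fun_eq_iff)
        then show ?thesis
          using 1 by blast
      next
        case 2
        have "(\<Sum>u\<in>?V. x u) = (\<Sum>u\<in>{u, v}. x u)"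
          using 2 s(2) fin arc[OF 2(1)] by (intro sum.mono_neutral_right) auto
        then have uv: "x u + x v = 1"
          using x1 arc[OF 2(1)] by simp
        then have "x = edge_point u v (x v)"
          using s(2) 2(2) arc[OF 2(1)] by (auto simp: edge_point_apply fun_eq_iff)
        moreover have "0 \<le> x v" "x v \<le> 1"
          using x0[of v] x0[of u] uv by auto
        ultimately show ?thesis
          using 2(1) by blast
      qed
    qed
  qed
  then show ?thesis
    by (simp add: graph_space_def complex_top_def)
qed

text \<open>
  A set of vertices that no edge leaves is closed under reachability.
\<close>

lemma connected_crossing_edge:
  assumes G: "pair_graph G" and conn: "Digraph_Component.connected (with_proj G)"
    and S: "S \<subseteq> pverts G" "S \<noteq> {}" "S \<noteq> pverts G"
  shows "\<exists>u\<in>S. \<exists>v\<in>pverts G - S. {u, v} \<in> edge_set G"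
proof (rule ccontr)
  assume n: "\<not> (\<exists>u\<in>S. \<exists>v\<in>pverts G - S. {u, v} \<in> edge_set G)"
  interpret pair_graph G by fact
  obtain u v where u: "u \<in> S" and v: "v \<in> pverts G" "v \<notin> S"
    using S by blast
  have step: "y \<in> S" if "x \<in> S" "(x, y) \<in> parcs (mk_symmetric (with_proj G))" for x y
  proof -
    have "(x, y) \<in> parcs G \<or> (y, x) \<in> parcs G"
      using that(2) by (auto simp: mk_symmetric_def)
    then have "{x, y} \<in> edge_set G" "y \<in> pverts G"
      using in_arcsD1 in_arcsD2 by (auto simp: edge_set_def insert_commute image_iff)
    then show ?thesis
      using n that(1) by blast
  qed
  have "u \<rightarrow>\<^sup>*\<^bsub>with_proj (mk_symmetric (with_proj G))\<^esub> v"
    using conn u v S(1) by (auto simp: connected_def strongly_connected_def)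
  then have "(u, v) \<in> rtrancl_on (pverts (mk_symmetric (with_proj G))) (parcs (mk_symmetric (with_proj G)))"
    by (simp add: reachable_def)
  then have "v \<in> S"
    by (induction rule: rtrancl_on_induct) (use u step in auto)
  then show False
    using v by simp
qed

theorem theorem3p4:
  fixes G :: "'v pair_pre_digraph" and n :: int
  assumes "pair_graph G" and "Digraph_Component.connected (with_proj G)"
  defines "b1 \<equiv> first_betti G"
  shows "BM_homology_group n (config2 (graph_space G)) \<cong>
    (if n = 2 then product_group {..<b1 * (b1 - 1) div 2} (\<lambda>_. integer_group)
     else if n = 1 then product_group {..<b1} (\<lambda>_. integer_mod_group 2)
     else singleton_group undefined)"
proof (cases "n < 0")
  case True
  then show ?thesis
    using trivial_group_iso_singleton[OF trivial_singleton_group] by (simp add: BM_homology_group_def)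
next
  case False
  interpret pair_graph G by fact
  let ?V = "pverts G" and ?E = "edge_set G"
  have ne: "?V \<noteq> {}"
    using assms(2) by (auto simp: connected_def strongly_connected_def)
  interpret graph_complex ?V ?E
  proof
    show "finite ?V"
      by (rule pair_finite_verts)
    fix e assume "e \<in> ?E"
    then obtain u v where uv: "(u, v) \<in> parcs G" "e = {u, v}"
      by (auto simp: edge_set_def)
    have "u \<in> ?V" "v \<in> ?V" "u \<noteq> v"
      using in_arcsD1[OF uv(1)] in_arcsD2[OF uv(1)] pair_no_loops[OF uv(1)] by auto
    then show "\<exists>u\<in>?V. \<exists>v\<in>?V. u \<noteq> v \<and> e = {u, v}"
      using uv(2) by blast
  qed
  obtain F where forest: "F \<subseteq> ?E" "card F + 1 = card ?V" "contractible_space (complex_top ?V F)"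
    using contractible_spanning_tree[OF ne connected_crossing_edge[OF assms(1,2)]] by blast
  \<comment> \<open>the number of edges outside the tree is the first Betti number\<close>
  have "card (?E - F) = card ?E - card F"
    using forest(1) finE by (intro card_Diff_subset) (auto intro: finite_subset)
  then have card: "card (?E - F) = b1"
    using forest(2) by (simp add: b1_def first_betti_def)
  obtain h where h: "bij_betw h {0..<card (?E - F)} (?E - F)"
    using ex_bij_betw_nat_finite[of "?E - F"] finE by auto
  have "\<exists>u v. h i = {u, v}" if "i < b1" for i
  proof -
    have "h i \<in> ?E - F"
      using h that card by (auto simp: bij_betw_def)
    then show ?thesis
      using edge[of "h i"] by blast
  qed
  then obtain a w where aw: "\<And>i. i < b1 \<Longrightarrow> h i = {a i, w i}"
    by metis
  have enum: "bij_betw (\<lambda>i. {a i, w i}) {..<b1} (?E - F)"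
    using h aw unfolding card atLeast0LessThan by (subst bij_betw_cong[of _ _ h]) auto
  obtain v where v: "v \<in> ?V"
    using ne by blast
  interpret graph_cells ?V ?E F b1 a w "unit_vec v"
  proof
    show "unit_vec v \<in> complex_points ?V F"
      using v finV by (auto simp: complex_points_def complex_faces_def unit_vec_def)
  qed (use forest enum in auto)
  have n: "n = int (nat n)"
    using False by simp
  have "BM_homology_group n (config2 (graph_space G)) \<cong> relative_homology_group n Ysym X0"
    using BM_homology_config2_tree[OF forest(1,3), of "nat n"] n
    unfolding X0_def graph_space_eq_complex_top[OF assms(1)] by simp
  moreover have "relative_homology_group n Ysym X0 \<cong>
    (if n = 2 then product_group {..<b1 * (b1 - 1) div 2} (\<lambda>_. integer_group)
     else if n = 1 then product_group {..<b1} (\<lambda>_. integer_mod_group 2)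
     else singleton_group undefined)"
  proof -
    consider "n = 2" | "n = 1" | "n \<noteq> 1" "n \<noteq> 2"
      by blast
    then show ?thesis
    proof cases
      case 3
      then have "rel_acyclic (nat n) Ysym X0"
        using False by (intro rel_acyclic_filtration) auto
      then have "trivial_group (relative_homology_group n Ysym X0)"
        using n unfolding rel_acyclic_iff_trivial by simp
      then show ?thesis
        using 3 trivial_group_iso_singleton by auto
    qed (use homology_degree2 homology_degree1 in auto)
  qed
  ultimately show ?thesis
    by (rule iso_trans)
qed

end
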